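(* For every integer $h\ge2$ and every $D>0$: (a) if $\alpha\ge1$, then $\lim_{C\downarrow0}\Phi^{\mathbb Z}_{\alpha,1,D,h}(C)\log\frac1C=(h\alpha-1)D$; (b) if $\alpha\ge1$ and $\beta>1$, then $\lim_{C\downarrow0}\Phi^{\mathbb Z}_{\alpha,\beta,D,h}(C)=1-e^{-(\beta-1)D/\beta}$; (c) if $0<\beta<1$ and $\alpha\ge\beta$, then there are constants $0<c_1\le c_2<\infty$ depending only on $\alpha,\beta,D,h$ such that $c_1C^{\Theta}\le\Phi^{\mathbb Z}_{\alpha,\beta,D,h}(C)\le c_2C^{\Theta}$ for all sufficiently small $C>0$, where $\Theta=\min\bigl\{\frac1{h\alpha},\frac{1-\beta}{h\alpha-\beta}\bigr\}$.
   Context: For $A\subset\mathbb Z$, $\mathcal U_h(A)$ is the set of multisets of size $h$ with elements in $A$, and $s(u)$ is the sum of $u$ counted with multiplicity. A set $B\subset\mathbb Z$ is a $B_h$ set if $s$ is injective on $\mathcal U_h(B)$. Let $X$ be an integer-valued random variable with support $A$, $X_1,\dots,X_h$ independent copies, $U_h=\{X_1,\dots,X_h\}$ (random multiset) and $S_h=X_1+\dots+X_h$. For discrete $Y$ and $\alpha>0$, $\alpha\ne1$, $M_\alpha(Y)=\sum_y\mathbb P(Y=y)^\alpha$ and $H_\alpha(Y)=\frac{\log M_\alpha(Y)}{1-\alpha}$; $H_1=H$ is Shannon entropy; logarithms are natural. $\Delta_{\alpha,h}(X)=H_\alpha(U_h)-H_\alpha(S_h)$; $\delta_h(X)=1-\sup\{\mathbb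 P(X\in B):B\subset A\text{ is a }B_h\text{ set}\}$; $$\Phi^{\mathbb Z}_{\alpha,\beta,D,h}(C)=\sup\{\delta_h(X):X\text{ integer-valued},\ \Delta_{\alpha,h}(X)\le C,\ H_\beta(X)\le D\},$$ the supremum being over those $X$ for which the deficit is defined, i.e. $M_\alpha(U_h)<\infty$ if $\alpha\ne1$ and $H(X)<\infty$ if $\alpha=1$. *)

theory Defs
  imports "HOL-Probability.Probability"
begin

text \<open>
  A discrete random variable enters only through its law, so an integer-valued \<open>X\<close> is
  represented by an \<open>int pmf\<close>; its support is \<^const>\<open>set_pmf\<close>.
\<close>

definition Bh_set :: "nat \<Rightarrow> int set \<Rightarrow> bool" where
  "Bh_set h B \<longleftrightarrow> inj_on sum_mset (multisets_of_size B h)"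

definition U_law :: "nat \<Rightarrow> int pmf \<Rightarrow> int multiset pmf" where
  "U_law h X = map_pmf mset (replicate_pmf h X)"

definition S_law :: "nat \<Rightarrow> int pmf \<Rightarrow> int pmf" where
  "S_law h X = map_pmf sum_list (replicate_pmf h X)"

text \<open>
  Both the power sum and the entropies may be infinite, so they take extended values.
  The conventions \<open>0 powr \<alpha> = 0\<close> and \<open>0 * ln 0 = 0\<close> make the sums over the whole type agree
  with the sums over the support.
\<close>

definition power_sum :: "real \<Rightarrow> 'a pmf \<Rightarrow> ennreal" where
  "power_sum \<alpha> Y = (\<integral>\<^sup>+ y. ennreal (pmf Y y powr \<alpha>) \<partial>count_space UNIV)"

definition shannon_entropy :: "'a pmf \<Rightarrow> ereal" where
  "shannon_entropy Y =
     enn2ereal (\<integral>\<^sup>+ y. ennreal (- (pmf Y y * ln (pmf Y y))) \<partial>count_space UNIV)"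

text \<open>
  The power sum is never 0, and it can be infinite only for \<open>\<alpha> < 1\<close>, where \<open>1 - \<alpha> > 0\<close>;
  hence the value \<open>\<infinity>\<close> in that case.
\<close>

definition renyi_entropy :: "real \<Rightarrow> 'a pmf \<Rightarrow> ereal" where
  "renyi_entropy \<alpha> Y =
     (if \<alpha> = 1 then shannon_entropy Y
      else if power_sum \<alpha> Y = \<infinity> then \<infinity>
      else ereal (ln (enn2real (power_sum \<alpha> Y)) / (1 - \<alpha>)))"

definition deficit_defined :: "real \<Rightarrow> nat \<Rightarrow> int pmf \<Rightarrow> bool" where
  "deficit_defined \<alpha> h X \<longleftrightarrow>
     (if \<alpha> = 1 then shannon_entropy X < \<infinity> else power_sum \<alpha> (U_law h X) < \<infinity>)"

text \<open>
  Only meaningful under \<^const>\<open>deficit_defined\<close>, which makes both terms finite.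
\<close>

definition deficit :: "real \<Rightarrow> nat \<Rightarrow> int pmf \<Rightarrow> ereal" where
  "deficit \<alpha> h X = renyi_entropy \<alpha> (U_law h X) - renyi_entropy \<alpha> (S_law h X)"

definition Bh_defect :: "nat \<Rightarrow> int pmf \<Rightarrow> real" where
  "Bh_defect h X = 1 - Sup {measure_pmf.prob X B | B. B \<subseteq> set_pmf X \<and> Bh_set h B}"

text \<open>
  For \<open>C \<ge> 0\<close> and \<open>D \<ge> 0\<close> the set below contains 0 (point masses) and is bounded by 1,
  so the real-valued supremum is the genuine one.
\<close>

definition Phi :: "real \<Rightarrow> real \<Rightarrow> real \<Rightarrow> nat \<Rightarrow> real \<Rightarrow> real" where
  "Phi \<alpha> \<beta> D h C =
     Sup {Bh_defect h X | X. deficit_defined \<alpha> h X \<and> deficit \<alpha> h X \<le> ereal C \<and>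
                             renyi_entropy \<beta> X \<le> ereal D}"

end

theory Submission
  imports Defs
    "HOL-Computational_Algebra.Computational_Algebra"
    "HOL-Number_Theory.Cong"
    "HOL-Real_Asymp.Real_Asymp"
begin

text \<open>
  Write \<open>f(x) = x\<^sup>\<alpha>\<close> for \<open>\<alpha> > 1\<close>, \<open>f(x) = - x\<^sup>\<alpha>\<close> for \<open>\<alpha> < 1\<close> and \<open>f(x) = x ln x\<close> for
  \<open>\<alpha> = 1\<close>. Then \<open>f(x + y) - f(x) - f(y)\<close> is at least a constant times \<open>min(x, y)\<^sup>\<alpha>\<close>. Merging
  colliding multisets one at a time, every collision contributes to the deficit. If a \<open>B\<^sub>h\<close>
  set is carved out of the atoms of mass \<open>\<ge> t\<close> by repeatedly deleting the lightest atom of a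
  collision, each deleted atom \<open>a\<close> therefore costs a deficit of order \<open>P(a)\<^bsup>h\<alpha>\<^esup>\<close>. Hence the
  defect is at most the mass of the atoms lighter than \<open>t\<close> plus a term of order \<open>C t\<^bsup>1 - h\<alpha>\<^esup>\<close>
  (or \<open>C\<^bsup>1/(h\<alpha>)\<^esup>\<close> if \<open>h\<alpha> < 1\<close>), and the entropy constraint controls the light mass.

  Conversely, put mass \<open>t\<close> on each point of \<open>m\<close> groups and the rest on 0, where each group is a
  copy of the curve \<open>x \<mapsto> (x, \<dots>, x\<^bsup>h-1\<^esup>)\<close> modulo a prime \<open>p\<close>. Power sums up to order
  \<open>h - 1\<close> determine fewer than \<open>h\<close> points by Newton's identities, so the only collisions are
  those of \<open>h\<close> points of one group, which are as light as possible; yet by counting sums a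
  \<open>B\<^sub>h\<close> subset contains only a vanishing fraction of a group as \<open>p\<close> grows.
\<close>

section \<open>Gain of a pushforward\<close>

text \<open>Where the exponents come from: up to constants an extremal law puts mass m t on m atoms
  of mass t. Collisions confined to h points of one group cost a deficit of order m t^(h \<alpha>).
  The entropy budget charges about m t ln(1/t) if \<beta> = 1 and m t^\<beta> if \<beta> < 1; if
  \<beta> > 1, one heavy atom already satisfies it. Maximising m t under both budgets gives t^(h
  \<alpha> - 1) ~ C and mass D / ln(1/t) ~ (h \<alpha> - 1) D / ln(1/C) for \<beta> = 1. For \<beta>
  < 1, taking m ~ t^(-\<beta>) gives the exponent (1 - \<beta>) / (h \<alpha> - \<beta>) and m = 1
  gives 1 / (h \<alpha>); the switch is at h \<alpha> = 1. The obstacle is that (a) and (b) ask for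
  exact constants. Almost all the mass of a group must be lost, so a group may contain no large B_h
  subset; yet no collision may involve the heavy atom 0, which would make the deficit much larger
  than t^(h \<alpha>) per group. The moment curve meets both demands, and since the group size
  depends only on h and the tolerated fraction \<epsilon>, it affects only constants when m and t
  vary.\<close>

definition ent_term :: "real \<Rightarrow> real \<Rightarrow> real" where
  "ent_term \<alpha> x = (if \<alpha> = 1 then - (x * ln x) else x powr \<alpha>)"

definition superadd_term :: "real \<Rightarrow> real \<Rightarrow> real" where
  "superadd_term \<alpha> x = (if \<alpha> \<le> 1 then - ent_term \<alpha> x else ent_term \<alpha> x)"

definition superadd_gap :: "real \<Rightarrow> real" where
  "superadd_gap \<alpha> = (if \<alpha> = 1 then ln 2 else \<bar>2 powr (\<alpha> - 1) - 1\<bar>)"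

lemma superadd_gap_pos: "superadd_gap \<alpha> > 0"
  by (auto simp: superadd_gap_def)

lemma ent_term_0 [simp]: "ent_term \<alpha> 0 = 0" and superadd_term_0 [simp]: "superadd_term \<alpha> 0 = 0"
  by (auto simp: ent_term_def superadd_term_def)

lemma ent_term_nonneg: "0 \<le> x \<Longrightarrow> x \<le> 1 \<Longrightarrow> 0 \<le> ent_term \<alpha> x"
  by (cases "x = 0") (auto simp: ent_term_def mult_nonneg_nonpos)

text \<open>Write f(x) = x \<psi>(x), where \<psi> is increasing: ln x, or x^(\<alpha>-1) with the
  sign of \<alpha> - 1. Then x \<psi>(x+y) >= x \<psi>(2x) and y \<psi>(x+y) >= y \<psi>(y), and the
  constant is x (\<psi>(2x) - \<psi>(x)) divided by x^\<alpha>, half of the exact value at x =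
  y.\<close>

lemma superadd_term_gap_aux:
  assumes "0 < \<alpha>" "0 < x" "x \<le> y"
  shows "superadd_gap \<alpha> * x powr \<alpha> \<le> superadd_term \<alpha> (x + y) - superadd_term \<alpha> x - superadd_term \<alpha> y"
proof -
  have split: "z powr \<alpha> = z * z powr (\<alpha> - 1)" if "z > 0" for z :: real
    using that by (simp add: powr_diff)
  have two: "(2 * x) powr (\<alpha> - 1) = 2 powr (\<alpha> - 1) * x powr (\<alpha> - 1)"
    using assms by (simp add: powr_mult)
  have y: "y > 0" "2 * x \<le> x + y" "y \<le> x + y" using assms by auto
  consider "\<alpha> = 1" | "\<alpha> > 1" | "\<alpha> < 1" by linarith
  then show ?thesis
  proof cases
    case 1
    have "x * ln (2 * x) + y * ln y \<le> x * ln (x + y) + y * ln (x + y)"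
      using assms y by (intro add_mono mult_left_mono) auto
    moreover have "ln (2 * x) = ln 2 + ln x" using assms by (simp add: ln_mult)
    ultimately show ?thesis using 1 assms by (simp add: superadd_gap_def superadd_term_def ent_term_def algebra_simps)
  next
    case 2
    have "x * (2 * x) powr (\<alpha> - 1) + y * y powr (\<alpha> - 1)
        \<le> x * (x + y) powr (\<alpha> - 1) + y * (x + y) powr (\<alpha> - 1)"
      using assms y 2 by (intro add_mono mult_left_mono powr_mono2) auto
    also have "\<dots> = (x + y) powr \<alpha>" using assms y by (simp add: split algebra_simps)
    finally have *: "x powr \<alpha> * 2 powr (\<alpha> - 1) + y powr \<alpha> \<le> (x + y) powr \<alpha>"
      using assms y by (simp only: two split) (simp add: algebra_simps)
    have "superadd_gap \<alpha> = 2 powr (\<alpha> - 1) - 1"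
      using 2 ge_one_powr_ge_zero[of 2 "\<alpha> - 1"] by (simp add: superadd_gap_def)
    then have "superadd_gap \<alpha> * x powr \<alpha> = x powr \<alpha> * 2 powr (\<alpha> - 1) - x powr \<alpha>"
      by (simp only:) (simp add: algebra_simps)
    then show ?thesis using * 2 by (simp add: superadd_term_def ent_term_def)
  next
    case 3
    have "x * (2 * x) powr (\<alpha> - 1) + y * y powr (\<alpha> - 1)
        \<ge> x * (x + y) powr (\<alpha> - 1) + y * (x + y) powr (\<alpha> - 1)"
      using assms y 3 by (intro add_mono mult_left_mono powr_mono2') auto
    also have "x * (x + y) powr (\<alpha> - 1) + y * (x + y) powr (\<alpha> - 1) = (x + y) powr \<alpha>"
      using assms y by (simp add: split algebra_simps)
    finally have *: "x powr \<alpha> * 2 powr (\<alpha> - 1) + y powr \<alpha> \<ge> (x + y) powr \<alpha>"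
      using assms y by (simp only: two split) (simp add: algebra_simps)
    have "2 powr (\<alpha> - 1) \<le> (2::real) powr 0" using 3 by (intro powr_mono) auto
    then have "superadd_gap \<alpha> = 1 - 2 powr (\<alpha> - 1)" using 3 by (simp add: superadd_gap_def)
    then have "superadd_gap \<alpha> * x powr \<alpha> = x powr \<alpha> - x powr \<alpha> * 2 powr (\<alpha> - 1)"
      by (simp only:) (simp add: algebra_simps)
    then show ?thesis using * 3 by (simp add: superadd_term_def ent_term_def)
  qed
qed

lemma superadd_term_gap:
  assumes "0 < \<alpha>" "0 \<le> x" "0 \<le> y"
  shows "superadd_gap \<alpha> * min x y powr \<alpha> \<le> superadd_term \<alpha> (x + y) - superadd_term \<alpha> x - superadd_term \<alpha> y"
proof -
  consider "x = 0" | "y = 0" | "0 < x" "x \<le> y" | "0 < y" "y \<le> x" using assms by linarith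
  then show ?thesis
  proof cases
    case 3
    then show ?thesis using superadd_term_gap_aux[of \<alpha> x y] assms by simp
  next
    case 4
    then show ?thesis using superadd_term_gap_aux[of \<alpha> y x] assms by (simp add: add.commute)
  qed (use assms in auto)
qed

section \<open>Merging finitely many atoms along a map\<close>

definition fiber_mass :: "('a \<Rightarrow> 'b) \<Rightarrow> 'a pmf \<Rightarrow> 'a set \<Rightarrow> 'b \<Rightarrow> real" where
  "fiber_mass g Y V s = (\<Sum>u\<in>{u\<in>V. g u = s}. pmf Y u)"

text \<open>Restricting to a finite \<open>V\<close> keeps this a real number even when the
  entropies of \<open>Y\<close> and of its image are infinite, and gives a quantity that grows as
  atoms are added one by one.\<close>

definition gain :: "real \<Rightarrow> ('a \<Rightarrow> 'b) \<Rightarrow> 'a pmf \<Rightarrow> 'a set \<Rightarrow> real" where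
  "gain \<alpha> g Y V = (\<Sum>s\<in>g ` V. superadd_term \<alpha> (fiber_mass g Y V s)) - (\<Sum>u\<in>V. superadd_term \<alpha> (pmf Y u))"

lemma fiber_mass_nonneg: "0 \<le> fiber_mass g Y V s"
  unfolding fiber_mass_def by (intro sum_nonneg) auto

lemma fiber_mass_le: "finite V \<Longrightarrow> v \<in> V \<Longrightarrow> pmf Y v \<le> fiber_mass g Y V (g v)"
  unfolding fiber_mass_def by (rule member_le_sum) auto

lemma fiber_mass_measure: "finite V \<Longrightarrow> fiber_mass g Y V s = measure_pmf.prob Y (V \<inter> g -` {s})"
  unfolding fiber_mass_def
  by (subst measure_measure_pmf_finite) (auto intro!: sum.cong)

lemma fiber_mass_outside: "s \<notin> g ` V \<Longrightarrow> fiber_mass g Y V s = 0"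
  unfolding fiber_mass_def by (rule sum.neutral) auto

text \<open>The new atom changes only its own fiber, where it merges with the mass already present;
  the bracket is exactly what \<open>superadd_term_gap\<close> bounds from below.\<close>

lemma gain_insert:
  assumes "finite V" "u \<notin> V"
  shows "gain \<alpha> g Y (insert u V) = gain \<alpha> g Y V +
     (superadd_term \<alpha> (pmf Y u + fiber_mass g Y V (g u)) - superadd_term \<alpha> (pmf Y u) - superadd_term \<alpha> (fiber_mass g Y V (g u)))"
proof -
  have same: "fiber_mass g Y (insert u V) (g u) = pmf Y u + fiber_mass g Y V (g u)"
  proof -
    have "{v \<in> insert u V. g v = g u} = insert u {v\<in>V. g v = g u}" by auto
    then show ?thesis using assms by (simp add: fiber_mass_def)
  qed
  have diff: "fiber_mass g Y (insert u V) s = fiber_mass g Y V s" if "s \<noteq> g u" for s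
    unfolding fiber_mass_def using that by (intro sum.cong) auto
  have "(\<Sum>s\<in>g ` insert u V. superadd_term \<alpha> (fiber_mass g Y (insert u V) s))
      = superadd_term \<alpha> (pmf Y u + fiber_mass g Y V (g u)) + (\<Sum>s\<in>g ` V - {g u}. superadd_term \<alpha> (fiber_mass g Y V s))"
    using assms by (simp add: sum.insert_remove same diff)
  \<comment> \<open>If \<open>g u\<close> is a new value its old fiber has mass 0 and contributes
    \<open>superadd_term \<alpha> 0 = 0\<close>, so the same identity covers both cases.\<close>
  moreover have "(\<Sum>s\<in>g ` V. superadd_term \<alpha> (fiber_mass g Y V s))
      = superadd_term \<alpha> (fiber_mass g Y V (g u)) + (\<Sum>s\<in>g ` V - {g u}. superadd_term \<alpha> (fiber_mass g Y V s))"
    using assms by (cases "g u \<in> g ` V") (auto simp: sum.remove fiber_mass_outside)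
  ultimately show ?thesis using assms by (simp add: gain_def)
qed

lemma gain_insert_ge:
  assumes "0 < \<alpha>" "finite V"
  shows "gain \<alpha> g Y V \<le> gain \<alpha> g Y (insert u V)"
proof (cases "u \<in> V")
  case False
  have "0 \<le> superadd_gap \<alpha> * min (pmf Y u) (fiber_mass g Y V (g u)) powr \<alpha>" using superadd_gap_pos[of \<alpha>] by simp
  then show ?thesis
    using superadd_term_gap[OF assms(1), of "pmf Y u" "fiber_mass g Y V (g u)"] fiber_mass_nonneg[of g Y V "g u"]
    by (simp add: gain_insert[OF assms(2) False])
qed (simp add: insert_absorb)

lemma gain_mono:
  assumes "0 < \<alpha>" "finite W" "V \<subseteq> W"
  shows "gain \<alpha> g Y V \<le> gain \<alpha> g Y W"
proof -
  have "gain \<alpha> g Y V \<le> gain \<alpha> g Y (V \<union> Z)" if "finite Z" for Z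
    using that
  proof (induction Z)
    case (insert z Z)
    have "finite (V \<union> Z)" using assms insert finite_subset by blast
    then show ?case using gain_insert_ge[OF assms(1), of "V \<union> Z" g Y z] insert by simp
  qed auto
  from this[of "W - V"] show ?thesis using assms by (simp add: Un_absorb1)
qed

lemma gain_empty [simp]: "gain \<alpha> g Y {} = 0" by (simp add: gain_def)

lemma gain_nonneg: "0 < \<alpha> \<Longrightarrow> finite V \<Longrightarrow> 0 \<le> gain \<alpha> g Y V"
  using gain_mono[of \<alpha> V "{}" g Y] by simp

text \<open>Add \<open>u\<close> last: its fiber then already contains \<open>v\<close>, so the
  insertion merges two masses of at least \<open>q\<close>. Shrinking to \<open>W\<close> is free by
  monotonicity, so an induction may drop many elements at once while charging for a single
  one.\<close>

lemma gain_collision: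
  assumes "0 < \<alpha>" "finite V" "u \<in> V" "v \<in> V" "u \<noteq> v" "g u = g v" "W \<subseteq> V - {u}"
    and "0 \<le> q" "q \<le> pmf Y u" "q \<le> pmf Y v"
  shows "gain \<alpha> g Y W + superadd_gap \<alpha> * q powr \<alpha> \<le> gain \<alpha> g Y V"
proof -
  let ?V = "V - {u}" and ?y = "fiber_mass g Y (V - {u}) (g u)"
  have "pmf Y v \<le> ?y" using fiber_mass_le[of ?V v Y g] assms by simp
  then have "q powr \<alpha> \<le> min (pmf Y u) ?y powr \<alpha>"
    using assms by (intro powr_mono2) auto
  then have "superadd_gap \<alpha> * q powr \<alpha> \<le> superadd_gap \<alpha> * min (pmf Y u) ?y powr \<alpha>"
    using superadd_gap_pos[of \<alpha>] by simp
  also have "\<dots> \<le> gain \<alpha> g Y V - gain \<alpha> g Y ?V"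
    using superadd_term_gap[OF assms(1), of "pmf Y u" ?y] fiber_mass_nonneg[of g Y ?V "g u"]
      gain_insert[of ?V u \<alpha> g Y] assms by (simp add: insert_absorb)
  finally show ?thesis using gain_mono[OF assms(1) _ assms(7), of g Y] assms(2) by simp
qed

section \<open>From finite sets to countable support\<close>

definition ent_sum :: "real \<Rightarrow> 'a pmf \<Rightarrow> ennreal" where
  "ent_sum \<alpha> Y = (\<integral>\<^sup>+ y. ennreal (ent_term \<alpha> (pmf Y y)) \<partial>count_space UNIV)"

lemma nn_integral_finite_support:
  assumes "finite V" "\<And>x. x \<notin> V \<Longrightarrow> F x = 0" "\<And>x. 0 \<le> F x"
  shows "(\<integral>\<^sup>+ x. ennreal (F x) \<partial>count_space UNIV) = ennreal (\<Sum>x\<in>V. F x)"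
proof -
  have "(\<integral>\<^sup>+ x. ennreal (F x) \<partial>count_space UNIV) = (\<Sum>x\<in>V. ennreal (F x))"
    by (rule nn_integral_count_space'[OF assms(1)]) (auto simp: assms(2))
  then show ?thesis using assms by (simp add: sum_ennreal)
qed

lemma exhaustion:
  fixes Y :: "'a pmf"
  assumes "finite V"
  obtains W :: "nat \<Rightarrow> 'a set" where "\<And>n. finite (W n)" "\<And>n. V \<subseteq> W n" "incseq W"
    "set_pmf Y \<subseteq> (\<Union>n. W n)"
proof
  let ?W = "\<lambda>n. V \<union> from_nat_into (set_pmf Y) ` {..n}"
  show "finite (?W n)" "V \<subseteq> ?W n" for n using assms by auto
  show "incseq ?W" by (auto simp: incseq_def)
  have "set_pmf Y = range (from_nat_into (set_pmf Y))"
    by (rule range_from_nat_into[symmetric]) (auto simp: set_pmf_not_empty)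
  then have "x \<in> (\<Union>n. ?W n)" if x: "x \<in> set_pmf Y" for x
  proof -
    obtain k where "x = from_nat_into (set_pmf Y) k"
      using x \<open>set_pmf Y = range (from_nat_into (set_pmf Y))\<close> by auto
    then have "x \<in> ?W k" by auto
    then show ?thesis by blast
  qed
  then show "set_pmf Y \<subseteq> (\<Union>n. ?W n)" by blast
qed

lemma fiber_mass_le_1: "finite V \<Longrightarrow> fiber_mass g Y V s \<le> 1"
  by (simp add: fiber_mass_measure)

lemma fiber_mass_tendsto:
  assumes "\<And>n. finite (W n)" "incseq W" "set_pmf Y \<subseteq> (\<Union>n. W n)"
  shows "(\<lambda>n. fiber_mass g Y (W n) s) \<longlonglongrightarrow> pmf (map_pmf g Y) s"
proof -
  have "(\<lambda>n. measure_pmf.prob Y (W n \<inter> g -` {s})) \<longlonglongrightarrow> measure_pmf.prob Y (\<Union>n. W n \<inter> g -` {s})"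
    using assms(2) by (intro measure_pmf.finite_Lim_measure_incseq) (auto simp: incseq_def)
  also have "measure_pmf.prob Y (\<Union>n. W n \<inter> g -` {s}) = measure_pmf.prob Y (g -` {s})"
    using assms(3) by (intro measure_pmf.finite_measure_eq_AE) (auto simp: AE_measure_pmf_iff)
  finally show ?thesis using assms(1) by (simp add: fiber_mass_measure pmf_map)
qed

lemma ent_term_tendsto:
  assumes "(x \<longlongrightarrow> a) F" "a > 0"
  shows "((\<lambda>n. ent_term \<alpha> (x n)) \<longlongrightarrow> ent_term \<alpha> a) F"
  using assms by (auto simp: ent_term_def intro!: tendsto_intros)

lemma fiber_mass_le_pmf: "finite V \<Longrightarrow> fiber_mass g Y V s \<le> pmf (map_pmf g Y) s"
  by (auto simp: fiber_mass_measure pmf_map intro!: measure_pmf.finite_measure_mono)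

lemma fiber_mass_eq_0:
  assumes "finite V" "pmf (map_pmf g Y) s = 0"
  shows "fiber_mass g Y V s = 0"
  using fiber_mass_le_pmf[OF assms(1), of g Y s] fiber_mass_nonneg[of g Y V s] assms(2) by simp

text \<open>Stated as a sum because both values of \<open>ent_sum\<close> may be infinite. On each
  \<open>W n\<close> the bound is a finite identity. Fatou is applied on the image side:
  \<open>ent_term 1\<close> is not monotone, so truncated fiber masses cannot be compared with the
  full ones term by term.\<close>

lemma gain_bound_le_1:
  assumes "0 < \<alpha>" "\<alpha> \<le> 1" "finite V"
  shows "ent_sum \<alpha> (map_pmf g Y) + ennreal (gain \<alpha> g Y V) \<le> ent_sum \<alpha> Y"
proof -
  obtain W where W: "\<And>n. finite (W n)" "\<And>n. V \<subseteq> W n" "incseq W" "set_pmf Y \<subseteq> (\<Union>n. W n)"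
    using exhaustion[OF assms(3)] by metis
  have conv: "(\<lambda>n. ennreal (ent_term \<alpha> (fiber_mass g Y (W n) s))) \<longlonglongrightarrow> ennreal (ent_term \<alpha> (pmf (map_pmf g Y) s))" for s
  proof (cases "pmf (map_pmf g Y) s = 0")
    case False
    then show ?thesis using fiber_mass_tendsto[OF W(1,3,4)]
      by (intro tendsto_ennrealI ent_term_tendsto) (auto simp: pmf_positive_iff pmf_eq_0_set_pmf)
  qed (simp add: fiber_mass_eq_0 W(1))
  have "ent_sum \<alpha> (map_pmf g Y)
      = (\<integral>\<^sup>+ s. liminf (\<lambda>n. ennreal (ent_term \<alpha> (fiber_mass g Y (W n) s))) \<partial>count_space UNIV)"
    unfolding ent_sum_def by (intro nn_integral_cong lim_imp_Liminf[symmetric] conv) auto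
  also have "\<dots> \<le> liminf (\<lambda>n. \<integral>\<^sup>+ s. ennreal (ent_term \<alpha> (fiber_mass g Y (W n) s)) \<partial>count_space UNIV)"
    by (rule nn_integral_liminf) simp
  finally have F: "ent_sum \<alpha> (map_pmf g Y)
    \<le> liminf (\<lambda>n. \<integral>\<^sup>+ s. ennreal (ent_term \<alpha> (fiber_mass g Y (W n) s)) \<partial>count_space UNIV)" .
  have step: "(\<integral>\<^sup>+ s. ennreal (ent_term \<alpha> (fiber_mass g Y (W n) s)) \<partial>count_space UNIV) + ennreal (gain \<alpha> g Y V)
     \<le> ent_sum \<alpha> Y" for n
  proof -
    have nn: "0 \<le> ent_term \<alpha> (fiber_mass g Y (W n) s)" "0 \<le> ent_term \<alpha> (pmf Y u)" for s u
      using fiber_mass_nonneg fiber_mass_le_1[OF W(1)] by (auto intro!: ent_term_nonneg simp: pmf_le_1)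
    have "(\<integral>\<^sup>+ s. ennreal (ent_term \<alpha> (fiber_mass g Y (W n) s)) \<partial>count_space UNIV)
      = ennreal (\<Sum>s\<in>g ` W n. ent_term \<alpha> (fiber_mass g Y (W n) s))"
      using W(1) nn by (intro nn_integral_finite_support) (auto simp: fiber_mass_outside)
    also have "\<dots> + ennreal (gain \<alpha> g Y V) =
      ennreal ((\<Sum>s\<in>g ` W n. ent_term \<alpha> (fiber_mass g Y (W n) s)) + gain \<alpha> g Y V)"
      using nn assms by (intro ennreal_plus[symmetric] sum_nonneg gain_nonneg) auto
    also have "\<dots> \<le> ennreal ((\<Sum>s\<in>g ` W n. ent_term \<alpha> (fiber_mass g Y (W n) s)) + gain \<alpha> g Y (W n))"
      using gain_mono[OF assms(1) W(1,2)] by (intro ennreal_leI) auto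
    also have "(\<Sum>s\<in>g ` W n. ent_term \<alpha> (fiber_mass g Y (W n) s)) + gain \<alpha> g Y (W n) = (\<Sum>u\<in>W n. ent_term \<alpha> (pmf Y u))"
      using assms by (simp add: gain_def superadd_term_def sum_negf)
    also have "ennreal \<dots> = (\<integral>\<^sup>+ u\<in>W n. ennreal (ent_term \<alpha> (pmf Y u)) \<partial>count_space UNIV)"
      using nn by (subst nn_integral_count_space'[OF W(1)[of n]]) (auto simp: sum_ennreal)
    also have "\<dots> \<le> ent_sum \<alpha> Y"
      unfolding ent_sum_def by (intro nn_integral_mono) (auto split: split_indicator)
    finally show ?thesis .
  qed
  have "ent_sum \<alpha> (map_pmf g Y) + ennreal (gain \<alpha> g Y V) \<le>
     liminf (\<lambda>n. \<integral>\<^sup>+ s. ennreal (ent_term \<alpha> (fiber_mass g Y (W n) s)) \<partial>count_space UNIV) + ennreal (gain \<alpha> g Y V)"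
    using F by (rule add_right_mono)
  also have "\<dots> = liminf (\<lambda>n. (\<integral>\<^sup>+ s. ennreal (ent_term \<alpha> (fiber_mass g Y (W n) s)) \<partial>count_space UNIV) + ennreal (gain \<alpha> g Y V))"
    by (rule Liminf_add_const[symmetric]) auto
  also have "\<dots> \<le> limsup (\<lambda>n. ent_sum \<alpha> Y)"
    by (intro order_trans[OF Liminf_le_Limsup] Limsup_mono always_eventually allI step) auto
  also have "\<dots> = ent_sum \<alpha> Y" by (simp add: Limsup_const)
  finally show ?thesis .
qed

text \<open>Here the roles are swapped: Fatou recovers the source, while on the image side
  \<open>ent_term \<alpha>\<close> is increasing and the truncated fiber masses lie below the full
  ones.\<close>

lemma gain_bound_gt_1:
  assumes "1 < \<alpha>" "finite V"
  shows "ent_sum \<alpha> Y + ennreal (gain \<alpha> g Y V) \<le> ent_sum \<alpha> (map_pmf g Y)"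
proof -
  obtain W where W: "\<And>n. finite (W n)" "\<And>n. V \<subseteq> W n" "incseq W" "set_pmf Y \<subseteq> (\<Union>n. W n)"
    using exhaustion[OF assms(2)] by metis
  have nn: "0 \<le> ent_term \<alpha> (fiber_mass g Y (W n) s)" "0 \<le> ent_term \<alpha> (pmf Y u)" for n s u
    using fiber_mass_nonneg fiber_mass_le_1[OF W(1)] by (auto intro!: ent_term_nonneg simp: pmf_le_1)
  let ?T = "\<lambda>n. \<integral>\<^sup>+ u. ennreal (ent_term \<alpha> (pmf Y u) * indicator (W n) u) \<partial>count_space UNIV"
  have conv: "(\<lambda>n. ennreal (ent_term \<alpha> (pmf Y u) * indicator (W n) u)) \<longlonglongrightarrow> ennreal (ent_term \<alpha> (pmf Y u))" for u
  proof (cases "u \<in> set_pmf Y")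
    case True
    then obtain k where k: "u \<in> W k" using W(4) by blast
    have "\<forall>\<^sub>F n in sequentially. ennreal (ent_term \<alpha> (pmf Y u)) = ennreal (ent_term \<alpha> (pmf Y u) * indicator (W n) u)"
      unfolding eventually_sequentially
    proof (intro exI allI impI)
      fix n assume "k \<le> n"
      then have "u \<in> W n" using k W(3) by (auto simp: incseq_def)
      then show "ennreal (ent_term \<alpha> (pmf Y u)) = ennreal (ent_term \<alpha> (pmf Y u) * indicator (W n) u)" by simp
    qed
    then show ?thesis by (rule Lim_transform_eventually[OF tendsto_const])
  qed (simp add: set_pmf_iff)
  have "ent_sum \<alpha> Y
      = (\<integral>\<^sup>+ u. liminf (\<lambda>n. ennreal (ent_term \<alpha> (pmf Y u) * indicator (W n) u)) \<partial>count_space UNIV)"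
    unfolding ent_sum_def by (intro nn_integral_cong lim_imp_Liminf[symmetric] conv) auto
  also have "\<dots> \<le> liminf ?T"
    by (rule nn_integral_liminf) simp
  finally have F: "ent_sum \<alpha> Y \<le> liminf ?T" .
  have step: "?T n + ennreal (gain \<alpha> g Y V) \<le> ent_sum \<alpha> (map_pmf g Y)" for n
  proof -
    have "?T n = ennreal (\<Sum>u\<in>W n. ent_term \<alpha> (pmf Y u) * indicator (W n) u)"
      by (rule nn_integral_finite_support[OF W(1)[of n]]) (auto simp: nn(2))
    also have "\<dots> = ennreal (\<Sum>u\<in>W n. ent_term \<alpha> (pmf Y u))"
      by (intro arg_cong[where f = ennreal] sum.cong) auto
    also have "\<dots> + ennreal (gain \<alpha> g Y V) = ennreal ((\<Sum>u\<in>W n. ent_term \<alpha> (pmf Y u)) + gain \<alpha> g Y V)"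
      using nn assms by (intro ennreal_plus[symmetric] sum_nonneg gain_nonneg) auto
    also have "\<dots> \<le> ennreal ((\<Sum>u\<in>W n. ent_term \<alpha> (pmf Y u)) + gain \<alpha> g Y (W n))"
      using gain_mono[OF _ W(1)[of n] W(2)[of n], of \<alpha> g Y] assms by (intro ennreal_leI) auto
    also have "(\<Sum>u\<in>W n. ent_term \<alpha> (pmf Y u)) + gain \<alpha> g Y (W n) = (\<Sum>s\<in>g ` W n. ent_term \<alpha> (fiber_mass g Y (W n) s))"
      using assms by (simp add: gain_def superadd_term_def)
    also have "ennreal \<dots> = (\<integral>\<^sup>+ s. ennreal (ent_term \<alpha> (fiber_mass g Y (W n) s)) \<partial>count_space UNIV)"
      using W(1) nn by (intro nn_integral_finite_support[symmetric]) (auto simp: fiber_mass_outside)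
    also have "\<dots> \<le> ent_sum \<alpha> (map_pmf g Y)"
      unfolding ent_sum_def using assms fiber_mass_nonneg fiber_mass_le_pmf[OF W(1)]
      by (intro nn_integral_mono ennreal_leI) (auto simp: ent_term_def intro!: powr_mono2)
    finally show ?thesis .
  qed
  have "ent_sum \<alpha> Y + ennreal (gain \<alpha> g Y V) \<le> liminf ?T + ennreal (gain \<alpha> g Y V)"
    using F by (rule add_right_mono)
  also have "\<dots> = liminf (\<lambda>n. ?T n + ennreal (gain \<alpha> g Y V))"
    by (rule Liminf_add_const[symmetric]) auto
  also have "\<dots> \<le> limsup (\<lambda>n. ent_sum \<alpha> (map_pmf g Y))"
    by (intro order_trans[OF Liminf_le_Limsup] Limsup_mono always_eventually allI step) auto
  also have "\<dots> = ent_sum \<alpha> (map_pmf g Y)" by (simp add: Limsup_const)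
  finally show ?thesis .
qed

section \<open>Deficit and gain; removing collisions\<close>

text \<open>The sum factors through the multiset, so the deficit compares \<open>U_law\<close> with
  an image of itself and the bounds above apply with \<open>sum_mset\<close> as the map.\<close>

lemma S_law_eq: "S_law h X = map_pmf sum_mset (U_law h X)"
  by (simp add: S_law_def U_law_def map_pmf_comp sum_mset_sum_list)

lemma ent_term_pos: "\<alpha> \<noteq> 1 \<Longrightarrow> 0 < x \<Longrightarrow> 0 < ent_term \<alpha> x"
  by (simp add: ent_term_def)

lemma power_sum_eq: "\<alpha> \<noteq> 1 \<Longrightarrow> power_sum \<alpha> Y = ent_sum \<alpha> Y"
  by (simp add: power_sum_def ent_sum_def ent_term_def)

lemma shannon_eq: "shannon_entropy Y = enn2ereal (ent_sum 1 Y)"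
  by (simp add: shannon_entropy_def ent_sum_def ent_term_def)

lemma ent_sum_ge: "ennreal (ent_term \<alpha> (pmf Y y)) \<le> ent_sum \<alpha> Y"
  unfolding ent_sum_def
  by (rule nn_integral_ge_point[of y UNIV "\<lambda>y. ennreal (ent_term \<alpha> (pmf Y y))"]) simp

lemma ent_sum_le_1:
  assumes "1 < \<alpha>" shows "ent_sum \<alpha> Y \<le> 1"
proof -
  have "x powr \<alpha> \<le> x" if "0 \<le> x" "x \<le> 1" for x :: real
    using that assms powr_mono'[of 1 \<alpha> x] by (cases "x = 0") auto
  then have "ent_sum \<alpha> Y \<le> (\<integral>\<^sup>+ y. ennreal (pmf Y y) \<partial>count_space UNIV)"
    unfolding ent_sum_def using assms
    by (intro nn_integral_mono ennreal_leI) (auto simp: ent_term_def pmf_le_1)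
  also have "\<dots> = 1" by (simp add: nn_integral_pmf)
  finally show ?thesis .
qed

lemma ent_sum_pos:
  assumes "\<alpha> \<noteq> 1" shows "0 < ent_sum \<alpha> Y"
proof -
  obtain y where "y \<in> set_pmf Y" using set_pmf_not_empty[of Y] by blast
  then have "0 < ennreal (ent_term \<alpha> (pmf Y y))"
    using ent_term_pos[OF assms] by (simp add: pmf_positive)
  then show ?thesis using ent_sum_ge[of \<alpha> Y y] by (rule less_le_trans)
qed

lemma ent_sum_map_le: "0 < \<alpha> \<Longrightarrow> \<alpha> \<le> 1 \<Longrightarrow> ent_sum \<alpha> (map_pmf g Y) \<le> ent_sum \<alpha> Y"
  using gain_bound_le_1[of \<alpha> "{}" g Y] by simp

definition deficit_gain_const :: "real \<Rightarrow> real \<Rightarrow> real" where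
  "deficit_gain_const \<alpha> W = (if \<alpha> = 1 then 1 else W * (\<bar>\<alpha> - 1\<bar> * exp \<bar>\<alpha> - 1\<bar>))"

text \<open>For \<alpha> \<noteq> 1 the deficit controls the logarithm of a ratio of power sums,
  whereas the gain is their difference. The passage is e^z - 1 <= z e^z with z = k C <= k. In the
  applications \<open>a\<close> is the smaller power sum and k = |\<alpha> - 1|.\<close>

lemma diff_le_of_ln_ratio_le:
  fixes a b :: real
  assumes "0 < a" "0 < b" "ln (b / a) / k \<le> C" "0 < k" "0 \<le> C" "C \<le> 1" "a \<le> W" "1 \<le> W"
  shows "b - a \<le> W * (k * exp k) * C"
proof -
  have "ln (b / a) \<le> k * C" using assms by (simp add: field_simps)
  then have "exp (ln (b / a)) \<le> exp (k * C)" by simp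
  then have "b / a \<le> exp (k * C)" using assms by simp
  then have "b \<le> exp (k * C) * a" using assms by (simp add: pos_divide_le_eq)
  then have step: "b - a \<le> a * (exp (k * C) - 1)" by (simp add: algebra_simps)
  have exp1: "exp (k * C) - 1 \<le> k * C * exp (k * C)"
  proof -
    have "(1 - k * C) * exp (k * C) \<le> exp (- (k * C)) * exp (k * C)"
      using exp_ge_add_one_self[of "- (k * C)"] by (intro mult_right_mono) auto
    also have "\<dots> = 1" by (simp flip: exp_add)
    finally show ?thesis by (simp add: left_diff_distrib)
  qed
  also have "k * C * exp (k * C) \<le> k * C * exp k"
    using assms by (intro mult_left_mono) (auto simp: mult_left_le)
  finally have "a * (exp (k * C) - 1) \<le> a * (k * C * exp k)"
    using assms by (intro mult_left_mono) auto
  with step have "b - a \<le> a * (k * C * exp k)" by linarith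
  also have "a * (k * C * exp k) \<le> W * (k * C * exp k)" using assms by (intro mult_right_mono) auto
  finally show ?thesis using assms by (simp add: mult_ac)
qed

lemma ln_quotient:
  fixes a b \<alpha> :: real
  assumes "0 < a" "0 < b"
  shows "ln a / (1 - \<alpha>) - ln b / (1 - \<alpha>) = ln (b / a) / (\<alpha> - 1)"
    and "ln a / (1 - \<alpha>) - ln b / (1 - \<alpha>) = ln (a / b) / (1 - \<alpha>)"
proof -
  have "x / (1 - \<alpha>) = - (x / (\<alpha> - 1))" for x :: real
    unfolding minus_divide_right by simp
  then show "ln a / (1 - \<alpha>) - ln b / (1 - \<alpha>) = ln (b / a) / (\<alpha> - 1)"
    using assms by (simp add: ln_div diff_divide_distrib)
qed (use assms in \<open>simp add: ln_div diff_divide_distrib\<close>)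

text \<open>A bound \<open>W\<close> on the power sum is demanded only for \<alpha> < 1, since for
  \<alpha> > 1 power sums never exceed 1 and for \<alpha> = 1 the deficit is already a difference of
  entropy sums.\<close>

lemma gain_le_deficit:
  assumes \<alpha>: "0 < \<alpha>" and C: "0 \<le> C" "C \<le> 1"
    and d: "deficit_defined \<alpha> h X" "deficit \<alpha> h X \<le> ereal C"
    and W: "\<alpha> < 1 \<Longrightarrow> ent_sum \<alpha> (U_law h X) \<le> ennreal W" "1 \<le> W"
    and V: "finite V"
  shows "gain \<alpha> sum_mset (U_law h X) V \<le> deficit_gain_const \<alpha> W * C"
proof -
  define U where "U = U_law h X"
  define a where "a = enn2real (ent_sum \<alpha> U)"
  define b where "b = enn2real (ent_sum \<alpha> (map_pmf sum_mset U))"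
  let ?G = "gain \<alpha> sum_mset U V"
  have G: "0 \<le> ?G" by (rule gain_nonneg[OF \<alpha> V])
  have S: "S_law h X = map_pmf sum_mset U" by (simp add: S_law_eq U_def)
  have conv: "\<alpha> \<le> 1 \<Longrightarrow> ent_sum \<alpha> (map_pmf sum_mset U) + ennreal ?G \<le> ent_sum \<alpha> U"
    using gain_bound_le_1[OF \<alpha> _ V] by auto
  consider "\<alpha> = 1" | "\<alpha> > 1" | "\<alpha> < 1" by linarith
  then show ?thesis
  proof cases
    case 1
    have le: "enn2ereal (ent_sum 1 U) - enn2ereal (ent_sum 1 (map_pmf sum_mset U)) \<le> ereal C"
      using d(2) 1 by (simp add: deficit_def renyi_entropy_def shannon_eq S flip: U_def)
    \<comment> \<open>In \<open>ereal\<close> the difference of two infinities is \<infinity>, so an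
      infinite entropy of \<open>U\<close> would contradict the bound by \<open>C\<close>.\<close>
    then have fin: "ent_sum 1 U < \<top>" by (cases "ent_sum 1 U") auto
    then have fin': "ent_sum 1 (map_pmf sum_mset U) < \<top>"
      using ent_sum_map_le[of 1 sum_mset U] by simp
    have "ent_sum 1 U = ennreal a" "ent_sum 1 (map_pmf sum_mset U) = ennreal b"
      using fin fin' 1 by (simp_all add: a_def b_def)
    moreover have ab: "0 \<le> a" "0 \<le> b" by (simp_all add: a_def b_def)
    ultimately have "a - b \<le> C" "ennreal (b + ?G) \<le> ennreal a"
      using le conv 1 G by (simp_all add: enn2ereal_ennreal)
    then show ?thesis using ab 1 by (simp add: deficit_gain_const_def U_def)
  next
    case 2
    have fin: "ent_sum \<alpha> U < \<top>" "ent_sum \<alpha> (map_pmf sum_mset U) < \<top>"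
      using le_less_trans[OF ent_sum_le_1[OF 2] ennreal_one_less_top] by auto
    have eq: "ent_sum \<alpha> U = ennreal a" "ent_sum \<alpha> (map_pmf sum_mset U) = ennreal b"
      using fin by (simp_all add: a_def b_def)
    have pos: "0 < a" "0 < b"
      using ent_sum_pos[of \<alpha> U] ent_sum_pos[of \<alpha> "map_pmf sum_mset U"] 2 by (auto simp: eq)
    have a1: "a \<le> 1" using ent_sum_le_1[OF 2, of U] by (simp add: eq)
    have "ln (b / a) / (\<alpha> - 1) = ln a / (1 - \<alpha>) - ln b / (1 - \<alpha>)"
      using ln_quotient(1)[OF pos, of \<alpha>] by simp
    also have "\<dots> \<le> C"
      using d(2) 2 pos by (simp add: deficit_def renyi_entropy_def power_sum_eq S eq flip: U_def)
    finally have "b - a \<le> W * ((\<alpha> - 1) * exp (\<alpha> - 1)) * C"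
      using pos a1 C 2 W(2) by (intro diff_le_of_ln_ratio_le) auto
    moreover have "ennreal (a + ?G) \<le> ennreal b"
      using gain_bound_gt_1[OF 2 V, of U sum_mset] G pos by (simp add: eq)
    then have "a + ?G \<le> b" using pos by simp
    ultimately show ?thesis using 2 by (simp add: deficit_gain_const_def U_def)
  next
    case 3
    have fin: "ent_sum \<alpha> U < \<top>" using d(1) 3 by (simp add: deficit_defined_def power_sum_eq U_def)
    then have fin': "ent_sum \<alpha> (map_pmf sum_mset U) < \<top>"
      using ent_sum_map_le[OF \<alpha>, of sum_mset U] 3 by (auto intro: le_less_trans)
    have eq: "ent_sum \<alpha> U = ennreal a" "ent_sum \<alpha> (map_pmf sum_mset U) = ennreal b"
      using fin fin' by (simp_all add: a_def b_def)
    have pos: "0 < a" "0 < b"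
      using ent_sum_pos[of \<alpha> U] ent_sum_pos[of \<alpha> "map_pmf sum_mset U"] 3 by (auto simp: eq)
    have "ennreal (b + ?G) \<le> ennreal a" using conv 3 G pos by (simp add: eq)
    then have ba: "b + ?G \<le> a" using pos by simp
    have a1: "a \<le> W" using W 3 pos by (simp add: eq flip: U_def)
    have "ln (a / b) / (1 - \<alpha>) = ln a / (1 - \<alpha>) - ln b / (1 - \<alpha>)"
      using ln_quotient(2)[OF pos, of \<alpha>] by simp
    also have "\<dots> \<le> C"
      using d(2) 3 pos by (simp add: deficit_def renyi_entropy_def power_sum_eq S eq flip: U_def)
    finally have "a - b \<le> W * ((1 - \<alpha>) * exp (1 - \<alpha>)) * C"
      using pos a1 C 3 W(2) ba G by (intro diff_le_of_ln_ratio_le) auto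
    then show ?thesis using ba 3 by (simp add: deficit_gain_const_def U_def)
  qed
qed

lemma ent_sum_finite_support:
  assumes "finite V" "set_pmf Y \<subseteq> V"
  shows "ent_sum \<alpha> Y = ennreal (\<Sum>u\<in>V. ent_term \<alpha> (pmf Y u))"
proof -
  have "pmf Y y = 0" if "y \<notin> V" for y
    using assms(2) that by (auto simp: pmf_eq_0_set_pmf)
  then show ?thesis unfolding ent_sum_def
    by (intro nn_integral_finite_support[OF assms(1)]) (auto simp: ent_term_nonneg pmf_le_1)
qed

lemma ln_le_diff_div: "0 < a \<Longrightarrow> 0 < b \<Longrightarrow> ln (b / a) \<le> (b - a) / (a::real)"
  using ln_le_minus_one[of "b / a"] by (simp add: field_simps)

text \<open>The factor for the converse estimate: ln z <= z - 1 divides the gain by one of the two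
  power sums, and both are at least q^\<alpha> when some multiset has mass at least
  \<open>q\<close>.\<close>

definition gain_deficit_const :: "real \<Rightarrow> real \<Rightarrow> real" where
  "gain_deficit_const \<alpha> q = (if \<alpha> = 1 then 1 else 1 / (\<bar>1 - \<alpha>\<bar> * q powr \<alpha>))"

lemma finite_set_U:
  assumes "finite (set_pmf X)" shows "finite (set_pmf (U_law h X))"
proof -
  have "set_pmf (replicate_pmf h X) = {xs. set xs \<subseteq> set_pmf X \<and> length xs = h}"
    by (auto simp: set_replicate_pmf)
  then show ?thesis using finite_lists_length_eq[OF assms, of h] by (simp add: U_law_def)
qed

lemma deficit_le_gain:
  assumes \<alpha>: "0 < \<alpha>" and fin: "finite (set_pmf X)"
    and q: "0 < q" "q \<le> pmf (U_law h X) u"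
  shows "deficit_defined \<alpha> h X \<and> deficit \<alpha> h X
    \<le> ereal (gain_deficit_const \<alpha> q * gain \<alpha> sum_mset (U_law h X) (set_pmf (U_law h X)))"
proof -
  define U where "U = U_law h X"
  define V where "V = set_pmf U"
  have V: "finite V" using fin by (simp add: V_def U_def finite_set_U)
  define a where "a = (\<Sum>u\<in>V. ent_term \<alpha> (pmf U u))"
  define b where "b = (\<Sum>s\<in>sum_mset ` V. ent_term \<alpha> (pmf (map_pmf sum_mset U) s))"
  have S: "S_law h X = map_pmf sum_mset U" by (simp add: S_law_eq U_def)
  have eq: "ent_sum \<alpha> U = ennreal a" "ent_sum \<alpha> (map_pmf sum_mset U) = ennreal b"
    unfolding a_def b_def using V by (auto intro!: ent_sum_finite_support simp: V_def)
  \<comment> \<open>With \<open>V\<close> the whole support, fiber masses are the atoms of the image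
    law, so \<open>gain\<close> is exactly the difference of the two entropy sums.\<close>
  have fiber_mass: "fiber_mass sum_mset U V s = pmf (map_pmf sum_mset U) s" for s
    unfolding fiber_mass_measure[OF V] pmf_map
    by (intro measure_pmf.finite_measure_eq_AE) (auto simp: AE_measure_pmf_iff V_def)
  have G: "gain \<alpha> sum_mset U V = (if \<alpha> \<le> 1 then a - b else b - a)"
    by (simp add: gain_def fiber_mass superadd_term_def a_def b_def sum_negf)
  have nn: "0 \<le> a" "0 \<le> b" unfolding a_def b_def
    by (intro sum_nonneg ent_term_nonneg pmf_nonneg pmf_le_1)+
  have Gn: "0 \<le> gain \<alpha> sum_mset U V" by (rule gain_nonneg[OF \<alpha> V])
  have qa: "q powr \<alpha> \<le> a" if "\<alpha> \<noteq> 1"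
  proof -
    have "q powr \<alpha> \<le> pmf U u powr \<alpha>" using q \<alpha> by (intro powr_mono2) (auto simp: U_def)
    then have "ennreal (q powr \<alpha>) \<le> ennreal (ent_term \<alpha> (pmf U u))" using that by (simp add: ent_term_def)
    also have "\<dots> \<le> ennreal a" using ent_sum_ge[of \<alpha> U u] eq by simp
    finally show ?thesis using nn by simp
  qed
  have qb: "q powr \<alpha> \<le> b" if "\<alpha> \<noteq> 1"
  proof -
    have "u \<in> V" using q by (auto simp: V_def U_def set_pmf_iff)
    then have "q \<le> pmf (map_pmf sum_mset U) (sum_mset u)"
      using fiber_mass_le[OF V, of u U sum_mset] q by (simp add: fiber_mass flip: U_def)
    then have "q powr \<alpha> \<le> pmf (map_pmf sum_mset U) (sum_mset u) powr \<alpha>"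
      using q \<alpha> by (intro powr_mono2) auto
    then have "ennreal (q powr \<alpha>) \<le> ennreal (ent_term \<alpha> (pmf (map_pmf sum_mset U) (sum_mset u)))"
      using that by (simp add: ent_term_def)
    also have "\<dots> \<le> ennreal b" using ent_sum_ge[of \<alpha> "map_pmf sum_mset U" "sum_mset u"] eq by simp
    finally show ?thesis using nn by simp
  qed
  have pos: "0 < a" "0 < b" if "\<alpha> \<noteq> 1" using qa[OF that] qb[OF that] q powr_gt_zero[of q \<alpha>] by linarith+
  have defined: "deficit_defined \<alpha> h X"
  proof (cases "\<alpha> = 1")
    case True
    then show ?thesis
      using ent_sum_finite_support[OF fin subset_refl, of 1]
      by (simp add: deficit_defined_def shannon_eq enn2ereal_ennreal sum_nonneg ent_term_nonneg pmf_le_1)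
  next
    case False
    then show ?thesis using eq by (simp add: deficit_defined_def power_sum_eq flip: U_def)
  qed
  consider "\<alpha> = 1" | "\<alpha> > 1" | "\<alpha> < 1" by linarith
  then have "deficit \<alpha> h X \<le> ereal (gain_deficit_const \<alpha> q * gain \<alpha> sum_mset U V)"
  proof cases
    case 1
    then have "gain 1 sum_mset U V = a - b" using G by simp
    then show ?thesis using eq nn 1
      by (simp add: deficit_def renyi_entropy_def shannon_eq S gain_deficit_const_def enn2ereal_ennreal flip: U_def)
  next
    case 2
    have "ln a / (1 - \<alpha>) - ln b / (1 - \<alpha>) = ln (b / a) / (\<alpha> - 1)"
      using ln_quotient(1)[OF pos, of \<alpha>] 2 by simp
    also have "\<dots> \<le> ((b - a) / a) / (\<alpha> - 1)"
      using ln_le_diff_div[of a b] 2 pos by (intro divide_right_mono) auto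
    also have "\<dots> \<le> ((b - a) / q powr \<alpha>) / (\<alpha> - 1)"
      using Gn G 2 qa q pos by (intro divide_right_mono divide_left_mono) auto
    finally show ?thesis
      using 2 pos by (simp add: deficit_def renyi_entropy_def power_sum_eq S eq G gain_deficit_const_def mult_ac flip: U_def)
  next
    case 3
    have "ln a / (1 - \<alpha>) - ln b / (1 - \<alpha>) = ln (a / b) / (1 - \<alpha>)"
      using ln_quotient(2)[OF pos, of \<alpha>] 3 by simp
    also have "\<dots> \<le> ((a - b) / b) / (1 - \<alpha>)"
      using ln_le_diff_div[of b a] 3 pos by (intro divide_right_mono) auto
    also have "\<dots> \<le> ((a - b) / q powr \<alpha>) / (1 - \<alpha>)"
      using Gn G 3 qb q pos by (intro divide_right_mono divide_left_mono) auto
    finally show ?thesis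
      using 3 pos by (simp add: deficit_def renyi_entropy_def power_sum_eq S eq G gain_deficit_const_def mult_ac flip: U_def)
  qed
  then show ?thesis using defined by (simp add: U_def V_def)
qed

section \<open>Atoms and power sums of the multiset law\<close>

lemma pmf_replicate_pmf:
  "pmf (replicate_pmf n X) xs = (if length xs = n then prod_list (map (pmf X) xs) else 0)"
proof (induction n arbitrary: xs)
  case (Suc n)
  have eq: "replicate_pmf (Suc n) X = map_pmf (\<lambda>(x, xs). x # xs) (pair_pmf X (replicate_pmf n X))"
    by (simp add: pair_pmf_def map_bind_pmf)
  show ?case
  proof (cases xs)
    case (Cons y ys)
    have "pmf (map_pmf (\<lambda>(x, xs). x # xs) (pair_pmf X (replicate_pmf n X))) ((\<lambda>(x, xs). x # xs) (y, ys))
      = pmf (pair_pmf X (replicate_pmf n X)) (y, ys)"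
      by (rule pmf_map_inj') (auto simp: inj_on_def)
    then show ?thesis using Suc Cons unfolding eq by (simp add: pmf_pair)
  next
    case Nil
    then have "xs \<notin> set_pmf (replicate_pmf (Suc n) X)" by (simp add: set_replicate_pmf del: replicate_pmf.simps)
    then show ?thesis using Nil by (simp add: set_pmf_iff del: replicate_pmf.simps)
  qed
qed (auto simp: indicator_def)

lemma prod_list_ge_power:
  assumes "\<And>x. x \<in> set xs \<Longrightarrow> q \<le> f x" "0 \<le> (q::real)"
  shows "q ^ length xs \<le> prod_list (map f xs)"
  using assms(1)
proof (induction xs)
  case (Cons a xs)
  then show ?case using assms(2) by (auto intro!: mult_mono order_trans[of 0 q "f a"])
qed simp

text \<open>A single ordering of \<open>u\<close> already has this probability; the multinomial
  factor is discarded.\<close>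

lemma pmf_U_ge:
  assumes "u \<in> multisets_of_size F h" "\<And>x. x \<in> set_mset u \<Longrightarrow> q \<le> pmf X x" "0 \<le> q"
  shows "q ^ h \<le> pmf (U_law h X) u"
proof -
  obtain xs where xs: "mset xs = u" using ex_mset by blast
  then have len: "length xs = h" using assms(1) by (auto simp: multisets_of_size_def)
  have "q ^ h \<le> pmf (replicate_pmf h X) xs"
    using prod_list_ge_power[of xs q "pmf X"] assms xs len by (auto simp: pmf_replicate_pmf)
  also have "\<dots> \<le> pmf (U_law h X) u"
    unfolding U_law_def pmf_map using xs
    by (subst measure_pmf_single[symmetric]) (intro measure_pmf.finite_measure_mono, auto)
  finally show ?thesis .
qed

lemma ent_sum_pair:
  assumes "\<alpha> \<noteq> 1"
  shows "ent_sum \<alpha> (pair_pmf A B) = ent_sum \<alpha> A * ent_sum \<alpha> B"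
proof -
  have "ent_sum \<alpha> (pair_pmf A B) = (\<integral>\<^sup>+ x. \<integral>\<^sup>+ y. ennreal (ent_term \<alpha> (pmf (pair_pmf A B) (x, y))) \<partial>count_space UNIV \<partial>count_space UNIV)"
    unfolding ent_sum_def by (rule nn_integral_fst_count_space[symmetric])
  also have "\<dots> = (\<integral>\<^sup>+ x. \<integral>\<^sup>+ y. ennreal (ent_term \<alpha> (pmf A x)) * ennreal (ent_term \<alpha> (pmf B y)) \<partial>count_space UNIV \<partial>count_space UNIV)"
    using assms by (simp add: pmf_pair ent_term_def powr_mult ennreal_mult)
  finally show ?thesis by (simp add: ent_sum_def nn_integral_cmult nn_integral_multc)
qed

text \<open>Power sums multiply over independent coordinates, and passing to an image, here
  forgetting the order, only lowers them when \<alpha> < 1. This provides the bound \<open>W\<close>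
  of \<open>gain_le_deficit\<close>.\<close>

lemma ent_sum_U_le:
  assumes "0 < \<alpha>" "\<alpha> < 1"
  shows "ent_sum \<alpha> (U_law h X) \<le> ent_sum \<alpha> X ^ h"
proof -
  have "ent_sum \<alpha> (replicate_pmf n X) \<le> ent_sum \<alpha> X ^ n" for n
  proof (induction n)
    case 0
    then show ?case using assms
      by (simp add: ent_sum_finite_support[of "{[]}"] ent_term_def)
  next
    case (Suc n)
    have eq: "replicate_pmf (Suc n) X = map_pmf (\<lambda>(x, xs). x # xs) (pair_pmf X (replicate_pmf n X))"
      by (simp add: pair_pmf_def map_bind_pmf)
    have "ent_sum \<alpha> (replicate_pmf (Suc n) X) \<le> ent_sum \<alpha> (pair_pmf X (replicate_pmf n X))"
      unfolding eq using assms by (intro ent_sum_map_le) auto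
    also have "\<dots> \<le> ent_sum \<alpha> X * ent_sum \<alpha> X ^ n"
      using Suc assms by (simp add: ent_sum_pair mult_left_mono)
    finally show ?case by simp
  qed
  then show ?thesis unfolding U_law_def
    using ent_sum_map_le[of \<alpha> mset "replicate_pmf h X"] assms by (meson less_imp_le order_trans)
qed

text \<open>The lightest atom \<open>b\<close> of the collision occurs in \<open>u'\<close>, so
  \<open>u'\<close> is not among the multisets over \<open>F - {b}\<close>, and both
  \<open>u'\<close> and \<open>v'\<close> have mass at least \<open>pmf X b ^ h\<close>. Inserting
  \<open>u'\<close> last thus yields a gain on top of everything obtained from
  \<open>F - {b}\<close>, so the charges for successive deletions add up. The partner
  \<open>v'\<close> may contain \<open>b\<close> as well, since it only has to lie over
  \<open>F\<close>.\<close>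

lemma Bh_removal:
  assumes "0 < \<alpha>" "finite F"
  shows "\<exists>B\<subseteq>F. Bh_set h B \<and> superadd_gap \<alpha> * (\<Sum>a\<in>F - B. pmf X a powr (real h * \<alpha>))
     \<le> gain \<alpha> sum_mset (U_law h X) (multisets_of_size F h)"
  using assms(2)
proof (induction F rule: finite_psubset_induct)
  case (psubset F)
  let ?U = "U_law h X"
  show ?case
  proof (cases "Bh_set h F")
    case True
    then show ?thesis using psubset(1) assms(1)
      by (intro exI[of _ F]) (auto intro!: gain_nonneg)
  next
    case False
    then obtain u v where uv: "u \<in> multisets_of_size F h" "v \<in> multisets_of_size F h" "u \<noteq> v"
        "sum_mset u = sum_mset v"
      by (auto simp: Bh_set_def inj_on_def)
    define Z where "Z = set_mset u \<union> set_mset v"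
    have "Z \<noteq> {}" using uv(3) by (auto simp: Z_def)
    define b where "b = arg_min_on (pmf X) Z"
    have b: "b \<in> Z" "\<And>z. z \<in> Z \<Longrightarrow> pmf X b \<le> pmf X z"
      using arg_min_if_finite(1)[of Z "pmf X"] arg_min_least[of Z _ "pmf X"] \<open>Z \<noteq> {}\<close>
      by (auto simp: b_def Z_def)
    \<comment> \<open>The two multisets are swapped if necessary, so that \<open>b\<close> occurs in
      the first.\<close>
    obtain u' v' where uv': "u' \<in> multisets_of_size F h" "v' \<in> multisets_of_size F h" "u' \<noteq> v'"
        "sum_mset u' = sum_mset v'" "b \<in># u'" "set_mset u' \<union> set_mset v' = Z"
      using uv b(1) unfolding Z_def by (metis Un_commute Un_iff)
    have bF: "b \<in> F" using uv' by (auto simp: multisets_of_size_def)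
    obtain B where B: "B \<subseteq> F - {b}" "Bh_set h B"
      "superadd_gap \<alpha> * (\<Sum>a\<in>F - {b} - B. pmf X a powr (real h * \<alpha>))
         \<le> gain \<alpha> sum_mset ?U (multisets_of_size (F - {b}) h)"
      using psubset(2)[of "F - {b}"] bF by blast
    have FB: "F - B = insert b (F - {b} - B)" using B(1) bF by auto
    \<comment> \<open>Only \<open>{#}\<close> has size 0, so a collision forces
      \<open>h > 0\<close>. This matters because \<open>0 ^ 0 = 1\<close> whereas
      \<open>0 powr 0 = 0\<close>.\<close>
    have "h > 0" using uv by (cases h) auto
    have pw: "pmf X b powr (real h * \<alpha>) = (pmf X b ^ h) powr \<alpha>"
    proof (cases "pmf X b = 0")
      case True
      then show ?thesis using \<open>h > 0\<close> by simp
    next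
      case False
      then have "pmf X b ^ h = pmf X b powr real h" by (simp add: powr_realpow pmf_positive_iff pmf_eq_0_set_pmf)
      then show ?thesis by (simp add: powr_powr)
    qed
    have "gain \<alpha> sum_mset ?U (multisets_of_size (F - {b}) h) + superadd_gap \<alpha> * (pmf X b ^ h) powr \<alpha>
        \<le> gain \<alpha> sum_mset ?U (multisets_of_size F h)"
    proof (rule gain_collision[where u = u' and v = v'])
      show "multisets_of_size (F - {b}) h \<subseteq> multisets_of_size F h - {u'}"
        using uv' by (auto simp: multisets_of_size_def)
      show "pmf X b ^ h \<le> pmf ?U u'" "pmf X b ^ h \<le> pmf ?U v'"
        using uv' b by (auto intro!: pmf_U_ge[where F = F])
    qed (use assms uv' psubset(1) in \<open>auto\<close>)
    then show ?thesis using B psubset(1)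
      by (intro exI[of _ B]) (auto simp: FB pw distrib_left)
  qed
qed

section \<open>Upper bounds on the defect\<close>

lemma Bh_set_empty: "0 < h \<Longrightarrow> Bh_set h {}"
  by (simp add: Bh_set_def)

lemma Bh_set_mono: "Bh_set h B \<Longrightarrow> A \<subseteq> B \<Longrightarrow> Bh_set h A"
  unfolding Bh_set_def by (erule inj_on_subset) (rule multisets_of_size_mono)

lemma Bh_defect_le:
  assumes "B \<subseteq> set_pmf X" "Bh_set h B"
  shows "Bh_defect h X \<le> 1 - measure_pmf.prob X B"
proof -
  have "measure_pmf.prob X B \<le> Sup {measure_pmf.prob X B | B. B \<subseteq> set_pmf X \<and> Bh_set h B}"
    using assms by (intro cSup_upper bdd_aboveI[of _ 1]) auto
  then show ?thesis by (simp add: Bh_defect_def)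
qed

lemma Bh_defect_ge:
  assumes "0 < h" "\<And>B. B \<subseteq> set_pmf X \<Longrightarrow> Bh_set h B \<Longrightarrow> measure_pmf.prob X B \<le> M"
  shows "1 - M \<le> Bh_defect h X"
proof -
  have "Sup {measure_pmf.prob X B | B. B \<subseteq> set_pmf X \<and> Bh_set h B} \<le> M"
    using assms Bh_set_empty[of h] by (intro cSup_least) auto
  then show ?thesis by (simp add: Bh_defect_def)
qed

lemma Bh_defect_le_1: "0 < h \<Longrightarrow> Bh_defect h X \<le> 1"
  using Bh_defect_le[of "{}" X h] Bh_set_empty[of h] by simp

lemma finite_heavy:
  assumes "0 < t" shows "finite {a. t \<le> pmf X a}"
proof (rule ccontr)
  assume inf: "infinite {a. t \<le> pmf X a}"
  obtain n :: nat where n: "1 / t < n" using reals_Archimedean2 by blast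
  obtain B where B: "B \<subseteq> {a. t \<le> pmf X a}" "finite B" "card B = n"
    using infinite_arbitrarily_large[OF inf] by metis
  have "n * t = (\<Sum>a\<in>B. t)" using B by simp
  also have "\<dots> \<le> (\<Sum>a\<in>B. pmf X a)" using B by (intro sum_mono) auto
  also have "\<dots> \<le> 1" using B(2) by (simp flip: measure_measure_pmf_finite)
  finally show False using n assms by (simp add: field_simps)
qed

lemma powr_split: "0 \<le> x \<Longrightarrow> x powr a * x powr (1 - a) = (x::real)"
  by (cases "x = 0") (simp_all flip: powr_add)

lemma sum_le_sum_powr_ge_1:
  fixes f :: "'a \<Rightarrow> real"
  assumes "1 \<le> r" "0 < t" "\<And>a. a \<in> A \<Longrightarrow> t \<le> f a"
  shows "(\<Sum>a\<in>A. f a) \<le> (\<Sum>a\<in>A. f a powr r) * t powr (1 - r)"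
  unfolding sum_distrib_right
proof (rule sum_mono)
  fix a assume a: "a \<in> A"
  have "f a = f a powr r * f a powr (1 - r)" using assms(2) assms(3)[OF a] by (simp add: powr_split)
  also have "\<dots> \<le> f a powr r * t powr (1 - r)"
    using assms(1,2) assms(3)[OF a] by (intro mult_left_mono powr_mono2') auto
  finally show "f a \<le> f a powr r * t powr (1 - r)" .
qed

text \<open>Nesting of the l^r quasi-norms: with T the sum of the r-th powers, each f(a)^r is at
  most T, so f(a) = f(a)^r f(a)^(1-r) <= f(a)^r T^(1/r - 1).\<close>

lemma sum_le_sum_powr_le_1:
  fixes f :: "'a \<Rightarrow> real"
  assumes "0 < r" "r \<le> 1" "finite A" "\<And>a. a \<in> A \<Longrightarrow> 0 \<le> f a"
  shows "(\<Sum>a\<in>A. f a) \<le> (\<Sum>a\<in>A. f a powr r) powr (1 / r)"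
proof -
  define T where "T = (\<Sum>a\<in>A. f a powr r)"
  have T: "0 \<le> T" unfolding T_def by (intro sum_nonneg) auto
  have "f a \<le> f a powr r * T powr (1 / r - 1)" if a: "a \<in> A" for a
  proof -
    have "f a powr r \<le> T" unfolding T_def using a assms by (intro member_le_sum) auto
    then have le: "(f a powr r) powr (1 / r) \<le> T powr (1 / r)" using assms by (intro powr_mono2) auto
    have "f a powr (1 - r) = (f a powr r) powr (1 / r - 1)"
      using assms by (simp add: powr_powr right_diff_distrib)
    also have "\<dots> \<le> T powr (1 / r - 1)"
      using assms \<open>f a powr r \<le> T\<close> by (intro powr_mono2) (auto simp: field_simps)
    finally have "f a powr r * f a powr (1 - r) \<le> f a powr r * T powr (1 / r - 1)"
      by (intro mult_left_mono) auto
    then show ?thesis using powr_split[of "f a" r] assms(4)[OF a] by simp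
  qed
  then have "(\<Sum>a\<in>A. f a) \<le> (\<Sum>a\<in>A. f a powr r * T powr (1 / r - 1))" by (rule sum_mono)
  also have "\<dots> = T * T powr (1 / r - 1)" by (simp add: T_def flip: sum_distrib_right)
  also have "\<dots> = T powr (1 / r)"
    using T by (cases "T = 0") (auto simp: powr_diff)
  finally show ?thesis by (simp add: T_def)
qed

lemma sum_powr_le_powr_sum:
  fixes f :: "'a \<Rightarrow> real"
  assumes "1 \<le> r" "finite A" "\<And>a. a \<in> A \<Longrightarrow> 0 \<le> f a"
  shows "(\<Sum>a\<in>A. f a powr r) \<le> (\<Sum>a\<in>A. f a) powr r"
proof -
  have "(\<Sum>a\<in>A. f a powr r) \<le> (\<Sum>a\<in>A. (f a powr r) powr (1 / r)) powr (1 / (1 / r))"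
    using assms by (intro sum_le_sum_powr_le_1) auto
  also have "(\<Sum>a\<in>A. (f a powr r) powr (1 / r)) = (\<Sum>a\<in>A. f a)"
    using assms by (intro sum.cong) (auto simp: powr_powr)
  finally show ?thesis by simp
qed

definition removal_const :: "real \<Rightarrow> real \<Rightarrow> real" where
  "removal_const \<alpha> W = deficit_gain_const \<alpha> W / superadd_gap \<alpha>"

lemma removal_const_nonneg: "0 \<le> W \<Longrightarrow> 0 \<le> removal_const \<alpha> W"
  using superadd_gap_pos[of \<alpha>] by (simp add: removal_const_def deficit_gain_const_def)

text \<open>\<open>R\<close> consists of the heavy atoms deleted by \<open>Bh_removal\<close>. Its
  size is left as a sum of powers because the conversion to mass depends on h \<alpha>: for h
  \<alpha> >= 1 the threshold \<open>t\<close> is used, for h \<alpha> <= 1 the nesting of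
  quasi-norms gives a bound free of \<open>t\<close>.\<close>

lemma Bh_defect_removal:
  assumes \<alpha>: "0 < \<alpha>" and C: "0 \<le> C" "C \<le> 1"
    and d: "deficit_defined \<alpha> h X" "deficit \<alpha> h X \<le> ereal C"
    and W: "\<alpha> < 1 \<Longrightarrow> ent_sum \<alpha> (U_law h X) \<le> ennreal W" "1 \<le> W"
    and t: "0 < t"
  obtains R where "finite R" "\<And>a. a \<in> R \<Longrightarrow> t \<le> pmf X a"
    "(\<Sum>a\<in>R. pmf X a powr (real h * \<alpha>)) \<le> removal_const \<alpha> W * C"
    "Bh_defect h X \<le> measure_pmf.prob X {a. pmf X a < t} + (\<Sum>a\<in>R. pmf X a)"
proof -
  define F where "F = {a. t \<le> pmf X a}"
  have F: "finite F" unfolding F_def by (rule finite_heavy[OF t])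
  obtain B where B: "B \<subseteq> F" "Bh_set h B" "superadd_gap \<alpha> * (\<Sum>a\<in>F - B. pmf X a powr (real h * \<alpha>))
     \<le> gain \<alpha> sum_mset (U_law h X) (multisets_of_size F h)"
    using Bh_removal[OF \<alpha> F] by blast
  have "\<dots> \<le> deficit_gain_const \<alpha> W * C"
    using gain_le_deficit[OF \<alpha> C d W finite_multisets_of_size[OF F]] .
  then have "superadd_gap \<alpha> * (\<Sum>a\<in>F - B. pmf X a powr (real h * \<alpha>)) \<le> deficit_gain_const \<alpha> W * C" using B(3) by simp
  then have 1: "(\<Sum>a\<in>F - B. pmf X a powr (real h * \<alpha>)) \<le> removal_const \<alpha> W * C"
    using superadd_gap_pos[of \<alpha>] by (simp add: removal_const_def field_simps)
  have "F \<subseteq> set_pmf X" using t by (auto simp: F_def set_pmf_iff)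
  then have "Bh_defect h X \<le> 1 - measure_pmf.prob X B" using B by (intro Bh_defect_le) auto
  also have "1 = measure_pmf.prob X ({a. pmf X a < t} \<union> F)"
  proof -
    have "{a. pmf X a < t} \<union> F = UNIV" by (auto simp: F_def)
    then show ?thesis by simp
  qed
  also have "\<dots> = measure_pmf.prob X {a. pmf X a < t} + measure_pmf.prob X F"
    by (rule measure_pmf.finite_measure_Union) (auto simp: F_def)
  also have "measure_pmf.prob X F = measure_pmf.prob X B + (\<Sum>a\<in>F - B. pmf X a)"
    using B(1) F by (simp add: measure_measure_pmf_finite finite_subset sum.subset_diff)
  finally show thesis using F 1 by (intro that[of "F - B"]) (auto simp: F_def)
qed

text \<open>A Markov inequality: on light atoms the entropy summand is at least c times the mass. It
  is used with c = ln(1/t) for \<beta> = 1 and with c = t^(\<beta>-1) for \<beta> < 1.\<close>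

lemma tail_bound:
  assumes "0 \<le> c" "\<And>x. 0 < x \<Longrightarrow> x < t \<Longrightarrow> x \<le> 1 \<Longrightarrow> c * x \<le> ent_term \<beta> x"
    "ent_sum \<beta> X \<le> ennreal M" "0 \<le> M"
  shows "c * measure_pmf.prob X {a. pmf X a < t} \<le> M"
proof -
  let ?T = "{a. pmf X a < t}"
  have "ennreal (c * measure_pmf.prob X ?T) = ennreal c * (\<integral>\<^sup>+ a. ennreal (pmf X a) * indicator ?T a \<partial>count_space UNIV)"
    using assms(1) nn_integral_pmf[of ?T X]
    by (simp add: ennreal_mult measure_pmf.emeasure_eq_measure nn_integral_count_space_indicator)
  also have "\<dots> = (\<integral>\<^sup>+ a. ennreal c * (ennreal (pmf X a) * indicator ?T a) \<partial>count_space UNIV)"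
    by (simp add: nn_integral_cmult)
  also have "\<dots> \<le> ent_sum \<beta> X" unfolding ent_sum_def
  proof (rule nn_integral_mono)
    fix a
    show "ennreal c * (ennreal (pmf X a) * indicator ?T a) \<le> ennreal (ent_term \<beta> (pmf X a))"
      using assms(1) assms(2)[of "pmf X a"] pmf_le_1[of X a]
      by (cases "pmf X a = 0")
         (auto split: split_indicator simp: less_le simp flip: ennreal_mult intro!: ennreal_leI)
  qed
  also have "\<dots> \<le> ennreal M" by fact
  finally show ?thesis using assms(4) by simp
qed

lemma renyi_1_le_iff: "0 \<le> D \<Longrightarrow> renyi_entropy 1 X \<le> ereal D \<longleftrightarrow> ent_sum 1 X \<le> ennreal D"
  by (simp add: renyi_entropy_def shannon_eq less_eq_ennreal.rep_eq enn2ereal_ennreal)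

lemma renyi_lt_1_le_iff:
  assumes "\<beta> < 1"
  shows "renyi_entropy \<beta> X \<le> ereal D \<longleftrightarrow> ent_sum \<beta> X \<le> ennreal (exp ((1 - \<beta>) * D))"
proof (cases "ent_sum \<beta> X")
  case (real r)
  then have "0 < r" using ent_sum_pos[of \<beta> X] assms by simp
  have "ln r / (1 - \<beta>) \<le> D \<longleftrightarrow> ln r \<le> (1 - \<beta>) * D" using assms by (simp add: field_simps)
  also have "\<dots> \<longleftrightarrow> r \<le> exp ((1 - \<beta>) * D)"
    using \<open>0 < r\<close> by (metis exp_gt_zero exp_ln ln_exp ln_le_cancel_iff)
  finally show ?thesis using real \<open>0 < r\<close> assms by (simp add: renyi_entropy_def power_sum_eq)
qed (use assms in \<open>simp add: renyi_entropy_def power_sum_eq top_unique\<close>)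

text \<open>Division by 1 - \<beta> < 0 turns the entropy bound into a lower bound on the power sum:
  it forces concentration instead of limiting the tail directly.\<close>

lemma renyi_gt_1_le_iff:
  assumes "1 < \<beta>"
  shows "renyi_entropy \<beta> X \<le> ereal D \<longleftrightarrow> ennreal (exp (- ((\<beta> - 1) * D))) \<le> ent_sum \<beta> X"
proof (cases "ent_sum \<beta> X")
  case (real r)
  then have "0 < r" using ent_sum_pos[of \<beta> X] assms by simp
  have "ln r / (1 - \<beta>) \<le> D \<longleftrightarrow> - ((\<beta> - 1) * D) \<le> ln r" using assms by (simp add: field_simps)
  also have "\<dots> \<longleftrightarrow> exp (- ((\<beta> - 1) * D)) \<le> r"
    using \<open>0 < r\<close> by (metis exp_gt_zero exp_ln ln_exp ln_le_cancel_iff)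
  finally show ?thesis using real \<open>0 < r\<close> assms by (simp add: renyi_entropy_def power_sum_eq)
next
  case top
  then show ?thesis using ent_sum_le_1[OF assms, of X] by (simp add: top_unique)
qed

definition admissible :: "real \<Rightarrow> real \<Rightarrow> real \<Rightarrow> nat \<Rightarrow> real \<Rightarrow> int pmf \<Rightarrow> bool" where
  "admissible \<alpha> \<beta> D h C X \<longleftrightarrow> deficit_defined \<alpha> h X \<and> deficit \<alpha> h X \<le> ereal C \<and>
     renyi_entropy \<beta> X \<le> ereal D"

lemma Bh_defect_le_tail_large:
  assumes "0 < \<alpha>" "1 \<le> real h * \<alpha>" "0 \<le> C" "C \<le> 1" "0 < t"
    and "deficit_defined \<alpha> h X" "deficit \<alpha> h X \<le> ereal C"
    and W: "\<alpha> < 1 \<Longrightarrow> ent_sum \<alpha> (U_law h X) \<le> ennreal W" "1 \<le> W"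
  shows "Bh_defect h X \<le> measure_pmf.prob X {a. pmf X a < t}
     + removal_const \<alpha> W * C * t powr (1 - real h * \<alpha>)"
proof -
  obtain R where R: "finite R" "\<And>a. a \<in> R \<Longrightarrow> t \<le> pmf X a"
    "(\<Sum>a\<in>R. pmf X a powr (real h * \<alpha>)) \<le> removal_const \<alpha> W * C"
    "Bh_defect h X \<le> measure_pmf.prob X {a. pmf X a < t} + (\<Sum>a\<in>R. pmf X a)"
    using Bh_defect_removal[OF assms(1,3,4,6,7) W assms(5)] by blast
  have "(\<Sum>a\<in>R. pmf X a) \<le> (\<Sum>a\<in>R. pmf X a powr (real h * \<alpha>)) * t powr (1 - real h * \<alpha>)"
    using R assms by (intro sum_le_sum_powr_ge_1) auto
  also have "\<dots> \<le> removal_const \<alpha> W * C * t powr (1 - real h * \<alpha>)"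
    using R(3) by (intro mult_right_mono) auto
  finally show ?thesis using R(4) by simp
qed

lemma Bh_defect_le_tail_small:
  assumes "0 < h" "0 < \<alpha>" "real h * \<alpha> \<le> 1" "0 \<le> C" "C \<le> 1" "0 < t"
    and "deficit_defined \<alpha> h X" "deficit \<alpha> h X \<le> ereal C"
    and W: "\<alpha> < 1 \<Longrightarrow> ent_sum \<alpha> (U_law h X) \<le> ennreal W" "1 \<le> W"
  shows "Bh_defect h X \<le> measure_pmf.prob X {a. pmf X a < t}
     + (removal_const \<alpha> W * C) powr (1 / (real h * \<alpha>))"
proof -
  obtain R where R: "finite R" "\<And>a. a \<in> R \<Longrightarrow> t \<le> pmf X a"
    "(\<Sum>a\<in>R. pmf X a powr (real h * \<alpha>)) \<le> removal_const \<alpha> W * C"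
    "Bh_defect h X \<le> measure_pmf.prob X {a. pmf X a < t} + (\<Sum>a\<in>R. pmf X a)"
    using Bh_defect_removal[OF assms(2,4,5,7,8) W assms(6)] by blast
  have "(\<Sum>a\<in>R. pmf X a) \<le> (\<Sum>a\<in>R. pmf X a powr (real h * \<alpha>)) powr (1 / (real h * \<alpha>))"
    using R assms by (intro sum_le_sum_powr_le_1) auto
  also have "\<dots> \<le> (removal_const \<alpha> W * C) powr (1 / (real h * \<alpha>))"
    using R(3) assms by (intro powr_mono2) (auto intro: sum_nonneg)
  finally show ?thesis using R(4) by simp
qed

lemma ent_sum_antimono:
  assumes "0 < \<beta>" "\<beta> \<le> \<alpha>" "\<alpha> < 1"
  shows "ent_sum \<alpha> X \<le> ent_sum \<beta> X"
  unfolding ent_sum_def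
proof (intro nn_integral_mono ennreal_leI)
  fix x
  show "ent_term \<alpha> (pmf X x) \<le> ent_term \<beta> (pmf X x)"
    using assms by (cases "pmf X x = 0") (auto simp: ent_term_def pmf_le_1 intro!: powr_mono')
qed

lemma Bh_defect_le_shannon:
  assumes "2 \<le> h" "1 \<le> \<alpha>" "0 < D" "0 \<le> C" "C \<le> 1" "0 < t" "t < 1" "admissible \<alpha> 1 D h C X"
  shows "Bh_defect h X \<le> D / ln (1 / t) + removal_const \<alpha> 1 * C * t powr (1 - real h * \<alpha>)"
proof -
  have ent: "ent_sum 1 X \<le> ennreal D" using assms by (simp add: admissible_def renyi_1_le_iff)
  have lt: "0 < ln (1 / t)" using assms by simp
  have "ln (1 / t) * measure_pmf.prob X {a. pmf X a < t} \<le> D"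
  proof (rule tail_bound[OF _ _ ent])
    fix x :: real assume x: "0 < x" "x < t"
    then have "ln x \<le> ln t" using assms by simp
    then have "x * ln x \<le> x * ln t" using x by simp
    then show "ln (1 / t) * x \<le> ent_term 1 x" using assms by (simp add: ent_term_def ln_div mult.commute)
  qed (use assms lt in auto)
  then have "measure_pmf.prob X {a. pmf X a < t} \<le> D / ln (1 / t)" using lt by (simp add: field_simps)
  moreover have "1 \<le> real h * \<alpha>" using assms mult_mono[of 1 "real h" 1 \<alpha>] by simp
  ultimately show ?thesis
    using Bh_defect_le_tail_large[of \<alpha> h C t X 1] assms by (auto simp: admissible_def)
qed

text \<open>Atoms lighter than \<open>t\<close> contribute at most t^(\<beta>-1) to the power sum,
  so the heavy atoms contribute the rest. Their power sum is at most the \<beta>-th power of their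
  total mass, which bounds that mass from below and hence the tail from above.\<close>

lemma Bh_defect_le_renyi_gt_1:
  assumes "2 \<le> h" "1 \<le> \<alpha>" "1 < \<beta>" "0 < D" "0 \<le> C" "C \<le> 1" "0 < t" "admissible \<alpha> \<beta> D h C X"
    and small: "t powr (\<beta> - 1) \<le> exp (- ((\<beta> - 1) * D))"
  shows "Bh_defect h X \<le> 1 - (exp (- ((\<beta> - 1) * D)) - t powr (\<beta> - 1)) powr (1 / \<beta>)
     + removal_const \<alpha> 1 * C * t powr (1 - real h * \<alpha>)"
proof -
  let ?F = "{a. t \<le> pmf X a}" and ?E = "exp (- ((\<beta> - 1) * D))"
  have F: "finite ?F" by (rule finite_heavy) fact
  have "ennreal ?E \<le> ent_sum \<beta> X" using assms by (simp add: admissible_def renyi_gt_1_le_iff)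
  also have "\<dots> \<le> (\<integral>\<^sup>+ a. ennreal (pmf X a powr \<beta> * indicator ?F a) + ennreal (t powr (\<beta> - 1)) * ennreal (pmf X a) \<partial>count_space UNIV)"
    unfolding ent_sum_def
  proof (rule nn_integral_mono)
    fix a
    have "pmf X a powr \<beta> \<le> t powr (\<beta> - 1) * pmf X a" if "pmf X a < t"
    proof -
      have "pmf X a powr \<beta> = pmf X a powr (\<beta> - 1) * pmf X a"
        by (cases "pmf X a = 0") (auto simp: powr_diff)
      also have "\<dots> \<le> t powr (\<beta> - 1) * pmf X a"
        using that assms by (intro mult_right_mono powr_mono2) auto
      finally show ?thesis .
    qed
    then show "ennreal (ent_term \<beta> (pmf X a)) \<le> ennreal (pmf X a powr \<beta> * indicator ?F a) + ennreal (t powr (\<beta> - 1)) * ennreal (pmf X a)"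
      using assms(3) by (auto split: split_indicator simp: ent_term_def simp flip: ennreal_mult ennreal_plus intro!: ennreal_leI)
  qed
  also have "\<dots> = (\<integral>\<^sup>+ a. ennreal (pmf X a powr \<beta> * indicator ?F a) \<partial>count_space UNIV) + ennreal (t powr (\<beta> - 1))"
    by (simp add: nn_integral_add nn_integral_cmult nn_integral_pmf)
  also have "(\<integral>\<^sup>+ a. ennreal (pmf X a powr \<beta> * indicator ?F a) \<partial>count_space UNIV)
    = ennreal (\<Sum>a\<in>?F. pmf X a powr \<beta> * indicator ?F a)"
    by (rule nn_integral_finite_support[OF F]) auto
  also have "(\<Sum>a\<in>?F. pmf X a powr \<beta> * indicator ?F a) = (\<Sum>a\<in>?F. pmf X a powr \<beta>)"
    by (rule sum.cong) auto
  also have "ennreal \<dots> + ennreal (t powr (\<beta> - 1)) = ennreal ((\<Sum>a\<in>?F. pmf X a powr \<beta>) + t powr (\<beta> - 1))"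
    by (rule ennreal_plus[symmetric]) (auto intro: sum_nonneg)
  finally have "?E \<le> (\<Sum>a\<in>?F. pmf X a powr \<beta>) + t powr (\<beta> - 1)"
    by (subst (asm) ennreal_le_iff) (auto intro!: sum_nonneg add_nonneg_nonneg)
  also have "(\<Sum>a\<in>?F. pmf X a powr \<beta>) \<le> (\<Sum>a\<in>?F. pmf X a) powr \<beta>"
    using F assms by (intro sum_powr_le_powr_sum) auto
  also have "(\<Sum>a\<in>?F. pmf X a) = measure_pmf.prob X ?F" using F by (simp add: measure_measure_pmf_finite)
  finally have "?E - t powr (\<beta> - 1) \<le> measure_pmf.prob X ?F powr \<beta>" by simp
  then have "(?E - t powr (\<beta> - 1)) powr (1 / \<beta>) \<le> (measure_pmf.prob X ?F powr \<beta>) powr (1 / \<beta>)"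
    using small assms by (intro powr_mono2) auto
  also have "\<dots> = measure_pmf.prob X ?F" using assms by (simp add: powr_powr)
  also have "\<dots> = 1 - measure_pmf.prob X {a. pmf X a < t}"
  proof -
    have "{a. pmf X a < t} = UNIV - ?F" by auto
    then show ?thesis using measure_pmf.prob_compl[of ?F X] by simp
  qed
  finally have "measure_pmf.prob X {a. pmf X a < t} \<le> 1 - (?E - t powr (\<beta> - 1)) powr (1 / \<beta>)" by simp
  moreover have "1 \<le> real h * \<alpha>" using assms mult_mono[of 1 "real h" 1 \<alpha>] by simp
  ultimately show ?thesis
    using Bh_defect_le_tail_large[of \<alpha> h C t X 1] assms by (auto simp: admissible_def)
qed

lemma tail_bound_renyi_lt_1:
  assumes "0 < \<beta>" "\<beta> < 1" "0 < t" "renyi_entropy \<beta> X \<le> ereal D"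
  shows "measure_pmf.prob X {a. pmf X a < t} \<le> t powr (1 - \<beta>) * exp ((1 - \<beta>) * D)"
proof -
  have "t powr (\<beta> - 1) * measure_pmf.prob X {a. pmf X a < t} \<le> exp ((1 - \<beta>) * D)"
  proof (rule tail_bound)
    show "ent_sum \<beta> X \<le> ennreal (exp ((1 - \<beta>) * D))" using assms by (simp add: renyi_lt_1_le_iff)
    fix x :: real assume x: "0 < x" "x < t"
    have "t powr (\<beta> - 1) * x \<le> x powr (\<beta> - 1) * x"
      using x assms by (intro mult_right_mono powr_mono2') auto
    also have "\<dots> = ent_term \<beta> x" using x assms by (simp add: ent_term_def powr_diff)
    finally show "t powr (\<beta> - 1) * x \<le> ent_term \<beta> x" .
  qed auto
  then have "t powr (1 - \<beta>) * (t powr (\<beta> - 1) * measure_pmf.prob X {a. pmf X a < t})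
     \<le> t powr (1 - \<beta>) * exp ((1 - \<beta>) * D)" by (intro mult_left_mono) auto
  then show ?thesis using assms by (simp flip: mult.assoc powr_add)
qed

text \<open>On [0, 1] one has x^\<alpha> <= x^\<beta>, so the constraint at \<beta> also controls
  the power sum at \<alpha>; this is what \<alpha> >= \<beta> buys in the upper bound.\<close>

lemma ent_sum_U_bound:
  assumes "0 < \<beta>" "\<beta> \<le> \<alpha>" "\<alpha> < 1" "renyi_entropy \<beta> X \<le> ereal D"
  shows "ent_sum \<alpha> (U_law h X) \<le> ennreal (exp ((1 - \<beta>) * D) ^ h)"
proof -
  have "ent_sum \<alpha> (U_law h X) \<le> ent_sum \<alpha> X ^ h" using assms by (intro ent_sum_U_le) auto
  also have "\<dots> \<le> ennreal (exp ((1 - \<beta>) * D)) ^ h"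
    using ent_sum_antimono[of \<beta> \<alpha> X] assms renyi_lt_1_le_iff[of \<beta> X D]
    by (intro power_mono) (auto intro: order_trans)
  finally show ?thesis by (simp add: ennreal_power)
qed

lemma Bh_defect_le_renyi_lt_1_large:
  assumes "2 \<le> h" "0 < \<beta>" "\<beta> < 1" "\<beta> \<le> \<alpha>" "0 < D" "0 \<le> C" "C \<le> 1" "0 < t"
    "1 \<le> real h * \<alpha>" "admissible \<alpha> \<beta> D h C X"
  shows "Bh_defect h X \<le> t powr (1 - \<beta>) * exp ((1 - \<beta>) * D)
     + removal_const \<alpha> (exp ((1 - \<beta>) * D) ^ h) * C * t powr (1 - real h * \<alpha>)"
proof -
  have "1 \<le> exp ((1 - \<beta>) * D) ^ h" using assms by (intro one_le_power) simp
  then show ?thesis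
    using Bh_defect_le_tail_large[of \<alpha> h C t X "exp ((1 - \<beta>) * D) ^ h"] tail_bound_renyi_lt_1[of \<beta> t X D]
      ent_sum_U_bound[of \<beta> \<alpha> X D h] assms by (fastforce simp: admissible_def)
qed

lemma Bh_defect_le_renyi_lt_1_small:
  assumes "2 \<le> h" "0 < \<beta>" "\<beta> < 1" "\<beta> \<le> \<alpha>" "0 < D" "0 \<le> C" "C \<le> 1" "0 < t"
    "real h * \<alpha> \<le> 1" "admissible \<alpha> \<beta> D h C X"
  shows "Bh_defect h X \<le> t powr (1 - \<beta>) * exp ((1 - \<beta>) * D)
     + (removal_const \<alpha> (exp ((1 - \<beta>) * D) ^ h) * C) powr (1 / (real h * \<alpha>))"
proof -
  have "1 \<le> exp ((1 - \<beta>) * D) ^ h" using assms by (intro one_le_power) simp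
  then show ?thesis
    using Bh_defect_le_tail_small[of h \<alpha> C t X "exp ((1 - \<beta>) * D) ^ h"] tail_bound_renyi_lt_1[of \<beta> t X D]
      ent_sum_U_bound[of \<beta> \<alpha> X D h] assms by (fastforce simp: admissible_def)
qed

section \<open>Moment curves modulo a prime\<close>

definition esym_fps :: "int multiset \<Rightarrow> int fps" where
  "esym_fps u = (\<Prod>x\<in>#u. 1 + fps_const x * fps_X)"

definition power_sum_mset :: "int multiset \<Rightarrow> nat \<Rightarrow> int" where
  "power_sum_mset u j = (\<Sum>x\<in>#u. x ^ j)"

lemma esym_fps_empty [simp]: "esym_fps {#} = 1" by (simp add: esym_fps_def)

lemma esym_fps_add [simp]: "esym_fps (add_mset x u) = (1 + fps_const x * fps_X) * esym_fps u"
  by (simp add: esym_fps_def)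

lemma power_sum_mset_empty [simp]: "power_sum_mset {#} j = 0" by (simp add: power_sum_mset_def)

lemma power_sum_mset_add [simp]: "power_sum_mset (add_mset x u) j = x ^ j + power_sum_mset u j" by (simp add: power_sum_mset_def)

text \<open>A logarithmic derivative: the factor 1 + x X contributes x / (1 + x X), whose
  coefficients are (-1)^j x^(j+1); clearing denominators gives the product form.\<close>

lemma newton_identity_fps:
  "fps_deriv (esym_fps u) = esym_fps u * Abs_fps (\<lambda>j. (-1) ^ j * power_sum_mset u (Suc j))"
proof (induction u)
  case (add x u)
  let ?A = "1 + fps_const x * fps_X"
  let ?G = "Abs_fps (\<lambda>j. (-1) ^ j * x ^ Suc j)"
  have AG: "?A * ?G = fps_const x"
  proof (rule fps_ext)
    fix n show "(?A * ?G) $ n = fps_const x $ n"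
      by (cases n) (simp_all add: distrib_right mult.assoc)
  qed
  have "Abs_fps (\<lambda>j. (-1) ^ j * power_sum_mset (add_mset x u) (Suc j))
      = ?G + Abs_fps (\<lambda>j. (-1) ^ j * power_sum_mset u (Suc j))"
    by (rule fps_ext) (simp add: distrib_left)
  moreover have "fps_deriv (esym_fps (add_mset x u)) = fps_const x * esym_fps u + ?A * fps_deriv (esym_fps u)"
    by (simp add: algebra_simps)
  moreover have "?A * ?G * esym_fps u + ?A * (esym_fps u * Q) = (?A * esym_fps u) * (?G + Q)" for Q
    by (simp only: distrib_left distrib_right mult_ac)
  ultimately show ?case by (simp only: add.IH esym_fps_add AG)
qed (simp add: fps_eq_iff)

lemma newton_identity:
  "int (Suc n) * esym_fps u $ Suc n = (\<Sum>i=0..n. esym_fps u $ i * ((-1) ^ (n - i) * power_sum_mset u (Suc (n - i))))"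
proof -
  have "fps_deriv (esym_fps u) $ n = (esym_fps u * Abs_fps (\<lambda>j. (-1) ^ j * power_sum_mset u (Suc j))) $ n"
    by (simp only: newton_identity_fps)
  then show ?thesis by (simp add: fps_mult_nth)
qed

text \<open>Newton's identity expresses n times the n-th elementary symmetric polynomial through
  power sums and lower ones, and each n with 0 < n <= k < p is invertible modulo p.\<close>

lemma esym_fps_cong:
  assumes "prime p" "int k < p" "\<And>j. 1 \<le> j \<Longrightarrow> j \<le> k \<Longrightarrow> [power_sum_mset u j = power_sum_mset v j] (mod p)" "n \<le> k"
  shows "[esym_fps u $ n = esym_fps v $ n] (mod p)"
  using assms(4)
proof (induction n rule: less_induct)
  case (less n)
  show ?case
  proof (cases n)
    case 0
    have "esym_fps w $ 0 = 1" for w by (induction w) auto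
    then show ?thesis using 0 by simp
  next
    case (Suc l)
    have "[(\<Sum>i=0..l. esym_fps u $ i * ((-1) ^ (l - i) * power_sum_mset u (Suc (l - i))))
        = (\<Sum>i=0..l. esym_fps v $ i * ((-1) ^ (l - i) * power_sum_mset v (Suc (l - i))))] (mod p)"
      using less Suc by (intro cong_sum cong_mult assms(3)) auto
    then have "[int (Suc l) * esym_fps u $ Suc l = int (Suc l) * esym_fps v $ Suc l] (mod p)"
      by (simp only: newton_identity)
    moreover have "\<not> p dvd int (Suc l)"
      using assms(2) less Suc zdvd_not_zless[of "int (Suc l)" p] by auto
    then have "coprime p (int (Suc l))" by (rule prime_imp_coprime[OF assms(1)])
    then have "coprime (int (Suc l)) p" using coprime_commute by blast
    ultimately show ?thesis using Suc cong_mult_lcancel by blast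
  qed
qed

lemma esym_fps_degree: "size u < n \<Longrightarrow> esym_fps u $ n = 0"
proof (induction u arbitrary: n)
  case (add x u)
  then show ?case by (cases n) (auto simp: distrib_right mult.assoc)
qed auto

text \<open>The elementary symmetric polynomials are the coefficients of a polynomial that vanishes
  at z = -x for every x in \<open>u\<close>; this lets points be recovered from them.\<close>

lemma esym_fps_eval: "(\<Sum>n\<le>size u. esym_fps u $ n * z ^ (size u - n)) = (\<Prod>y\<in>#u. z + y)"
proof (induction u)
  case (add x u)
  let ?s = "size u"
  have nth: "esym_fps (add_mset x u) $ Suc n = esym_fps u $ Suc n + x * esym_fps u $ n" for n
    by (simp add: distrib_right mult.assoc)
  have nth0: "esym_fps (add_mset x u) $ 0 = esym_fps u $ 0" by simp
  have "(\<Sum>n\<le>size (add_mset x u). esym_fps (add_mset x u) $ n * z ^ (size (add_mset x u) - n))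
     = esym_fps u $ 0 * z ^ Suc ?s + (\<Sum>n\<le>?s. (esym_fps u $ Suc n + x * esym_fps u $ n) * z ^ (?s - n))"
    by (simp only: size_add_mset sum.atMost_Suc_shift nth nth0) simp
  also have "\<dots> = (esym_fps u $ 0 * z ^ Suc ?s + (\<Sum>n\<le>?s. esym_fps u $ Suc n * z ^ (?s - n)))
     + x * (\<Sum>n\<le>?s. esym_fps u $ n * z ^ (?s - n))"
    by (simp add: distrib_right sum.distrib sum_distrib_left mult.assoc)
  also have "esym_fps u $ 0 * z ^ Suc ?s + (\<Sum>n\<le>?s. esym_fps u $ Suc n * z ^ (?s - n))
     = (\<Sum>n\<le>Suc ?s. esym_fps u $ n * z ^ (Suc ?s - n))"
    by (simp only: sum.atMost_Suc_shift) simp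
  also have "\<dots> = z * (\<Sum>n\<le>?s. esym_fps u $ n * z ^ (?s - n))"
    by (simp add: esym_fps_degree sum_distrib_left Suc_diff_le mult_ac)
  finally show ?case by (simp add: add.IH algebra_simps)
qed simp

text \<open>Modulo p the monic polynomials with roots -u and -v have equal coefficients. At -x with
  x in \<open>u\<close> the product over \<open>v\<close> is divisible by p, so some y in
  \<open>v\<close> is congruent to x, and equal to it because both lie in {0..<p}. Remove this
  common point and induct.\<close>

lemma power_sums_determine:
  assumes "prime p" "size u = k" "size v = k" "int k < p" "set_mset u \<subseteq> {0..<p}" "set_mset v \<subseteq> {0..<p}"
    "\<And>j. 1 \<le> j \<Longrightarrow> j \<le> k \<Longrightarrow> [power_sum_mset u j = power_sum_mset v j] (mod p)"
  shows "u = v"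
  using assms(2-)
proof (induction k arbitrary: u v)
  case (Suc k)
  obtain x where x: "x \<in># u" using Suc.prems(1) by fastforce
  have ec: "[esym_fps u $ n = esym_fps v $ n] (mod p)" if "n \<le> Suc k" for n
    using esym_fps_cong[OF assms(1) Suc.prems(3,6) that] by blast
  have "[(\<Sum>n\<le>Suc k. esym_fps u $ n * (-x) ^ (Suc k - n)) = (\<Sum>n\<le>Suc k. esym_fps v $ n * (-x) ^ (Suc k - n))] (mod p)"
    by (intro cong_sum cong_mult ec cong_refl) auto
  then have "[(\<Prod>y\<in>#u. - x + y) = (\<Prod>y\<in>#v. - x + y)] (mod p)"
    using esym_fps_eval[of u "-x"] esym_fps_eval[of v "-x"] Suc.prems(1,2) by simp
  moreover have "(\<Prod>y\<in>#u. - x + y) = 0" using x by (auto simp: prod_mset_zero_iff)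
  ultimately have "[(\<Prod>y\<in>#v. - x + y) = 0] (mod p)" by (simp only: cong_sym_eq)
  then have "p dvd (\<Prod>y\<in>#v. - x + y)" by (simp only: cong_0_iff)
  then obtain y where y: "y \<in># v" "p dvd - x + y"
    using prime_dvd_prod_mset_iff[OF assms(1)] by auto
  have "0 \<le> x" "x < p" "0 \<le> y" "y < p" using x y Suc.prems(4,5) by auto
  moreover have "y mod p = x mod p" using y(2) by (simp add: mod_eq_dvd_iff)
  ultimately have "x = y" by simp
  then obtain u' v' where uv: "u = add_mset x u'" "v = add_mset x v'"
    using x y(1) by (metis insert_DiffM)
  have "u' = v'"
  proof (rule Suc.IH)
    fix j assume "1 \<le> j" "j \<le> k"
    then have "[power_sum_mset u j = power_sum_mset v j] (mod p)" using Suc.prems(6) by simp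
    then show "[power_sum_mset u' j = power_sum_mset v' j] (mod p)" by (simp add: uv cong_add_lcancel)
  qed (use Suc.prems uv in auto)
  then show ?case by (simp add: uv)
qed simp

section \<open>Encoding the curves by base-L digits\<close>

lemma base_digits_unique:
  fixes L :: int
  assumes "\<And>k. k < n \<Longrightarrow> 0 \<le> d k \<and> d k < L" "\<And>k. k < n \<Longrightarrow> 0 \<le> d' k \<and> d' k < L"
    "(\<Sum>k<n. d k * L ^ k) = (\<Sum>k<n. d' k * L ^ k)" "k < n"
  shows "d k = d' k"
  using assms
proof (induction n arbitrary: d d' k)
  case (Suc n)
  have split: "(\<Sum>k<Suc n. f k * L ^ k) = f 0 + L * (\<Sum>k<n. f (Suc k) * L ^ k)" for f :: "nat \<Rightarrow> int"
    by (simp add: sum.lessThan_Suc_shift sum_distrib_left mult_ac del: sum.lessThan_Suc)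
  have eq: "d 0 + L * (\<Sum>k<n. d (Suc k) * L ^ k) = d' 0 + L * (\<Sum>k<n. d' (Suc k) * L ^ k)"
    using Suc.prems(3) by (simp only: split)
  have b: "0 \<le> d 0" "d 0 < L" "0 \<le> d' 0" "d' 0 < L" using Suc.prems(1,2)[of 0] by auto
  have "d 0 = (d 0 + L * (\<Sum>k<n. d (Suc k) * L ^ k)) mod L" using b by simp
  also have "\<dots> = (d' 0 + L * (\<Sum>k<n. d' (Suc k) * L ^ k)) mod L" by (simp only: eq)
  also have "\<dots> = d' 0" using b by simp
  finally have d0: "d 0 = d' 0" .
  then have "(\<Sum>k<n. d (Suc k) * L ^ k) = (\<Sum>k<n. d' (Suc k) * L ^ k)" using eq b by simp
  then have "d (Suc j) = d' (Suc j)" if "j < n" for j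
    using that Suc.prems by (intro Suc.IH[of "\<lambda>k. d (Suc k)" "\<lambda>k. d' (Suc k)"]) auto
  then show ?case using d0 Suc.prems(4) by (cases k) auto
qed simp

text \<open>
  Code points \<open>(i, x)\<close> with \<open>i < m\<close> carry the truncated moment curve \<open>x \<mapsto> (1, x, \<dots>, x\<^bsup>h-1\<^esup>)\<close> modulo
  \<open>p\<close> in the \<open>i\<close>-th block of \<open>h\<close> base-\<open>L\<close> digits; every point with \<open>i \<ge> m\<close> is encoded by 0.
\<close>

definition digit :: "nat \<Rightarrow> int \<Rightarrow> nat \<times> int \<Rightarrow> nat \<Rightarrow> int" where
  "digit h p z k = (if k div h = fst z then snd z ^ (k mod h) mod p else 0)"

definition code :: "nat \<Rightarrow> int \<Rightarrow> int \<Rightarrow> nat \<Rightarrow> nat \<times> int \<Rightarrow> int" where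
  "code h p L m z = (\<Sum>k<m * h. digit h p z k * L ^ k)"

definition block :: "nat \<Rightarrow> (nat \<times> int) multiset \<Rightarrow> int multiset" where
  "block i w = image_mset snd (filter_mset (\<lambda>z. fst z = i) w)"

lemma code_sum: "(\<Sum>z\<in>#w. code h p L m z) = (\<Sum>k<m * h. (\<Sum>z\<in>#w. digit h p z k) * L ^ k)"
  by (induction w) (auto simp: code_def sum.distrib distrib_right)

lemma digit_bounds: "0 < p \<Longrightarrow> 0 \<le> digit h p z k \<and> digit h p z k \<le> p"
  by (auto simp: digit_def less_imp_le)

lemma digit_sum_bounds:
  assumes "0 < p" shows "0 \<le> (\<Sum>z\<in>#w. digit h p z k) \<and> (\<Sum>z\<in>#w. digit h p z k) \<le> int (size w) * p"
proof (induction w)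
  case (add z w)
  then show ?case using digit_bounds[OF assms, of h z k] by (simp add: distrib_right)
qed simp

lemma digit_sum_block:
  assumes "j < h"
  shows "(\<Sum>z\<in>#w. digit h p z (i * h + j)) = (\<Sum>x\<in>#block i w. x ^ j mod p)"
proof -
  have "(i * h + j) div h = i" "(i * h + j) mod h = j" using assms by auto
  then show ?thesis by (induction w) (auto simp: digit_def block_def)
qed

lemma sum_mod_cong: "[(\<Sum>x\<in>#u. f x mod p) = (\<Sum>x\<in>#u. f x)] (mod (p::int))"
  by (induction u) (auto intro: cong_add)

lemma filter_block: "filter_mset (\<lambda>z. fst z = i) w = image_mset (Pair i) (block i w)"
  by (induction w) (auto simp: block_def)

lemma replicate_mset_eqI: "\<forall>z\<in>#v. z = a \<Longrightarrow> v = replicate_mset (size v) a"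
  by (induction v) auto

text \<open>Digit sums of at most h points are at most h p < L, so no carry occurs and equal sums
  mean that in every block the power sums of orders 0, ..., h - 1 agree modulo p. A block with fewer
  than h points is then determined. The exception is a block holding all h points, for which the
  order h is missing; in that case nothing is left outside it.\<close>

lemma code_collision:
  assumes p: "prime p" "int h < p" and h: "1 \<le> h" and L: "int h * p < L"
    and w: "set_mset w \<subseteq> {..<m} \<times> {0..<p} \<union> {(m, 0)}" "set_mset w' \<subseteq> {..<m} \<times> {0..<p} \<union> {(m, 0)}"
    and sz: "size w = size w'" "size w \<le> h"
    and eq: "(\<Sum>z\<in>#w. code h p L m z) = (\<Sum>z\<in>#w'. code h p L m z)"
  shows "w = w' \<or> size w = h \<and> (\<exists>i<m. set_mset w \<subseteq> {i} \<times> {0..<p} \<and> set_mset w' \<subseteq> {i} \<times> {0..<p})"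
proof -
  have p0: "0 < p" using p by (simp add: prime_gt_0_int)
  have p1: "1 < p" using p by (simp add: prime_gt_1_int)
  have bd: "0 \<le> (\<Sum>z\<in>#w. digit h p z k) \<and> (\<Sum>z\<in>#w. digit h p z k) < L" if "size w \<le> h" for w k
  proof -
    have "int (size w) * p \<le> int h * p" using that p0 by (intro mult_right_mono) auto
    then show ?thesis using digit_sum_bounds[OF p0, of h k w] L by auto
  qed
  have dig: "(\<Sum>z\<in>#w. digit h p z k) = (\<Sum>z\<in>#w'. digit h p z k)" if "k < m * h" for k
    using base_digits_unique[of "m * h" "\<lambda>k. \<Sum>z\<in>#w. digit h p z k" L "\<lambda>k. \<Sum>z\<in>#w'. digit h p z k" k]
      bd[of w] bd[of w'] sz eq that unfolding code_sum by auto
  have mom: "(\<Sum>x\<in>#block i w. x ^ j mod p) = (\<Sum>x\<in>#block i w'. x ^ j mod p)" if "i < m" "j < h" for i j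
  proof -
    have "i * h + j < Suc i * h" using that by simp
    also have "\<dots> \<le> m * h" using that by (intro mult_right_mono) auto
    finally show ?thesis using dig[of "i * h + j"] that by (simp add: digit_sum_block)
  qed
  \<comment> \<open>Digit 0 of a block is \<open>1 mod p = 1\<close> for each of its points, so it
    counts them.\<close>
  have bsz: "size (block i w) = size (block i w')" if "i < m" for i
    using mom[OF that, of 0] h p1 by simp
  have bset: "set_mset (block i w) \<subseteq> {0..<p}" "set_mset (block i w') \<subseteq> {0..<p}" if "i < m" for i
    using w that by (auto simp: block_def)
  have beq: "block i w = block i w'" if i: "i < m" and lt: "size (block i w) < h" for i
  proof (rule power_sums_determine[OF p(1) refl bsz[OF i, symmetric] _ bset[OF i]])
    show "int (size (block i w)) < p" using lt p by simp
    fix j assume "1 \<le> j" "j \<le> size (block i w)"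
    then have "(\<Sum>x\<in>#block i w. x ^ j mod p) = (\<Sum>x\<in>#block i w'. x ^ j mod p)" using mom[OF i] lt by simp
    then show "[power_sum_mset (block i w) j = power_sum_mset (block i w') j] (mod p)"
      unfolding power_sum_mset_def using sum_mod_cong[of "\<lambda>x. x ^ j" p] by (metis cong_sym cong_trans)
  qed
  show ?thesis
  proof (cases "\<exists>i<m. size (block i w) = h")
    case True
    then obtain i where i: "i < m" "size (block i w) = h" by blast
    have full: "set_mset v \<subseteq> {i} \<times> {0..<p}"
      if "size (block i v) = h" "size v \<le> h" "set_mset v \<subseteq> {..<m} \<times> {0..<p} \<union> {(m, 0)}" for v
    proof -
      have "size v = size (filter_mset (\<lambda>z. fst z = i) v) + size (filter_mset (\<lambda>z. fst z \<noteq> i) v)"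
        by (subst multiset_partition[of v "\<lambda>z. fst z = i"]) (rule size_union)
      then have "filter_mset (\<lambda>z. fst z \<noteq> i) v = {#}" using that(1,2) by (simp add: block_def)
      then have "fst z = i" if "z \<in># v" for z
        using that unfolding filter_mset_eq_mempty_iff by blast
      then show ?thesis using that(3) i(1) by force
    qed
    have "size w = h" using i sz size_filter_mset_lesseq[of "\<lambda>z. fst z = i" w] by (simp add: block_def)
    then show ?thesis using full[of w] full[of w'] i sz w bsz[OF i(1)] by auto
  next
    case False
    have "size (block i w) < h" if "i < m" for i
    proof -
      have "size (block i w) \<le> h"
        using sz size_filter_mset_lesseq[of "\<lambda>z. fst z = i" w] by (simp add: block_def)
      moreover have "size (block i w) \<noteq> h" using False that by blast
      ultimately show ?thesis by simp
    qed
    then have be: "block i w = block i w'" if "i < m" for i using beq that by blast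
    have low: "filter_mset (\<lambda>z. fst z < m) w = filter_mset (\<lambda>z. fst z < m) w'"
    proof (rule multiset_eqI)
      fix z
      show "count (filter_mset (\<lambda>z. fst z < m) w) z = count (filter_mset (\<lambda>z. fst z < m) w') z"
      proof (cases "fst z < m")
        case True
        have "count (filter_mset (\<lambda>y. fst y = fst z) w) z = count (filter_mset (\<lambda>y. fst y = fst z) w') z"
          using be[OF True] by (simp only: filter_block)
        then show ?thesis using True by simp
      qed simp
    qed
    \<comment> \<open>Outside the blocks there are only copies of \<open>(m, 0)\<close>, whose
      number is fixed by the total size.\<close>
    have high: "filter_mset (\<lambda>z. \<not> fst z < m) v = replicate_mset (size v - size (filter_mset (\<lambda>z. fst z < m) v)) (m, 0)"
      if "set_mset v \<subseteq> {..<m} \<times> {0..<p} \<union> {(m, 0)}" for v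
    proof -
      have "size v = size (filter_mset (\<lambda>z. fst z < m) v) + size (filter_mset (\<lambda>z. \<not> fst z < m) v)"
        by (subst multiset_partition[of v "\<lambda>z. fst z < m"]) (rule size_union)
      moreover have "\<forall>z\<in>#filter_mset (\<lambda>z. \<not> fst z < m) v. z = (m, 0)" using that by auto
      then have "filter_mset (\<lambda>z. \<not> fst z < m) v = replicate_mset (size (filter_mset (\<lambda>z. \<not> fst z < m) v)) (m, 0)"
        by (rule replicate_mset_eqI)
      ultimately show ?thesis by simp
    qed
    have "filter_mset (\<lambda>z. \<not> fst z < m) w = filter_mset (\<lambda>z. \<not> fst z < m) w'"
      unfolding high[OF w(1)] high[OF w(2)] low sz(1) ..
    then have "w = w'"
      using multiset_partition[of w "\<lambda>z. fst z < m"] multiset_partition[of w' "\<lambda>z. fst z < m"]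
        low by simp
    then show ?thesis ..
  qed
qed

text \<open>Two single points form a collision of size 1 < h; this is why
  \<open>code_collision\<close> admits sizes below h.\<close>

lemma code_inj:
  assumes p: "prime p" "int h < p" and h: "2 \<le> h" and L: "int h * p < L"
  shows "inj_on (code h p L m) ({..<m} \<times> {0..<p} \<union> {(m, 0)})"
proof (rule inj_onI)
  fix z z' assume "z \<in> {..<m} \<times> {0..<p} \<union> {(m, 0)}" "z' \<in> {..<m} \<times> {0..<p} \<union> {(m, 0)}"
    "code h p L m z = code h p L m z'"
  then show "z = z'" using code_collision[OF p _ L, of "{#z#}" m "{#z'#}"] h by simp
qed

text \<open>Within one block the sum of the codes of an h-subset depends only on its moments, so the
  B_h property makes the vector of moments injective on h-subsets of \<open>T\<close>. There are
  only about p^(h-1) vectors, fewer in order than the p^h subsets available to a positive fraction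
  of the block.\<close>

lemma Bh_block_card:
  assumes p: "prime p" "int h < p" and h: "2 \<le> h" and L: "int h * p < L" and i: "i < m"
    and T: "T \<subseteq> {0..<p}" "Bh_set h ((\<lambda>x. code h p L m (i, x)) ` T)"
  shows "real (card T choose h) \<le> (real h * p + 1) ^ (h - 1)"
proof -
  let ?c = "\<lambda>x. code h p L m (i, x)"
  have p0: "0 < p" using p by (simp add: prime_gt_0_int)
  have finT: "finite T" using T(1) finite_subset by blast
  have inj: "inj_on ?c T"
  proof (rule inj_onI)
    fix x y assume xy: "x \<in> T" "y \<in> T" "?c x = ?c y"
    have "(i, x) = (i, y)"
      by (rule inj_onD[OF code_inj[OF p h L, of m] xy(3)]) (use i T(1) xy in auto)
    then show "x = y" by simp
  qed
  let ?S = "{S. S \<subseteq> T \<and> card S = h}"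
  \<comment> \<open>Order 0 is left out: it equals h for every S, and counting it would lose a
    decisive factor of order p.\<close>
  define f where "f S = restrict (\<lambda>j. \<Sum>x\<in>S. x ^ j mod p) {1..<h}" for S
  have fin: "finite S" if "S \<in> ?S" for S using that finT finite_subset by blast
  have sum_eq: "(\<Sum>x\<in>S. ?c x) = (\<Sum>k<m * h. (if k div h = i then (\<Sum>x\<in>S. x ^ (k mod h) mod p) else 0) * L ^ k)" for S
  proof -
    have "(\<Sum>x\<in>S. ?c x) = (\<Sum>k<m * h. \<Sum>x\<in>S. digit h p (i, x) k * L ^ k)"
      unfolding code_def by (rule sum.swap)
    also have "\<dots> = (\<Sum>k<m * h. (if k div h = i then (\<Sum>x\<in>S. x ^ (k mod h) mod p) else 0) * L ^ k)"
      by (rule sum.cong) (simp_all add: digit_def sum_distrib_right)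
    finally show ?thesis .
  qed
  have "inj_on f ?S"
  proof (rule inj_onI)
    fix S S' assume S: "S \<in> ?S" "S' \<in> ?S" "f S = f S'"
    have "(\<Sum>x\<in>S. x ^ j mod p) = (\<Sum>x\<in>S'. x ^ j mod p)" if "j < h" for j
    proof (cases "j = 0")
      case True
      then show ?thesis using S by simp
    next
      case False
      then have "j \<in> {1..<h}" using that by auto
      then show ?thesis using fun_cong[OF S(3), of j] by (simp add: f_def)
    qed
    then have "(\<Sum>x\<in>S. ?c x) = (\<Sum>x\<in>S'. ?c x)"
      unfolding sum_eq using h by (intro sum.cong) auto
    moreover have img: "mset_set (?c ` S) = image_mset ?c (mset_set S)" if "S \<subseteq> T" for S
      by (rule image_mset_mset_set[symmetric, OF inj_on_subset[OF inj that]])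
    ultimately have sm: "sum_mset (mset_set (?c ` S)) = sum_mset (mset_set (?c ` S'))"
      using S img[of S] img[of S'] by (simp add: sum_unfold_sum_mset)
    have in_ms: "mset_set (?c ` S) \<in> multisets_of_size (?c ` T) h" if "S \<in> ?S" for S
      using that fin[OF that] inj by (auto simp: multisets_of_size_def card_image inj_on_subset)
    have "mset_set (?c ` S) = mset_set (?c ` S')"
      using T(2) sm in_ms[OF S(1)] in_ms[OF S(2)] unfolding Bh_set_def by (rule inj_onD)
    then have "set_mset (mset_set (?c ` S)) = set_mset (mset_set (?c ` S'))" by simp
    then have "?c ` S = ?c ` S'" using fin[OF S(1)] fin[OF S(2)] by simp
    then show "S = S'" using inj_on_image_eq_iff[OF inj, of S S'] S by blast
  qed
  moreover have "f ` ?S \<subseteq> PiE {1..<h} (\<lambda>_. {0..int h * p})"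
  proof (rule image_subsetI)
    fix S assume S: "S \<in> ?S"
    have "0 \<le> (\<Sum>x\<in>S. x ^ j mod p)" for j using p0 by (intro sum_nonneg) simp
    moreover have "(\<Sum>x\<in>S. x ^ j mod p) \<le> int h * p" for j
    proof -
      have "(\<Sum>x\<in>S. x ^ j mod p) \<le> (\<Sum>x\<in>S. p)" using p0 by (intro sum_mono) (simp add: less_imp_le)
      then show ?thesis using S by simp
    qed
    ultimately show "f S \<in> PiE {1..<h} (\<lambda>_. {0..int h * p})"
      unfolding f_def by (intro restrict_PiE_iff[THEN iffD2]) simp
  qed
  ultimately have "card ?S \<le> card (PiE {1..<h} (\<lambda>_. {0..int h * p}))"
    by (rule card_inj_on_le) (intro finite_PiE, auto)
  also have "\<dots> = nat (int h * p + 1) ^ (h - 1)" by (simp add: card_PiE)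
  finally have "card T choose h \<le> nat (int h * p + 1) ^ (h - 1)" using finT by (simp add: n_subsets)
  then have "real (card T choose h) \<le> real (nat (int h * p + 1) ^ (h - 1))" by (rule of_nat_mono)
  also have "\<dots> = (real h * p + 1) ^ (h - 1)" using p0 by simp
  finally show ?thesis .
qed

text \<open>The prime, which is the group size \<open>K\<close>, depends only on h and \<epsilon>;
  more groups merely lengthen the digit string. Hence m can tend to infinity at fixed
  \<open>K\<close>.\<close>

lemma collision_family:
  fixes \<epsilon> :: real
  assumes h: "2 \<le> h" and \<epsilon>: "0 < \<epsilon>"
  obtains K where "1 \<le> K" "\<And>m. \<exists>G :: nat \<Rightarrow> int set.
     (\<forall>i<m. finite (G i) \<and> card (G i) = K \<and> 0 \<notin> G i) \<and> disjoint_family_on G {..<m}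
     \<and> (\<forall>i<m. \<forall>T\<subseteq>G i. Bh_set h T \<longrightarrow> real (card T) \<le> \<epsilon> * real K)
     \<and> (\<forall>u\<in>multisets_of_size (insert 0 (\<Union>i<m. G i)) h. \<forall>v\<in>multisets_of_size (insert 0 (\<Union>i<m. G i)) h.
          sum_mset u = sum_mset v \<longrightarrow> u = v \<or> (\<exists>i<m. set_mset u \<subseteq> G i \<and> set_mset v \<subseteq> G i))"
proof -
  \<comment> \<open>The first term makes h^h (2 h q)^(h-1) < (\<epsilon> q)^h, contradicting a B_h
    subset of more than \<epsilon> q points. The second gives h <= \<epsilon> q, so that such a
    subset has at least h points and (n/h)^h bounds its binomial coefficient from below. The third
    gives h < q.\<close>
  define B where "B = real h ^ h * (2 * real h) ^ (h - 1) / \<epsilon> ^ h + real h / \<epsilon> + real h"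
  obtain q :: nat where q: "prime q" "nat \<lceil>B\<rceil> < q" using bigger_prime by blast
  define p where "p = int q"
  have p: "prime p" using q by (simp add: p_def)
  have qB: "B < real q" using q(2) by linarith
  have B1: "0 \<le> real h ^ h * (2 * real h) ^ (h - 1) / \<epsilon> ^ h" "0 \<le> real h / \<epsilon>" using \<epsilon> by auto
  have hp: "int h < p" using qB B1 by (simp add: B_def p_def)
  have eq: "real h \<le> \<epsilon> * real q"
  proof -
    have "real h / \<epsilon> \<le> real q" using qB B1 by (simp add: B_def)
    then show ?thesis using \<epsilon> by (simp add: field_simps)
  qed
  have big: "real h ^ h * (2 * real h) ^ (h - 1) < real q * \<epsilon> ^ h"
  proof -
    have "real h ^ h * (2 * real h) ^ (h - 1) / \<epsilon> ^ h < real q" using qB B1 h by (simp add: B_def)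
    then show ?thesis using \<epsilon> by (simp add: pos_divide_less_eq)
  qed
  define L where "L = int h * p + 1"
  have L: "int h * p < L" by (simp add: L_def)
  show thesis
  proof (rule that[of q])
    show "1 \<le> q" using prime_gt_0_nat[OF q(1)] by simp
    fix m
    define c where "c = code h p L m"
    define I where "I = {..<m} \<times> {0..<p} \<union> {(m, 0)}"
    define G where "G i = (\<lambda>x. c (i, x)) ` {0..<p}" for i
    have inj: "inj_on c I" unfolding c_def I_def by (rule code_inj[OF p hp h L])
    have c0: "c (m, 0) = 0" unfolding c_def code_def digit_def
    proof (rule sum.neutral, rule ballI)
      fix k assume "k \<in> {..<m * h}"
      then have "k div h < m" by (simp add: less_mult_imp_div_less)
      then show "(if k div h = fst (m, 0::int) then snd (m, 0::int) ^ (k mod h) mod p else 0) * L ^ k = 0" by simp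
    qed
    have supp: "insert 0 (\<Union>i<m. G i) = c ` I"
      using c0 by (auto simp: G_def I_def image_Un)
    have lift: "\<exists>w. set_mset w \<subseteq> I \<and> u = image_mset c w" if "set_mset u \<subseteq> c ` I" for u
      using that by (intro exI[of _ "image_mset (inv_into I c) u"])
        (auto simp: multiset.map_comp o_def inv_into_into f_inv_into_f intro!: multiset.map_ident_strong[symmetric])
    have injG: "inj_on (\<lambda>x. c (i, x)) {0..<p}" if "i < m" for i
      using that inj by (auto simp: inj_on_def I_def)
    have A: "finite (G i) \<and> card (G i) = q \<and> 0 \<notin> G i" if i: "i < m" for i
    proof -
      have "card (G i) = q" unfolding G_def using card_image[OF injG[OF i]] by (simp add: p_def)
      moreover have "0 \<notin> G i"
      proof
        assume "0 \<in> G i"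
        then obtain x where "x \<in> {0..<p}" "c (m, 0) = c (i, x)" by (auto simp: G_def c0)
        then have "(m, 0) = (i, x)" using i by (intro inj_onD[OF inj]) (auto simp: I_def)
        then show False using i by simp
      qed
      ultimately show ?thesis by (simp add: G_def)
    qed
    have D: "disjoint_family_on G {..<m}"
      unfolding disjoint_family_on_def
    proof (intro ballI impI)
      fix i j assume ij: "i \<in> {..<m}" "j \<in> {..<m}" "i \<noteq> j"
      show "G i \<inter> G j = {}"
      proof (rule ccontr)
        assume "G i \<inter> G j \<noteq> {}"
        then obtain z where "z \<in> G i" "z \<in> G j" by blast
        then obtain x y where "x \<in> {0..<p}" "y \<in> {0..<p}" "c (i, x) = c (j, y)"
          unfolding G_def by blast
        then have "(i, x) = (j, y)" using ij by (intro inj_onD[OF inj]) (auto simp: I_def)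
        then show False using ij by simp
      qed
    qed
    have E: "real (card T) \<le> \<epsilon> * real q" if i: "i < m" and T: "T \<subseteq> G i" "Bh_set h T" for i T
    proof (rule ccontr)
      assume "\<not> ?thesis"
      then have lt: "\<epsilon> * real q < real (card T)" by simp
      obtain T' where T': "T' \<subseteq> {0..<p}" "T = (\<lambda>x. c (i, x)) ` T'"
        using T(1) unfolding G_def by (auto simp: subset_image_iff)
      have cT: "card T = card T'" using T' injG[OF i] by (simp add: card_image inj_on_subset)
      have "h \<le> card T" using lt eq by simp
      have q1: "1 \<le> real h * real q"
        using h prime_gt_0_nat[OF q(1)] mult_mono[of 1 "real h" 1 "real q"] by simp
      have "(\<epsilon> * real q) ^ h \<le> real (card T) ^ h" using lt \<epsilon> by (intro power_mono) auto
      also have "\<dots> = real h ^ h * (real (card T) / real h) ^ h" using h by (simp add: power_divide)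
      also have "\<dots> \<le> real h ^ h * real (card T choose h)"
        using binomial_ge_n_over_k_pow_k[OF \<open>h \<le> card T\<close>, where 'a = real] by (intro mult_left_mono) auto
      also have "\<dots> \<le> real h ^ h * (real h * p + 1) ^ (h - 1)"
        using Bh_block_card[OF p hp h L i T'(1)] T T' cT by (intro mult_left_mono) (auto simp: c_def)
      also have "\<dots> \<le> real h ^ h * (2 * real h * real q) ^ (h - 1)"
        using q1 by (intro mult_left_mono power_mono) (auto simp: p_def)
      also have "\<dots> = real h ^ h * (2 * real h) ^ (h - 1) * real q ^ (h - 1)" by (simp add: power_mult_distrib)
      also have "\<dots> < real q * \<epsilon> ^ h * real q ^ (h - 1)"
        using big prime_gt_0_nat[OF q(1)] by (intro mult_strict_right_mono) auto
      also have "\<dots> = (\<epsilon> * real q) ^ h" using h by (cases h) (auto simp: power_mult_distrib)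
      finally show False by simp
    qed
    have F: "u = v \<or> (\<exists>i<m. set_mset u \<subseteq> G i \<and> set_mset v \<subseteq> G i)"
      if uv: "u \<in> multisets_of_size (c ` I) h" "v \<in> multisets_of_size (c ` I) h" "sum_mset u = sum_mset v" for u v
    proof -
      obtain w w' where w: "set_mset w \<subseteq> I" "u = image_mset c w" "set_mset w' \<subseteq> I" "v = image_mset c w'"
        using lift[of u] lift[of v] uv by (auto simp: multisets_of_size_def)
      have sz: "size w = h" "size w' = h" using uv w by (auto simp: multisets_of_size_def)
      have "w = w' \<or> size w = h \<and> (\<exists>i<m. set_mset w \<subseteq> {i} \<times> {0..<p} \<and> set_mset w' \<subseteq> {i} \<times> {0..<p})"
      proof (rule code_collision[OF p hp _ L])
        show "(\<Sum>z\<in>#w. code h p L m z) = (\<Sum>z\<in>#w'. code h p L m z)" using uv(3) w by (simp add: c_def)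
      qed (use h w sz in \<open>auto simp: I_def\<close>)
      then show ?thesis
      proof
        assume "size w = h \<and> (\<exists>i<m. set_mset w \<subseteq> {i} \<times> {0..<p} \<and> set_mset w' \<subseteq> {i} \<times> {0..<p})"
        then obtain i where "i < m" "set_mset w \<subseteq> {i} \<times> {0..<p}" "set_mset w' \<subseteq> {i} \<times> {0..<p}" by blast
        then have "set_mset u \<subseteq> G i \<and> set_mset v \<subseteq> G i" unfolding w(2,4) G_def by force
        then show ?thesis using \<open>i < m\<close> by blast
      qed (use w in auto)
    qed
    show "\<exists>G :: nat \<Rightarrow> int set.
     (\<forall>i<m. finite (G i) \<and> card (G i) = q \<and> 0 \<notin> G i) \<and> disjoint_family_on G {..<m}
     \<and> (\<forall>i<m. \<forall>T\<subseteq>G i. Bh_set h T \<longrightarrow> real (card T) \<le> \<epsilon> * real q)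
     \<and> (\<forall>u\<in>multisets_of_size (insert 0 (\<Union>i<m. G i)) h. \<forall>v\<in>multisets_of_size (insert 0 (\<Union>i<m. G i)) h.
          sum_mset u = sum_mset v \<longrightarrow> u = v \<or> (\<exists>i<m. set_mset u \<subseteq> G i \<and> set_mset v \<subseteq> G i))"
      using A D E F by (intro exI[of _ G] conjI allI impI ballI) (auto simp: supp)
  qed
qed

section \<open>Spread-out laws with few collisions\<close>

text \<open>With P the total mass, \<alpha> = 1 uses x ln(P/x) <= P for each atom, and \<alpha> < 1
  uses x^\<alpha> <= P^\<alpha>. The factor \<open>card A\<close> is harmless because fibers will
  have a size bounded in terms of h and K.\<close>

lemma fiber_gain:
  fixes x :: "'a \<Rightarrow> real"
  assumes "0 < \<alpha>" "finite A" "A \<noteq> {}" "\<And>u. u \<in> A \<Longrightarrow> 0 \<le> x u"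
  shows "superadd_term \<alpha> (\<Sum>u\<in>A. x u) - (\<Sum>u\<in>A. superadd_term \<alpha> (x u)) \<le> card A * (\<Sum>u\<in>A. x u) powr \<alpha>"
proof -
  let ?P = "\<Sum>u\<in>A. x u"
  have P: "0 \<le> ?P" "x u \<le> ?P" if "u \<in> A" for u
    using that assms by (auto intro: sum_nonneg member_le_sum)
  have c1: "1 \<le> real (card A)" using assms(2,3) by (simp add: Suc_le_eq card_gt_0_iff)
  consider "\<alpha> = 1" | "\<alpha> > 1" | "\<alpha> < 1" by linarith
  then show ?thesis
  proof cases
    case 1
    have "x u * (ln ?P - ln (x u)) \<le> ?P" if u: "u \<in> A" for u
    proof (cases "x u = 0")
      case False
      then have pos: "0 < x u" "0 < ?P" using assms(4)[OF u] P(2)[OF u] by auto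
      then have "ln ?P - ln (x u) \<le> ?P / x u"
        using ln_le_minus_one[of "?P / x u"] by (simp add: ln_div)
      then have "x u * (ln ?P - ln (x u)) \<le> x u * (?P / x u)" using pos by (intro mult_left_mono) auto
      then show ?thesis using False by simp
    qed (use P u in auto)
    then have "(\<Sum>u\<in>A. x u * (ln ?P - ln (x u))) \<le> (\<Sum>u\<in>A. ?P)" by (rule sum_mono)
    moreover have "(\<Sum>u\<in>A. x u * (ln ?P - ln (x u))) = ?P * ln ?P - (\<Sum>u\<in>A. x u * ln (x u))"
      by (simp add: right_diff_distrib sum_subtractf sum_distrib_right)
    moreover have "0 \<le> ?P" using assms(4) by (rule sum_nonneg)
    ultimately show ?thesis using 1 by (simp add: superadd_term_def ent_term_def)
  next
    case 2
    have "?P powr \<alpha> - (\<Sum>u\<in>A. x u powr \<alpha>) \<le> 1 * ?P powr \<alpha>" by (simp add: sum_nonneg)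
    also have "\<dots> \<le> card A * ?P powr \<alpha>" using c1 by (intro mult_right_mono) auto
    finally show ?thesis using 2 by (simp add: superadd_term_def ent_term_def)
  next
    case 3
    have "(\<Sum>u\<in>A. x u powr \<alpha>) \<le> (\<Sum>u\<in>A. ?P powr \<alpha>)"
      using P assms by (intro sum_mono powr_mono2) auto
    also have "\<dots> = card A * ?P powr \<alpha>" by simp
    finally have "(\<Sum>u\<in>A. x u powr \<alpha>) - ?P powr \<alpha> \<le> card A * ?P powr \<alpha>"
      using powr_ge_zero[of ?P \<alpha>] by linarith
    then show ?thesis using 3 by (simp add: superadd_term_def ent_term_def sum_negf)
  qed
qed

text \<open>Singleton fibers contribute nothing. A larger fiber lies entirely in \<open>Z\<close>,
  and its bound can be distributed as one q^\<alpha> for each of its elements; summing over fibers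
  counts no element twice.\<close>

lemma gain_le_bad:
  assumes \<alpha>: "0 < \<alpha>" and V: "finite V"
    and q: "\<And>u v. u \<in> V \<Longrightarrow> v \<in> V \<Longrightarrow> u \<noteq> v \<Longrightarrow> g u = g v \<Longrightarrow> fiber_mass g Y V (g u) \<le> q"
    and Z: "finite Z" "\<And>u v. u \<in> V \<Longrightarrow> v \<in> V \<Longrightarrow> u \<noteq> v \<Longrightarrow> g u = g v \<Longrightarrow> u \<in> Z"
  shows "gain \<alpha> g Y V \<le> card Z * q powr \<alpha>"
proof -
  have "gain \<alpha> g Y V = (\<Sum>s\<in>g ` V. superadd_term \<alpha> (fiber_mass g Y V s) - (\<Sum>u\<in>{u\<in>V. g u = s}. superadd_term \<alpha> (pmf Y u)))"
    unfolding gain_def by (subst sum.image_gen[OF V, of _ g]) (simp add: sum_subtractf)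
  also have "\<dots> \<le> (\<Sum>s\<in>g ` V. \<Sum>u\<in>{u\<in>V. g u = s}. if u \<in> Z then q powr \<alpha> else 0)"
  proof (rule sum_mono)
    fix s assume s: "s \<in> g ` V"
    let ?A = "{u\<in>V. g u = s}"
    have A: "finite ?A" "?A \<noteq> {}" using V s by auto
    show "superadd_term \<alpha> (fiber_mass g Y V s) - (\<Sum>u\<in>?A. superadd_term \<alpha> (pmf Y u)) \<le> (\<Sum>u\<in>?A. if u \<in> Z then q powr \<alpha> else 0)"
    proof (cases "\<exists>u. ?A = {u}")
      case True
      then obtain u where "?A = {u}" by blast
      then show ?thesis by (simp add: fiber_mass_def)
    next
      case False
      have other: "\<exists>v\<in>?A. v \<noteq> u" if "u \<in> ?A" for u using False that by blast
      have inZ: "u \<in> Z" if "u \<in> ?A" for u using other[OF that] that Z(2) by fastforce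
      obtain u where u: "u \<in> ?A" using A by blast
      have "fiber_mass g Y V s \<le> q" using other[OF u] u q by fastforce
      then have "fiber_mass g Y V s powr \<alpha> \<le> q powr \<alpha>" using fiber_mass_nonneg[of g Y V s] \<alpha> by (intro powr_mono2) auto
      then have "card ?A * fiber_mass g Y V s powr \<alpha> \<le> card ?A * q powr \<alpha>" by (intro mult_left_mono) auto
      then have "superadd_term \<alpha> (fiber_mass g Y V s) - (\<Sum>u\<in>?A. superadd_term \<alpha> (pmf Y u)) \<le> card ?A * q powr \<alpha>"
        using fiber_gain[OF \<alpha> A, of "pmf Y"] unfolding fiber_mass_def by simp
      also have "\<dots> = (\<Sum>u\<in>?A. q powr \<alpha>)" by simp
      also have "\<dots> = (\<Sum>u\<in>?A. if u \<in> Z then q powr \<alpha> else 0)"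
        by (rule sum.cong) (use inZ in auto)
      finally show ?thesis .
    qed
  qed
  also have "\<dots> = (\<Sum>u\<in>V. if u \<in> Z then q powr \<alpha> else 0)"
    by (rule sum.image_gen[OF V, symmetric])
  also have "\<dots> = card (V \<inter> Z) * q powr \<alpha>" using V by (simp add: sum.If_cases)
  also have "\<dots> \<le> card Z * q powr \<alpha>" using Z(1) by (intro mult_right_mono) (auto intro: card_mono)
  finally show ?thesis .
qed

lemma card_multisets_le:
  assumes "finite A" shows "card (multisets_of_size A h) \<le> card A ^ h"
proof -
  let ?L = "{xs. set xs \<subseteq> A \<and> length xs = h}"
  have "multisets_of_size A h \<subseteq> mset ` ?L"
  proof
    fix u assume u: "u \<in> multisets_of_size A h"
    obtain xs where "mset xs = u" using ex_mset by blast
    then show "u \<in> mset ` ?L" using u by (intro image_eqI[of _ _ xs]) (auto simp: multisets_of_size_def)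
  qed
  then have "card (multisets_of_size A h) \<le> card ?L"
    using finite_lists_length_eq[OF assms] by (meson surj_card_le)
  then show ?thesis using card_lists_length_eq[OF assms] by simp
qed

lemma prob_multisets:
  fixes t :: real
  assumes "finite A" "\<And>a. a \<in> A \<Longrightarrow> pmf X a = t"
  shows "measure_pmf.prob (U_law h X) (multisets_of_size A h) = (card A * t) ^ h"
proof -
  let ?L = "{xs. set xs \<subseteq> A \<and> length xs = h}"
  have "measure_pmf.prob (U_law h X) (multisets_of_size A h) = measure_pmf.prob (replicate_pmf h X) ?L"
    unfolding U_law_def measure_map_pmf
    by (intro arg_cong[where f = "measure_pmf.prob (replicate_pmf h X)"])
       (auto simp: multisets_of_size_def)
  also have "\<dots> = (\<Sum>xs\<in>?L. pmf (replicate_pmf h X) xs)"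
    by (rule measure_measure_pmf_finite) (rule finite_lists_length_eq[OF assms(1)])
  also have "\<dots> = (\<Sum>xs\<in>?L. t ^ h)"
  proof (rule sum.cong)
    fix xs assume xs: "xs \<in> ?L"
    have "prod_list (map (pmf X) ys) = t ^ length ys" if "set ys \<subseteq> A" for ys
      using that assms(2) by (induction ys) auto
    then show "pmf (replicate_pmf h X) xs = t ^ h" using xs by (simp add: pmf_replicate_pmf)
  qed simp
  finally show ?thesis by (simp add: card_lists_length_eq[OF assms(1)] power_mult_distrib)
qed

lemma spread_pmf:
  fixes S :: "int set"
  assumes "finite S" "S \<noteq> {}" "0 \<notin> S" "0 < t" "real (card S) * t < 1"
  obtains X where "\<And>a. pmf X a = (if a \<in> S then t else if a = 0 then 1 - real (card S) * t else 0)"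
    "set_pmf X = insert 0 S"
proof -
  define d where "d = real (card S) * t"
  have d: "0 \<le> d" "d \<le> 1" using assms by (auto simp: d_def)
  define X where "X = bind_pmf (bernoulli_pmf d) (\<lambda>b. if b then pmf_of_set S else return_pmf 0)"
  have c: "card S \<noteq> 0" using assms by simp
  have pmf: "pmf X a = (if a \<in> S then t else if a = 0 then 1 - real (card S) * t else 0)" for a
    using d assms c unfolding X_def by (auto simp: pmf_bind d_def)
  moreover have "set_pmf X = insert 0 S" using assms by (auto simp: set_pmf_iff pmf split: if_splits)
  ultimately show thesis using that by blast
qed

text \<open>Each point of the groups gets mass t and 0 gets the rest. A B_h set can keep 0 but only
  a fraction \<epsilon> of each group, which gives the defect. A colliding fiber lies among the
  multisets over one group, of total probability (K t)^h, and at most m K^h multisets are involved,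
  which gives the deficit.\<close>

lemma spread_construction:
  fixes \<epsilon> :: real
  assumes h: "2 \<le> h" and \<epsilon>: "0 < \<epsilon>"
  obtains K :: nat where "1 \<le> K" "\<And>(m::nat) (t::real). 1 \<le> m \<Longrightarrow> 0 < t \<Longrightarrow> real m * real K * t < 1 \<Longrightarrow>
    \<exists>X. (1 - \<epsilon>) * (real m * real K * t) \<le> Bh_defect h X
      \<and> (\<forall>\<beta>. ent_sum \<beta> X = ennreal (ent_term \<beta> (1 - real m * real K * t) + real m * real K * ent_term \<beta> t))
      \<and> (\<forall>\<alpha>>0. deficit_defined \<alpha> h X \<and> deficit \<alpha> h X
          \<le> ereal (gain_deficit_const \<alpha> ((1 - real m * real K * t) ^ h) * (real m * real K ^ h * ((real K * t) ^ h) powr \<alpha>)))"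
proof -
  show thesis
  proof (rule collision_family[OF h \<epsilon>])
    fix K :: nat
    assume K: "1 \<le> K" "\<And>m. \<exists>G :: nat \<Rightarrow> int set.
     (\<forall>i<m. finite (G i) \<and> card (G i) = K \<and> 0 \<notin> G i) \<and> disjoint_family_on G {..<m}
     \<and> (\<forall>i<m. \<forall>T\<subseteq>G i. Bh_set h T \<longrightarrow> real (card T) \<le> \<epsilon> * real K)
     \<and> (\<forall>u\<in>multisets_of_size (insert 0 (\<Union>i<m. G i)) h. \<forall>v\<in>multisets_of_size (insert 0 (\<Union>i<m. G i)) h.
          sum_mset u = sum_mset v \<longrightarrow> u = v \<or> (\<exists>i<m. set_mset u \<subseteq> G i \<and> set_mset v \<subseteq> G i))"
  show thesis
  proof (rule that[OF K(1)])
    fix m :: nat and t :: real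
    assume m: "1 \<le> m" and t: "0 < t" and mKt: "real m * real K * t < 1"
    obtain G :: "nat \<Rightarrow> int set" where G0:
      "(\<forall>i<m. finite (G i) \<and> card (G i) = K \<and> 0 \<notin> G i) \<and> disjoint_family_on G {..<m}
       \<and> (\<forall>i<m. \<forall>T\<subseteq>G i. Bh_set h T \<longrightarrow> real (card T) \<le> \<epsilon> * real K)
       \<and> (\<forall>u\<in>multisets_of_size (insert 0 (\<Union>i<m. G i)) h. \<forall>v\<in>multisets_of_size (insert 0 (\<Union>i<m. G i)) h.
            sum_mset u = sum_mset v \<longrightarrow> u = v \<or> (\<exists>i<m. set_mset u \<subseteq> G i \<and> set_mset v \<subseteq> G i))"
      using K(2)[of m] ..
    have G: "finite (G i) \<and> card (G i) = K \<and> 0 \<notin> G i" if "i < m" for i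
      using conjunct1[OF G0] that by simp
    have disj: "disjoint_family_on G {..<m}"
      by (rule conjunct1[OF conjunct2[OF G0]])
    have small: "real (card T) \<le> \<epsilon> * real K" if "i < m" "T \<subseteq> G i" "Bh_set h T" for i T
      using conjunct1[OF conjunct2[OF conjunct2[OF G0]]] that by simp
    have coll: "u = v \<or> (\<exists>i<m. set_mset u \<subseteq> G i \<and> set_mset v \<subseteq> G i)"
      if "u \<in> multisets_of_size (insert 0 (\<Union>i<m. G i)) h"
         "v \<in> multisets_of_size (insert 0 (\<Union>i<m. G i)) h" "sum_mset u = sum_mset v" for u v
      using conjunct2[OF conjunct2[OF conjunct2[OF G0]]] that by blast
    define S where "S = (\<Union>i<m. G i)"
    have S: "finite S" "0 \<notin> S" using G by (auto simp: S_def)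
    have cS: "card S = m * K" unfolding S_def using G disj
      by (subst card_UN_disjoint) (auto simp: disjoint_family_on_def)
    have "S \<noteq> {}" using cS m K(1) by auto
    define d where "d = real m * real K * t"
    have d: "0 < d" "d < 1" using m K(1) t mKt by (auto simp: d_def)
    obtain X where X: "\<And>a. pmf X a = (if a \<in> S then t else if a = 0 then 1 - real (card S) * t else 0)"
      "set_pmf X = insert 0 S"
      using spread_pmf[OF S(1) \<open>S \<noteq> {}\<close> S(2) t] mKt unfolding cS by auto
    have XS: "pmf X a = t" if "a \<in> S" for a using X(1)[of a] that by simp
    have X0: "pmf X 0 = 1 - d" using X(1)[of 0] S(2) by (simp add: cS d_def)
    have defect: "(1 - \<epsilon>) * d \<le> Bh_defect h X"
    proof -
      have "1 - (1 - d + \<epsilon> * d) \<le> Bh_defect h X"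
      proof (rule Bh_defect_ge)
        fix B assume B: "B \<subseteq> set_pmf X" "Bh_set h B"
        have "measure_pmf.prob X B \<le> measure_pmf.prob X (insert 0 (\<Union>i<m. B \<inter> G i))"
          using B(1) X(2) by (intro measure_pmf.finite_measure_mono) (auto simp: S_def)
        also have "\<dots> \<le> pmf X 0 + measure_pmf.prob X (\<Union>i<m. B \<inter> G i)"
          using measure_Un_le[of "{0}" "measure_pmf X" "\<Union>i<m. B \<inter> G i"]
          by (simp add: measure_pmf_single)
        also have "measure_pmf.prob X (\<Union>i<m. B \<inter> G i) \<le> (\<Sum>i<m. measure_pmf.prob X (B \<inter> G i))"
          by (rule measure_pmf.finite_measure_subadditive_finite) auto
        also have "\<dots> \<le> (\<Sum>i<m. \<epsilon> * K * t)"
        proof (rule sum_mono)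
          fix i assume i: "i \<in> {..<m}"
          have "measure_pmf.prob X (B \<inter> G i) = (\<Sum>a\<in>B \<inter> G i. pmf X a)"
            using G i by (intro measure_measure_pmf_finite) auto
          also have "\<dots> = (\<Sum>a\<in>B \<inter> G i. t)" using i by (intro sum.cong XS) (auto simp: S_def)
          also have "\<dots> \<le> \<epsilon> * K * t"
            using small[of i "B \<inter> G i"] i t Bh_set_mono[OF B(2), of "B \<inter> G i"] by simp
          finally show "measure_pmf.prob X (B \<inter> G i) \<le> \<epsilon> * K * t" .
        qed
        finally show "measure_pmf.prob X B \<le> 1 - d + \<epsilon> * d" by (simp add: X0 d_def mult_ac)
      qed (use h in simp)
      then show ?thesis by (simp add: algebra_simps)
    qed
    have ent: "ent_sum \<beta> X = ennreal (ent_term \<beta> (1 - d) + real m * real K * ent_term \<beta> t)" for \<beta>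
    proof -
      have "(\<Sum>a\<in>insert 0 S. ent_term \<beta> (pmf X a)) = ent_term \<beta> (1 - d) + (\<Sum>a\<in>S. ent_term \<beta> t)"
        using S by (simp add: X0 XS)
      then show ?thesis
        using ent_sum_finite_support[of "insert 0 S" X \<beta>] S X(2) by (simp add: cS)
    qed
    have def: "deficit_defined \<alpha> h X \<and> deficit \<alpha> h X
          \<le> ereal (gain_deficit_const \<alpha> ((1 - d) ^ h) * (real m * real K ^ h * ((real K * t) ^ h) powr \<alpha>))" if \<alpha>: "0 < \<alpha>" for \<alpha>
    proof -
      let ?U = "U_law h X"
      define V where "V = set_pmf ?U"
      have finX: "finite (set_pmf X)" using X(2) S(1) by simp
      have V: "finite V" unfolding V_def by (rule finite_set_U[OF finX])
      have Vms: "u \<in> multisets_of_size (insert 0 (\<Union>i<m. G i)) h" if "u \<in> V" for u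
        using that X(2) by (auto simp: V_def U_law_def set_replicate_pmf multisets_of_size_def S_def)
      define Z where "Z = (\<Union>i<m. multisets_of_size (G i) h)"
      have group: "\<exists>i<m. u \<in> multisets_of_size (G i) h \<and> v \<in> multisets_of_size (G i) h"
        if "u \<in> V" "v \<in> V" "u \<noteq> v" "sum_mset u = sum_mset v" for u v
        using coll[OF Vms[OF that(1)] Vms[OF that(2)] that(4)] that Vms by (auto simp: multisets_of_size_def)
      have gain: "gain \<alpha> sum_mset ?U V \<le> card Z * ((real K * t) ^ h) powr \<alpha>"
      proof (rule gain_le_bad[OF \<alpha> V])
        fix u v assume uv: "u \<in> V" "v \<in> V" "u \<noteq> v" "sum_mset u = sum_mset v"
        show "u \<in> Z" using group[OF uv] by (auto simp: Z_def)
        obtain i where i: "i < m" "u \<in> multisets_of_size (G i) h" using group[OF uv] by blast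
        \<comment> \<open>A nonempty multiset lies over at most one of the disjoint groups, so all
          partners of \<open>u\<close> share its group.\<close>
        have "w \<in> multisets_of_size (G i) h" if w: "w \<in> V" "sum_mset w = sum_mset u" for w
        proof (cases "w = u")
          case False
          obtain j where j: "j < m" "u \<in> multisets_of_size (G j) h" "w \<in> multisets_of_size (G j) h"
            using group[OF w(1) uv(1) False w(2)] by blast
          have "u \<noteq> {#}" using i(2) h by (auto simp: multisets_of_size_def)
          then obtain x where "x \<in># u" by blast
          then have "x \<in> G i" "x \<in> G j" using i j by (auto simp: multisets_of_size_def)
          then have "i = j" using disj i(1) j(1) unfolding disjoint_family_on_def by blast
          then show ?thesis using j by simp
        qed (use i in simp)
        then have "fiber_mass sum_mset ?U V (sum_mset u) \<le> measure_pmf.prob ?U (multisets_of_size (G i) h)"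
          unfolding fiber_mass_measure[OF V] by (intro measure_pmf.finite_measure_mono) auto
        also have "\<dots> = (real K * t) ^ h"
          using G i(1) XS by (subst prob_multisets[where t = t]) (auto simp: S_def)
        finally show "fiber_mass sum_mset ?U V (sum_mset u) \<le> (real K * t) ^ h" .
      qed (use G in \<open>auto simp: Z_def\<close>)
      have "card Z \<le> (\<Sum>i<m. card (multisets_of_size (G i) h))"
        unfolding Z_def by (rule card_UN_le) simp
      also have "\<dots> \<le> (\<Sum>i<m. K ^ h)"
      proof (rule sum_mono)
        fix i assume "i \<in> {..<m}"
        then show "card (multisets_of_size (G i) h) \<le> K ^ h"
          using G[of i] card_multisets_le[of "G i" h] by simp
      qed
      finally have "card Z \<le> m * K ^ h" by simp
      then have "real (card Z) \<le> real (m * K ^ h)" by (rule of_nat_mono)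
      then have "card Z * ((real K * t) ^ h) powr \<alpha> \<le> real m * real K ^ h * ((real K * t) ^ h) powr \<alpha>"
        by (intro mult_right_mono) auto
      then have gain': "gain \<alpha> sum_mset ?U V \<le> real m * real K ^ h * ((real K * t) ^ h) powr \<alpha>" using gain by linarith
      \<comment> \<open>The multiset of h zeros is the heavy atom required by
        \<open>deficit_le_gain\<close>.\<close>
      have q: "(1 - d) ^ h \<le> pmf ?U (replicate_mset h 0)"
        using d by (intro pmf_U_ge[where F = "{0}"]) (auto simp: multisets_of_size_def X0 split: if_splits)
      have "0 \<le> gain_deficit_const \<alpha> ((1 - d) ^ h)" by (simp add: gain_deficit_const_def)
      then have "gain_deficit_const \<alpha> ((1 - d) ^ h) * gain \<alpha> sum_mset ?U V
          \<le> gain_deficit_const \<alpha> ((1 - d) ^ h) * (real m * real K ^ h * ((real K * t) ^ h) powr \<alpha>)"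
        using gain' by (rule mult_left_mono[rotated])
      then have "ereal (gain_deficit_const \<alpha> ((1 - d) ^ h) * gain \<alpha> sum_mset ?U V)
          \<le> ereal (gain_deficit_const \<alpha> ((1 - d) ^ h) * (real m * real K ^ h * ((real K * t) ^ h) powr \<alpha>))"
        by (simp only: ereal_less_eq)
      moreover have "0 < (1 - d) ^ h" using d by simp
      ultimately show ?thesis using deficit_le_gain[OF \<alpha> finX _ q] unfolding V_def
        by (meson order_trans)
    qed
    show "\<exists>X. (1 - \<epsilon>) * (real m * real K * t) \<le> Bh_defect h X
      \<and> (\<forall>\<beta>. ent_sum \<beta> X = ennreal (ent_term \<beta> (1 - real m * real K * t) + real m * real K * ent_term \<beta> t))
      \<and> (\<forall>\<alpha>>0. deficit_defined \<alpha> h X \<and> deficit \<alpha> h X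
          \<le> ereal (gain_deficit_const \<alpha> ((1 - real m * real K * t) ^ h) * (real m * real K ^ h * ((real K * t) ^ h) powr \<alpha>)))"
    proof (intro exI[of _ X] conjI allI impI)
      show "(1 - \<epsilon>) * (real m * real K * t) \<le> Bh_defect h X" using defect by (simp only: d_def)
      show "ent_sum \<beta> X = ennreal (ent_term \<beta> (1 - real m * real K * t) + real m * real K * ent_term \<beta> t)" for \<beta>
        using ent by (simp only: d_def)
      fix \<alpha> :: real assume "0 < \<alpha>"
      note def[OF this, unfolded d_def]
      then show "deficit_defined \<alpha> h X" "deficit \<alpha> h X
          \<le> ereal (gain_deficit_const \<alpha> ((1 - real m * real K * t) ^ h) * (real m * real K ^ h * ((real K * t) ^ h) powr \<alpha>))"
        by auto
    qed
  qed
qed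
qed

section \<open>The Shannon entropy constraint\<close>

lemma Phi_ge:
  assumes "0 < h" "admissible \<alpha> \<beta> D h C X"
  shows "Bh_defect h X \<le> Phi \<alpha> \<beta> D h C"
  unfolding Phi_def
proof (rule cSup_upper)
  show "bdd_above {Bh_defect h X | X. deficit_defined \<alpha> h X \<and> deficit \<alpha> h X \<le> ereal C \<and>
                             renyi_entropy \<beta> X \<le> ereal D}"
    using Bh_defect_le_1[OF assms(1)] by (intro bdd_aboveI[of _ 1]) auto
qed (use assms in \<open>auto simp: admissible_def\<close>)

text \<open>A bound on a supremum of reals needs a nonempty set, so the lower-bound constructions
  below also record that an admissible law exists.\<close>

lemma Phi_le:
  assumes "\<exists>X. admissible \<alpha> \<beta> D h C X" "\<And>X. admissible \<alpha> \<beta> D h C X \<Longrightarrow> Bh_defect h X \<le> M"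
  shows "Phi \<alpha> \<beta> D h C \<le> M"
  unfolding Phi_def
  by (rule cSup_least) (use assms in \<open>auto simp: admissible_def\<close>)

text \<open>The mass at 0 stays above p, which makes the factor \<open>gain_deficit_const\<close>
  uniform; it is absorbed into c together with all powers of K. The entropy condition remains a
  premise because m and t are tuned differently for each range of \<beta>.\<close>

lemma spread_admissible:
  fixes \<epsilon> \<alpha> p :: real
  assumes h: "2 \<le> h" and \<epsilon>: "0 < \<epsilon>" and \<alpha>: "0 < \<alpha>" and p: "0 < p"
  obtains K :: nat and c :: real where "1 \<le> K" "0 < c"
    "\<And>(m::nat) (t::real) \<beta> D C. 1 \<le> m \<Longrightarrow> 0 < t \<Longrightarrow> real m * real K * t \<le> 1 - p \<Longrightarrow>
      (\<And>X::int pmf. ent_sum \<beta> X = ennreal (ent_term \<beta> (1 - real m * real K * t) + real m * real K * ent_term \<beta> t) \<Longrightarrow> renyi_entropy \<beta> X \<le> ereal D) \<Longrightarrow>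
      c * (m * t powr (h * \<alpha>)) \<le> C \<Longrightarrow>
      \<exists>X. admissible \<alpha> \<beta> D h C X \<and> (1 - \<epsilon>) * (real m * real K * t) \<le> Bh_defect h X"
proof (rule spread_construction[OF h \<epsilon>])
  fix K :: nat
  assume K: "1 \<le> K" and constr: "\<And>(m::nat) (t::real). 1 \<le> m \<Longrightarrow> 0 < t \<Longrightarrow> real m * real K * t < 1 \<Longrightarrow>
    \<exists>X. (1 - \<epsilon>) * (real m * real K * t) \<le> Bh_defect h X
      \<and> (\<forall>\<beta>. ent_sum \<beta> X = ennreal (ent_term \<beta> (1 - real m * real K * t) + real m * real K * ent_term \<beta> t))
      \<and> (\<forall>\<alpha>>0. deficit_defined \<alpha> h X \<and> deficit \<alpha> h X
          \<le> ereal (gain_deficit_const \<alpha> ((1 - real m * real K * t) ^ h) * (real m * real K ^ h * ((real K * t) ^ h) powr \<alpha>)))"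
  define c where "c = gain_deficit_const \<alpha> (p ^ h) * (K ^ h * K powr (h * \<alpha>))"
  have dpos: "0 < gain_deficit_const \<alpha> (p ^ h)" using p by (simp add: gain_deficit_const_def)
  have c: "0 < c" using dpos K by (simp add: c_def)
  show thesis
  proof (rule that[OF K c])
    fix m :: nat and t \<beta> D C :: real
    assume m: "1 \<le> m" and t: "0 < t" and mKt: "real m * real K * t \<le> 1 - p"
      and ent: "\<And>X::int pmf. ent_sum \<beta> X = ennreal (ent_term \<beta> (1 - real m * real K * t) + real m * real K * ent_term \<beta> t) \<Longrightarrow> renyi_entropy \<beta> X \<le> ereal D"
      and C: "c * (m * t powr (h * \<alpha>)) \<le> C"
    obtain X where X: "(1 - \<epsilon>) * (real m * real K * t) \<le> Bh_defect h X"
      "ent_sum \<beta> X = ennreal (ent_term \<beta> (1 - real m * real K * t) + real m * real K * ent_term \<beta> t)"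
      "deficit_defined \<alpha> h X" "deficit \<alpha> h X
          \<le> ereal (gain_deficit_const \<alpha> ((1 - real m * real K * t) ^ h) * (real m * real K ^ h * ((real K * t) ^ h) powr \<alpha>))"
      using constr[OF m t] mKt p \<alpha> by fastforce
    have kt: "((real K * t) ^ h) powr \<alpha> = K powr (h * \<alpha>) * t powr (h * \<alpha>)"
    proof -
      have "((real K * t) ^ h) powr \<alpha> = (real K * t) powr (h * \<alpha>)"
        using t K powr_powr[of "K * t" "real h" \<alpha>] by (simp add: powr_realpow)
      then show ?thesis using t by (simp add: powr_mult)
    qed
    have "p ^ h \<le> (1 - real m * real K * t) ^ h" using mKt p by (intro power_mono) auto
    then have "(p ^ h) powr \<alpha> \<le> ((1 - real m * real K * t) ^ h) powr \<alpha>" using p \<alpha> by (intro powr_mono2) auto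
    then have "gain_deficit_const \<alpha> ((1 - real m * real K * t) ^ h) \<le> gain_deficit_const \<alpha> (p ^ h)"
      using p mKt by (auto simp: gain_deficit_const_def intro!: divide_left_mono mult_left_mono mult_pos_pos)
    then have "gain_deficit_const \<alpha> ((1 - real m * real K * t) ^ h) * (real m * real K ^ h * ((real K * t) ^ h) powr \<alpha>)
      \<le> gain_deficit_const \<alpha> (p ^ h) * (real m * real K ^ h * ((real K * t) ^ h) powr \<alpha>)" by (intro mult_right_mono) auto
    also have "\<dots> = c * (m * t powr (h * \<alpha>))"
      unfolding kt c_def by (simp add: mult_ac)
    finally have "ereal (gain_deficit_const \<alpha> ((1 - real m * real K * t) ^ h) * (real m * real K ^ h * ((real K * t) ^ h) powr \<alpha>)) \<le> ereal C"
      using C by simp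
    then have "admissible \<alpha> \<beta> D h C X"
      unfolding admissible_def using X(3) order_trans[OF X(4)] ent[OF X(2)] by blast
    then show "\<exists>X. admissible \<alpha> \<beta> D h C X \<and> (1 - \<epsilon>) * (real m * real K * t) \<le> Bh_defect h X"
      using X(1) by blast
  qed
qed

lemma floor_bounds:
  assumes "1 \<le> (x::real)" shows "1 \<le> nat \<lfloor>x\<rfloor>" "real (nat \<lfloor>x\<rfloor>) \<le> x" "x - 1 \<le> real (nat \<lfloor>x\<rfloor>)" "x / 2 \<le> real (nat \<lfloor>x\<rfloor>)"
proof -
  have "1 \<le> \<lfloor>x\<rfloor>" using assms by simp
  then show "1 \<le> nat \<lfloor>x\<rfloor>" "real (nat \<lfloor>x\<rfloor>) \<le> x" "x - 1 \<le> real (nat \<lfloor>x\<rfloor>)" "x / 2 \<le> real (nat \<lfloor>x\<rfloor>)"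
    by (linarith | simp)+
qed

text \<open>The constructions are parametrised by t with C = c t^s; this is the substitution back to
  C.\<close>

lemma rescale_at_right_0:
  assumes "eventually P (at_right (0::real))" "0 < c" "0 < s"
  shows "eventually (\<lambda>C. P ((C / c) powr (1 / s))) (at_right 0)"
proof -
  have "filterlim (\<lambda>C. (C / c) powr (1 / s)) (at_right 0) (at_right 0)"
    using assms(2,3) by real_asymp
  then show ?thesis using assms(1) by (simp add: filterlim_iff)
qed

lemma rescale_powr: "0 < C \<Longrightarrow> 0 < c \<Longrightarrow> 0 < s \<Longrightarrow> c * ((C / c) powr (1 / s)) powr s = (C::real)"
  by (simp add: powr_powr)

text \<open>Since m t <= 1, the deficit m t^(h \<alpha>) is at most t^(h \<alpha> - 1) up to c,
  which ties C to t and makes ln(1/C) about (h \<alpha> - 1) ln(1/t).\<close>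

lemma spread_shannon:
  assumes h: "2 \<le> h" and \<alpha>: "1 \<le> \<alpha>" and D: "0 < D" and \<epsilon>: "0 < \<epsilon>" "\<epsilon> < 1"
  obtains K :: nat and c :: real where "0 < c"
    "\<forall>\<^sub>F C in at_right 0. \<exists>X. admissible \<alpha> 1 D h C X \<and>
      (1 - \<epsilon>) * (D / (1 + ln (1 / (C / c) powr (1 / (h * \<alpha> - 1)))) - real K * (C / c) powr (1 / (h * \<alpha> - 1))) \<le> Bh_defect h X"
proof -
  have \<alpha>0: "0 < \<alpha>" using \<alpha> by simp
  have h\<alpha>: "0 < h * \<alpha> - 1" using h \<alpha> mult_mono[of 2 "real h" 1 \<alpha>] by simp
  obtain K :: nat and c :: real where K: "1 \<le> K" and c: "0 < c" and
    adm: "\<And>(m::nat) (t::real) \<beta> D C. 1 \<le> m \<Longrightarrow> 0 < t \<Longrightarrow> real m * real K * t \<le> 1 - 1/2 \<Longrightarrow>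
      (\<And>X::int pmf. ent_sum \<beta> X = ennreal (ent_term \<beta> (1 - real m * real K * t) + real m * real K * ent_term \<beta> t) \<Longrightarrow> renyi_entropy \<beta> X \<le> ereal D) \<Longrightarrow>
      c * (m * t powr (h * \<alpha>)) \<le> C \<Longrightarrow>
      \<exists>X. admissible \<alpha> \<beta> D h C X \<and> (1 - \<epsilon>) * (real m * real K * t) \<le> Bh_defect h X"
    using spread_admissible[OF h \<epsilon>(1) \<alpha>0, of "1/2"] by (metis half_gt_zero zero_less_one)
  have ev: "\<forall>\<^sub>F t in at_right 0. 0 < t \<and> t < (1::real) \<and> D / (1 + ln (1 / t)) \<le> 1 / 2 \<and> 1 \<le> D / (1 + ln (1 / t)) / (t * K)"
    using D K by (intro eventually_conj; real_asymp)
  have ev2: "\<forall>\<^sub>F t::real in at_right 0. \<exists>X. admissible \<alpha> 1 D h (c * t powr (h * \<alpha> - 1)) X \<and>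
      (1 - \<epsilon>) * (D / (1 + ln (1 / t)) - real K * t) \<le> Bh_defect h X"
    using ev
  proof eventually_elim
    case (elim t)
    then have t: "0 < t" "t < 1" by auto
    \<comment> \<open>Chosen so that d = m K t is just below D / (1 + ln(1/t)). The light atoms have
      entropy d ln(1/t) and the atom at 0 adds at most d, together at most D. Rounding loses at most
      K t, negligible against 1 / ln(1/t).\<close>
    define x where "x = D / (1 + ln (1 / t)) / (t * K)"
    define m where "m = nat \<lfloor>x\<rfloor>"
    have x: "1 \<le> x" using elim by (simp add: x_def)
    note m = floor_bounds[OF x, folded m_def]
    have tK: "0 < t * K" using t K by simp
    have xtK: "x * (t * K) = D / (1 + ln (1 / t))" using t K by (simp add: x_def)
    define d where "d = real m * real K * t"
    have "m * (t * K) \<le> x * (t * K)" using m tK by (intro mult_right_mono) auto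
    moreover have dm: "m * (t * K) = d" by (simp add: d_def mult_ac)
    ultimately have d: "d \<le> D / (1 + ln (1 / t))" by (simp only: xtK)
    then have d2: "d \<le> 1 / 2" using elim by linarith
    have d0: "0 < d" using m K t by (simp add: d_def)
    have lt: "0 < ln (1 / t)" using t by simp
    have "\<exists>X. admissible \<alpha> 1 D h (c * t powr (h * \<alpha> - 1)) X \<and> (1 - \<epsilon>) * (real m * real K * t) \<le> Bh_defect h X"
    proof (rule adm)
      show "real m * real K * t \<le> 1 - 1 / 2" using d2 by (simp add: d_def)
      have "ln (1 / (1 - d)) \<le> 1 / (1 - d) - 1" using d2 by (intro ln_le_minus_one) simp
      then have "(1 - d) * ln (1 / (1 - d)) \<le> (1 - d) * (1 / (1 - d) - 1)" using d2 by (intro mult_left_mono) auto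
      also have "\<dots> = d" using d2 by (simp add: field_simps)
      finally have "ent_term 1 (1 - d) \<le> d" using d2 by (simp add: ent_term_def ln_div)
      moreover have "real m * real K * ent_term 1 t = d * ln (1 / t)" using t by (simp add: ent_term_def d_def ln_div)
      moreover have "d + d * ln (1 / t) \<le> D" using d lt by (simp add: field_simps)
      ultimately have "ent_term 1 (1 - d) + real m * real K * ent_term 1 t \<le> D" by simp
      then show "renyi_entropy 1 X \<le> ereal D"
        if "ent_sum 1 X = ennreal (ent_term 1 (1 - real m * real K * t) + real m * real K * ent_term 1 t)" for X :: "int pmf"
        using D that by (simp add: renyi_1_le_iff d_def ennreal_leI)
      have "real m * t * 1 \<le> real m * t * real K" using K t by (intro mult_left_mono) auto
      then have "m * t \<le> 1" using d2 by (simp add: d_def mult_ac)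
      have "m * t powr (h * \<alpha>) = (m * t) * t powr (h * \<alpha> - 1)" using t by (simp add: powr_diff)
      also have "\<dots> \<le> 1 * t powr (h * \<alpha> - 1)" using \<open>m * t \<le> 1\<close> by (intro mult_right_mono) auto
      finally show "c * (m * t powr (h * \<alpha>)) \<le> c * t powr (h * \<alpha> - 1)" using c by simp
    qed (use m t in auto)
    then obtain X where X: "admissible \<alpha> 1 D h (c * t powr (h * \<alpha> - 1)) X" "(1 - \<epsilon>) * (real m * real K * t) \<le> Bh_defect h X"
      by blast
    have "(x - 1) * (t * K) \<le> m * (t * K)" using m tK by (intro mult_right_mono) auto
    then have "D / (1 + ln (1 / t)) - 1 * (t * K) \<le> d" by (simp only: left_diff_distrib dm xtK)
    then have "D / (1 + ln (1 / t)) - real K * t \<le> real m * real K * t"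
      by (simp add: d_def mult.commute)
    then have "(1 - \<epsilon>) * (D / (1 + ln (1 / t)) - real K * t) \<le> (1 - \<epsilon>) * (real m * real K * t)" using \<epsilon> by (intro mult_left_mono) auto
    then show ?case using X by (intro exI[of _ X]) auto
  qed
  show thesis
  proof (rule that[OF c, of K])
    show "\<forall>\<^sub>F C in at_right 0. \<exists>X. admissible \<alpha> 1 D h C X \<and>
      (1 - \<epsilon>) * (D / (1 + ln (1 / (C / c) powr (1 / (h * \<alpha> - 1)))) - real K * (C / c) powr (1 / (h * \<alpha> - 1))) \<le> Bh_defect h X"
      using rescale_at_right_0[OF ev2 c h\<alpha>] eventually_at_right_less[of 0]
    proof eventually_elim
      case (elim C)
      then show ?case using rescale_powr[OF elim(2) c h\<alpha>] by simp
    qed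
  qed
qed

lemma Phi_limit_shannon:
  assumes h: "2 \<le> h" and \<alpha>: "1 \<le> \<alpha>" and D: "0 < D"
  shows "((\<lambda>C. Phi \<alpha> 1 D h C * ln (1 / C)) \<longlongrightarrow> (real h * \<alpha> - 1) * D) (at_right 0)"
proof -
  define r where "r = real h * \<alpha> - 1"
  have r: "0 < r" using h \<alpha> mult_mono[of 2 "real h" 1 \<alpha>] by (simp add: r_def)
  have h0: "0 < h" using h by simp
  define k where "k = removal_const \<alpha> 1"
  show ?thesis unfolding r_def[symmetric]
  proof (rule order_tendstoI)
    fix a assume a: "a < r * D"
    have rD: "0 < r * D" using r D by simp
    \<comment> \<open>The second entry leaves (1 - \<epsilon>) r D at least halfway between a and r
      D; the minimum with 1/2 keeps \<epsilon> < 1 when a is very negative.\<close>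
    define \<epsilon> where "\<epsilon> = min (1/2) ((r * D - a) / (2 * (r * D)))"
    have \<epsilon>: "0 < \<epsilon>" "\<epsilon> < 1" using a rD by (auto simp: \<epsilon>_def)
    have "\<epsilon> * (r * D) \<le> (r * D - a) / (2 * (r * D)) * (r * D)" using rD by (intro mult_right_mono) (auto simp: \<epsilon>_def)
    also have "\<dots> = (r * D - a) / 2"
    proof -
      have *: "x / (2 * q) * q = x / 2" if "q \<noteq> 0" for x q :: real using that by simp
      show ?thesis by (rule *) (use rD in linarith)
    qed
    finally have a': "a < (1 - \<epsilon>) * (D * r)" using a by (simp add: algebra_simps)
    obtain K :: nat and c :: real where c: "0 < c" and ev:
      "\<forall>\<^sub>F C in at_right 0. \<exists>X. admissible \<alpha> 1 D h C X \<and>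
        (1 - \<epsilon>) * (D / (1 + ln (1 / (C / c) powr (1 / r))) - real K * (C / c) powr (1 / r)) \<le> Bh_defect h X"
      using spread_shannon[OF h \<alpha> D \<epsilon>] unfolding r_def by blast
    let ?L = "\<lambda>C. D / (1 + ln (1 / (C / c) powr (1 / r))) - real K * (C / c) powr (1 / r)"
    have "((\<lambda>C. (1 - \<epsilon>) * (?L C * ln (1 / C))) \<longlongrightarrow> (1 - \<epsilon>) * (D * r)) (at_right 0)"
    proof (rule tendsto_mult_left)
      show "((\<lambda>C. ?L C * ln (1 / C)) \<longlongrightarrow> D * r) (at_right 0)"
      proof -
        have 1: "((\<lambda>C. D / (1 + ln (1 / (C / c) powr (1 / r))) * ln (1 / C)) \<longlongrightarrow> D * r) (at_right 0)"
          using r c D by real_asymp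
        have 2: "((\<lambda>C. (C / c) powr (1 / r) * ln (1 / C)) \<longlongrightarrow> 0) (at_right 0)"
          using r c by real_asymp
        show ?thesis using tendsto_diff[OF 1 tendsto_mult_left[OF 2, of "real K"]]
          by (simp add: left_diff_distrib mult.assoc)
      qed
    qed
    then have "\<forall>\<^sub>F C in at_right 0. a < (1 - \<epsilon>) * (?L C * ln (1 / C))" using a' by (rule order_tendstoD)
    moreover have "\<forall>\<^sub>F C in at_right 0. C < (1::real)" by real_asymp
    ultimately show "\<forall>\<^sub>F C in at_right 0. a < Phi \<alpha> 1 D h C * ln (1 / C)"
      using ev eventually_at_right_less[of 0]
    proof eventually_elim
      case (elim C)
      then obtain X where X: "admissible \<alpha> 1 D h C X" "(1 - \<epsilon>) * ?L C \<le> Bh_defect h X" by blast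
      have "(1 - \<epsilon>) * ?L C \<le> Phi \<alpha> 1 D h C" using X(2) Phi_ge[OF h0 X(1)] by linarith
      then have "(1 - \<epsilon>) * ?L C * ln (1 / C) \<le> Phi \<alpha> 1 D h C * ln (1 / C)"
        using elim by (intro mult_right_mono) auto
      then show ?case using elim(1) by (simp only: mult.assoc)
    qed
  next
    fix a assume a: "r * D < a"
    \<comment> \<open>Any \<open>e\<close> in (0, 1) yields admissible laws, as
      \<open>Phi_le\<close> requires.\<close>
    obtain e :: real where e: "0 < e" "e < 1" by (rule that[of "1/2"]) auto
    obtain K :: nat and c :: real where
      "\<forall>\<^sub>F C in at_right 0. \<exists>X. admissible \<alpha> 1 D h C X \<and>
        (1 - e) * (D / (1 + ln (1 / (C / c) powr (1 / r))) - real K * (C / c) powr (1 / r)) \<le> Bh_defect h X"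
      using spread_shannon[OF h \<alpha> D e] unfolding r_def by blast
    then have ex: "\<forall>\<^sub>F C in at_right 0. \<exists>X. admissible \<alpha> 1 D h C X" by eventually_elim blast
    let ?U = "\<lambda>C. D * r / (- ln C - 2 * ln (- ln C)) + k / (- ln C)\<^sup>2"
    have "((\<lambda>C. ?U C * (- ln C)) \<longlongrightarrow> D * r) (at_right 0)" by real_asymp
    then have "\<forall>\<^sub>F C in at_right 0. ?U C * (- ln C) < a" using a by (intro order_tendstoD) (auto simp: mult.commute)
    moreover have "\<forall>\<^sub>F C in at_right 0. C < (1::real)" by real_asymp
    moreover have "\<forall>\<^sub>F C::real in at_right 0. 0 < - ln C - 2 * ln (- ln C)" by real_asymp
    moreover have "\<forall>\<^sub>F C::real in at_right 0. 0 < - ln C" by real_asymp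
    ultimately show "\<forall>\<^sub>F C in at_right 0. Phi \<alpha> 1 D h C * ln (1 / C) < a"
      using ex eventually_at_right_less[of 0]
    proof eventually_elim
      case (elim C)
      \<comment> \<open>The threshold satisfies t^r = C (ln C)^2. The squared logarithm makes the
        removal term k / (ln C)^2 vanish even after multiplication by ln(1/C), and changes ln(1/t) ~
        ln(1/C) / r only to lower order.\<close>
      define y where "y = C * (- ln C)\<^sup>2"
      define t where "t = y powr (1 / r)"
      have y: "0 < y" using elim by (simp add: y_def)
      have lny: "ln y = - (- ln C - 2 * ln (- ln C))"
      proof -
        have sq: "ln (z\<^sup>2) = 2 * ln z" if "0 < z" for z :: real using that by (simp add: ln_realpow)
        have "ln ((- ln C)\<^sup>2) = 2 * ln (- ln C)" by (rule sq) (use elim in blast)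
        moreover have "ln y = ln C + ln ((- ln C)\<^sup>2)"
          unfolding y_def using elim by (intro ln_mult_pos) auto
        ultimately show ?thesis by linarith
      qed
      have t: "0 < t" using y by (simp add: t_def)
      have lnt: "ln (1 / t) = (- ln C - 2 * ln (- ln C)) / r"
      proof -
        have "ln (1 / t) = - ln y / r" using y t by (simp add: t_def ln_div ln_powr)
        then show ?thesis by (simp only: lny minus_minus)
      qed
      then have "0 < ln (1 / t)" using elim r by simp
      then have t1: "t < 1" using t by simp
      have tr: "t powr (1 - real h * \<alpha>) = 1 / y"
      proof -
        have "t powr (1 - real h * \<alpha>) = t powr (- r)" by (simp add: r_def)
        also have "\<dots> = y powr (- 1)" using r by (simp add: t_def powr_powr)
        finally show ?thesis using y by (simp add: powr_minus_divide)
      qed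
      have "Phi \<alpha> 1 D h C \<le> ?U C"
      proof (rule Phi_le)
        fix X assume "admissible \<alpha> 1 D h C X"
        then have "Bh_defect h X \<le> D / ln (1 / t) + k * C * t powr (1 - real h * \<alpha>)"
          unfolding k_def using elim h \<alpha> D t t1 by (intro Bh_defect_le_shannon) auto
        also have "D / ln (1 / t) = D * r / (- ln C - 2 * ln (- ln C))" by (simp add: lnt)
        also have "k * C * t powr (1 - real h * \<alpha>) = k / (- ln C)\<^sup>2"
          using elim by (simp add: tr y_def)
        finally show "Bh_defect h X \<le> ?U C" .
      qed (use elim in blast)
      then have "Phi \<alpha> 1 D h C * (- ln C) \<le> ?U C * (- ln C)" using elim by (intro mult_right_mono) auto
      moreover have "ln (1 / C) = - ln C" using elim by (simp add: ln_div)
      ultimately show ?case using elim(1) by simp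
    qed
  qed
qed

section \<open>The Renyi entropy constraints\<close>

text \<open>An atom of mass p with p^\<beta> = e^(-(\<beta>-1) D) meets the entropy constraint
  alone, so the remaining mass 1 - p can be spread over arbitrarily many groups. Hence the limit
  value is a lower bound for every C > 0.\<close>

lemma Phi_ge_renyi_gt_1:
  assumes h: "2 \<le> h" and \<alpha>: "1 \<le> \<alpha>" and \<beta>: "1 < \<beta>" and D: "0 < D" and C: "0 < C"
  shows "\<exists>X. admissible \<alpha> \<beta> D h C X" (is ?E)
    and "1 - exp (- ((\<beta> - 1) * D / \<beta>)) \<le> Phi \<alpha> \<beta> D h C" (is ?P)
proof -
  define p where "p = exp (- ((\<beta> - 1) * D / \<beta>))"
  have p: "0 < p" "p < 1" using \<beta> D by (auto simp: p_def)
  have p\<beta>: "p powr \<beta> = exp (- ((\<beta> - 1) * D))" using \<beta> by (simp add: p_def exp_powr_real)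
  have \<alpha>0: "0 < \<alpha>" using \<alpha> by simp
  have h0: "0 < h" using h by simp
  have h\<alpha>: "2 \<le> h * \<alpha>" using h \<alpha> mult_mono[of 2 "real h" 1 \<alpha>] by simp
  have main: "\<exists>X. admissible \<alpha> \<beta> D h C X \<and> (1 - \<epsilon>) * (1 - p) \<le> Bh_defect h X" if \<epsilon>: "0 < \<epsilon>" for \<epsilon>
  proof (rule spread_admissible[OF h \<epsilon> \<alpha>0 p(1)])
    fix K :: nat and c :: real
    assume K: "1 \<le> K" and c: "0 < c" and
    adm: "\<And>(m::nat) (t::real) \<beta> D C. 1 \<le> m \<Longrightarrow> 0 < t \<Longrightarrow> real m * real K * t \<le> 1 - p \<Longrightarrow>
      (\<And>X::int pmf. ent_sum \<beta> X = ennreal (ent_term \<beta> (1 - real m * real K * t) + real m * real K * ent_term \<beta> t) \<Longrightarrow> renyi_entropy \<beta> X \<le> ereal D) \<Longrightarrow>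
      c * (m * t powr (h * \<alpha>)) \<le> C \<Longrightarrow>
      \<exists>X. admissible \<alpha> \<beta> D h C X \<and> (1 - \<epsilon>) * (real m * real K * t) \<le> Bh_defect h X"
    \<comment> \<open>As t <= 1/m and h \<alpha> >= 2, the deficit is at most c m (1/m)^2 = c / m,
      which m > c / C pushes below C.\<close>
    obtain m :: nat where m: "max 1 (c / C) < m" using reals_Archimedean2 by blast
    define t where "t = (1 - p) / (real m * real K)"
    have mK: "real m * real K * t = 1 - p" using m K by (simp add: t_def)
    have t: "0 < t" using p m K by (simp add: t_def)
    have "\<exists>X. admissible \<alpha> \<beta> D h C X \<and> (1 - \<epsilon>) * (real m * real K * t) \<le> Bh_defect h X"
    proof (rule adm)
      fix X :: "int pmf" assume X: "ent_sum \<beta> X = ennreal (ent_term \<beta> (1 - real m * real K * t) + real m * real K * ent_term \<beta> t)"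
      have "exp (- ((\<beta> - 1) * D)) \<le> ent_term \<beta> (1 - real m * real K * t) + real m * real K * ent_term \<beta> t"
        using \<beta> by (simp add: ent_term_def mK p\<beta>)
      then show "renyi_entropy \<beta> X \<le> ereal D"
        unfolding renyi_gt_1_le_iff[OF \<beta>] X by (rule ennreal_leI)
    next
      have tm: "t \<le> 1 / m"
      proof -
        have "1 - p \<le> real K" using p K by simp
        then have "t \<le> real K / (real m * real K)" unfolding t_def by (intro divide_right_mono) auto
        then show ?thesis using K by simp
      qed
      moreover have "1 / real m \<le> 1" using m by simp
      ultimately have "t \<le> 1" by linarith
      then have "t powr (h * \<alpha>) \<le> t powr 2" using t h\<alpha> by (intro powr_mono') auto
      also have "\<dots> = t\<^sup>2" using t by simp
      also have "\<dots> \<le> (1 / m)\<^sup>2" using tm t by (intro power_mono) auto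
      finally have "m * t powr (h * \<alpha>) \<le> m * (1 / m)\<^sup>2" by (intro mult_left_mono) auto
      also have "\<dots> = 1 / m" by (simp add: power2_eq_square)
      finally have "c * (m * t powr (h * \<alpha>)) \<le> c * (1 / m)" using c by (intro mult_left_mono) auto
      also have "\<dots> \<le> C" using m C by (simp add: field_simps)
      finally show "c * (m * t powr (h * \<alpha>)) \<le> C" .
    qed (use m t mK in auto)
    then show ?thesis unfolding mK .
  qed
  then show ?E using zero_less_one by blast
  have "(1 - \<epsilon>) * (1 - p) \<le> Phi \<alpha> \<beta> D h C" if "0 < \<epsilon>" for \<epsilon>
    using main[OF that] Phi_ge[OF h0] by (meson order_trans)
  then have le: "1 - p \<le> Phi \<alpha> \<beta> D h C + \<epsilon> * (1 - p)" if "0 < \<epsilon>" for \<epsilon>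
    using that by (fastforce simp: algebra_simps)
  have "1 - p \<le> Phi \<alpha> \<beta> D h C"
  proof (rule field_le_epsilon)
    fix e :: real assume "0 < e"
    then show "1 - p \<le> Phi \<alpha> \<beta> D h C + e" using le[of "e / (1 - p)"] p by simp
  qed
  then show ?P by (simp add: p_def)
qed

lemma Phi_limit_renyi_gt_1:
  assumes h: "2 \<le> h" and \<alpha>: "1 \<le> \<alpha>" and \<beta>: "1 < \<beta>" and D: "0 < D"
  shows "((\<lambda>C. Phi \<alpha> \<beta> D h C) \<longlongrightarrow> 1 - exp (- ((\<beta> - 1) * D / \<beta>))) (at_right 0)"
proof -
  define k where "k = removal_const \<alpha> 1"
  define a where "a = real h * \<alpha>"
  have a: "2 \<le> a" using h \<alpha> mult_mono[of 2 "real h" 1 \<alpha>] by (simp add: a_def)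
  define E where "E = exp (- ((\<beta> - 1) * D))"
  have E: "0 < E" by (simp add: E_def)
  \<comment> \<open>Any exponent strictly between 0 and 1/(a - 1) would let both t^(\<beta>-1) and C
    t^(1-a) tend to 0; this one makes the latter C^(1/2 + 1/(2a)).\<close>
  let ?t = "\<lambda>C. C powr (1 / (2 * a))"
  let ?U = "\<lambda>C. 1 - (E - ?t C powr (\<beta> - 1)) powr (1 / \<beta>) + k * C * ?t C powr (1 - a)"
  have t0: "((\<lambda>C. ?t C powr (\<beta> - 1)) \<longlongrightarrow> 0) (at_right 0)" using a \<beta> by real_asymp
  have t1: "((\<lambda>C. C * ?t C powr (1 - a)) \<longlongrightarrow> 0) (at_right 0)"
  proof -
    have "((\<lambda>C::real. C powr (1 / 2 + 1 / (2 * a))) \<longlongrightarrow> 0) (at_right 0)"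
    proof -
      have "0 < 1 / 2 + 1 / (2 * a)" using a by (simp add: add_pos_pos)
      then show ?thesis by real_asymp
    qed
    moreover have "\<forall>\<^sub>F C in at_right 0. C powr (1 / 2 + 1 / (2 * a)) = C * ?t C powr (1 - a)"
      using eventually_at_right_less[of 0]
    proof eventually_elim
      case (elim C)
      have "C * ?t C powr (1 - a) = C powr 1 * C powr ((1 - a) / (2 * a))"
        using elim by (simp add: powr_powr)
      also have "\<dots> = C powr (1 + (1 - a) / (2 * a))" by (rule powr_add[symmetric])
      also have "1 + (1 - a) / (2 * a) = 1 / 2 + 1 / (2 * a)" using a by (simp add: field_simps)
      finally show ?case ..
    qed
    ultimately show ?thesis by (rule Lim_transform_eventually)
  qed
  have "(?U \<longlongrightarrow> 1 - (E - 0) powr (1 / \<beta>) + k * 0) (at_right 0)"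
    unfolding mult.assoc[of k] using E by (intro tendsto_intros t0 t1) auto
  then have lim: "(?U \<longlongrightarrow> 1 - exp (- ((\<beta> - 1) * D / \<beta>))) (at_right 0)"
    by (simp add: E_def exp_powr_real)
  have "\<forall>\<^sub>F C in at_right 0. ?t C powr (\<beta> - 1) < E" using t0 E by (rule order_tendstoD)
  moreover have "\<forall>\<^sub>F C::real in at_right 0. C < 1" by real_asymp
  ultimately have upper: "\<forall>\<^sub>F C in at_right 0. Phi \<alpha> \<beta> D h C \<le> ?U C"
    using eventually_at_right_less[of 0]
  proof eventually_elim
    case (elim C)
    show ?case
    proof (rule Phi_le)
      fix X assume "admissible \<alpha> \<beta> D h C X"
      then show "Bh_defect h X \<le> ?U C"
        unfolding k_def E_def a_def using elim h \<alpha> \<beta> D by (intro Bh_defect_le_renyi_gt_1) (auto simp: E_def a_def)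
    qed (rule Phi_ge_renyi_gt_1(1)[OF h \<alpha> \<beta> D elim(3)])
  qed
  have lower: "\<forall>\<^sub>F C in at_right 0. 1 - exp (- ((\<beta> - 1) * D / \<beta>)) \<le> Phi \<alpha> \<beta> D h C"
    using eventually_at_right_less[of 0] by eventually_elim (rule Phi_ge_renyi_gt_1(2)[OF h \<alpha> \<beta> D])
  show ?thesis by (rule tendsto_sandwich[OF lower upper tendsto_const lim])
qed

text \<open>The atom at 0 contributes at most 1 to the power sum, which leaves e^((1-\<beta>) D) - 1
  for the groups. With \<epsilon> = 1/2 half of the spread mass is lost, enough for an order of
  magnitude.\<close>

lemma spread_renyi_lt_1:
  fixes \<alpha> \<beta> D :: real
  assumes h: "2 \<le> h" and \<beta>: "0 < \<beta>" "\<beta> < 1" and \<alpha>: "\<beta> \<le> \<alpha>" and D: "0 < D"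
  obtains K :: nat and c :: real where "1 \<le> K" "0 < c"
    "\<And>(m::nat) (t::real) C. 1 \<le> m \<Longrightarrow> 0 < t \<Longrightarrow> real m * real K * t \<le> 1 / 2 \<Longrightarrow>
      real m * real K * t powr \<beta> \<le> exp ((1 - \<beta>) * D) - 1 \<Longrightarrow>
      c * (m * t powr (h * \<alpha>)) \<le> C \<Longrightarrow>
      (\<exists>X. admissible \<alpha> \<beta> D h C X) \<and> 1 / 2 * (real m * real K * t) \<le> Phi \<alpha> \<beta> D h C"
proof (rule spread_admissible[OF h, of "1/2" \<alpha> "1/2"])
  fix K :: nat and c :: real
  assume K: "1 \<le> K" and c: "0 < c" and
  adm: "\<And>(m::nat) (t::real) \<beta> D C. 1 \<le> m \<Longrightarrow> 0 < t \<Longrightarrow> real m * real K * t \<le> 1 - 1/2 \<Longrightarrow>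
    (\<And>X::int pmf. ent_sum \<beta> X = ennreal (ent_term \<beta> (1 - real m * real K * t) + real m * real K * ent_term \<beta> t) \<Longrightarrow> renyi_entropy \<beta> X \<le> ereal D) \<Longrightarrow>
    c * (m * t powr (h * \<alpha>)) \<le> C \<Longrightarrow>
    \<exists>X. admissible \<alpha> \<beta> D h C X \<and> (1 - 1/2) * (real m * real K * t) \<le> Bh_defect h X"
  show thesis
  proof (rule that[OF K c])
    fix m :: nat and t C :: real
    assume m: "1 \<le> m" and t: "0 < t" and d: "real m * real K * t \<le> 1 / 2"
      and e: "real m * real K * t powr \<beta> \<le> exp ((1 - \<beta>) * D) - 1"
      and C: "c * (m * t powr (h * \<alpha>)) \<le> C"
    have d0: "0 \<le> real m * real K * t" using t by simp
    have "\<exists>X. admissible \<alpha> \<beta> D h C X \<and> (1 - 1/2) * (real m * real K * t) \<le> Bh_defect h X"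
    proof (rule adm)
      fix X :: "int pmf" assume X: "ent_sum \<beta> X = ennreal (ent_term \<beta> (1 - real m * real K * t) + real m * real K * ent_term \<beta> t)"
      have "(1 - real m * real K * t) powr \<beta> \<le> 1 powr \<beta>" using d d0 \<beta> by (intro powr_mono2) auto
      then have "ent_term \<beta> (1 - real m * real K * t) + real m * real K * ent_term \<beta> t \<le> exp ((1 - \<beta>) * D)"
        using e \<beta> by (simp add: ent_term_def)
      then show "renyi_entropy \<beta> X \<le> ereal D"
        unfolding renyi_lt_1_le_iff[OF \<beta>(2)] X by (rule ennreal_leI)
    qed (use m t d C in auto)
    then obtain X where X: "admissible \<alpha> \<beta> D h C X" "(1 - 1/2) * (real m * real K * t) \<le> Bh_defect h X" by blast
    then have "1 / 2 * (real m * real K * t) \<le> Phi \<alpha> \<beta> D h C"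
      using Phi_ge[OF _ X(1)] h by simp
    then show "(\<exists>X. admissible \<alpha> \<beta> D h C X) \<and> 1 / 2 * (real m * real K * t) \<le> Phi \<alpha> \<beta> D h C"
      using X(1) by blast
  qed
qed (use \<alpha> \<beta> in auto)

text \<open>The entropy budget is exhausted: m K is about \<kappa> t^(-\<beta>), so the spread mass
  has order t^(1-\<beta>) and the deficit order t^(h \<alpha> - \<beta>).\<close>

lemma Phi_ge_renyi_lt_1_many:
  fixes \<alpha> \<beta> D :: real
  assumes h: "2 \<le> h" and \<beta>: "0 < \<beta>" "\<beta> < 1" and \<alpha>: "\<beta> \<le> \<alpha>" and D: "0 < D"
  shows "\<exists>c>0. \<forall>\<^sub>F C in at_right 0. (\<exists>X. admissible \<alpha> \<beta> D h C X) \<and>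
     c * C powr ((1 - \<beta>) / (real h * \<alpha> - \<beta>)) \<le> Phi \<alpha> \<beta> D h C"
proof (rule spread_renyi_lt_1[OF assms])
  fix K :: nat and c :: real
  assume K: "1 \<le> K" and c: "0 < c" and
    adm: "\<And>(m::nat) (t::real) C. 1 \<le> m \<Longrightarrow> 0 < t \<Longrightarrow> real m * real K * t \<le> 1 / 2 \<Longrightarrow>
      real m * real K * t powr \<beta> \<le> exp ((1 - \<beta>) * D) - 1 \<Longrightarrow>
      c * (m * t powr (h * \<alpha>)) \<le> C \<Longrightarrow>
      (\<exists>X. admissible \<alpha> \<beta> D h C X) \<and> 1 / 2 * (real m * real K * t) \<le> Phi \<alpha> \<beta> D h C"
  define \<kappa> where "\<kappa> = exp ((1 - \<beta>) * D) - 1"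
  have \<kappa>: "0 < \<kappa>" using \<beta> D by (simp add: \<kappa>_def)
  define s where "s = real h * \<alpha> - \<beta>"
  have "1 * \<beta> < real h * \<alpha>" using h \<alpha> \<beta> by (intro mult_less_le_imp_less) auto
  then have s: "0 < s" by (simp add: s_def)
  have K0: "0 < real K" using K by simp
  have ev: "\<forall>\<^sub>F t::real in at_right 0. 0 < t \<and> 1 \<le> \<kappa> * t powr (- \<beta>) / K \<and> \<kappa> * t powr (1 - \<beta>) \<le> 1 / 2"
    using \<kappa> \<beta> K0 by (intro eventually_conj; real_asymp)
  have ev2: "\<forall>\<^sub>F t::real in at_right 0. (\<exists>X. admissible \<alpha> \<beta> D h (c * \<kappa> * t powr s) X) \<and>
     \<kappa> / 4 * t powr (1 - \<beta>) \<le> Phi \<alpha> \<beta> D h (c * \<kappa> * t powr s)"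
    using ev
  proof eventually_elim
    case (elim t)
    define x where "x = \<kappa> * t powr (- \<beta>) / K"
    define m where "m = nat \<lfloor>x\<rfloor>"
    have t: "0 < t" and x: "1 \<le> x" and small: "\<kappa> * t powr (1 - \<beta>) \<le> 1 / 2"
      using elim by (simp_all add: x_def)
    note m = floor_bounds[OF x, folded m_def]
    have xK: "x * K = \<kappa> * t powr (- \<beta>)" using K0 by (simp add: x_def)
    have t1: "t powr (- \<beta>) * t = t powr (1 - \<beta>)" using t by (simp add: powr_diff powr_minus_divide)
    have t2: "t powr (- \<beta>) * t powr \<beta> = 1" using t by (simp flip: powr_add)
    have t3: "t powr (- \<beta>) * t powr (h * \<alpha>) = t powr s" by (simp add: s_def flip: powr_add)
    have mK: "real m * real K \<le> \<kappa> * t powr (- \<beta>)"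
      unfolding xK[symmetric] using m by (intro mult_right_mono) auto
    have "(\<exists>X. admissible \<alpha> \<beta> D h (c * \<kappa> * t powr s) X) \<and>
       1 / 2 * (real m * real K * t) \<le> Phi \<alpha> \<beta> D h (c * \<kappa> * t powr s)"
    proof (rule adm)
      have "real m * real K * t \<le> \<kappa> * t powr (- \<beta>) * t" using mK t by (intro mult_right_mono) auto
      also have "\<dots> \<le> 1 / 2" using small by (simp only: mult.assoc t1)
      finally show "real m * real K * t \<le> 1 / 2" .
      have "real m * real K * t powr \<beta> \<le> \<kappa> * t powr (- \<beta>) * t powr \<beta>" using mK by (intro mult_right_mono) auto
      also have "\<dots> = \<kappa>" by (simp only: mult.assoc t2 mult_1_right)
      finally show "real m * real K * t powr \<beta> \<le> exp ((1 - \<beta>) * D) - 1" by (simp add: \<kappa>_def)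
      have "real m * 1 \<le> real m * real K" using K by (intro mult_left_mono) auto
      then have "real m \<le> \<kappa> * t powr (- \<beta>)" using mK by simp
      then have "real m * t powr (h * \<alpha>) \<le> \<kappa> * t powr (- \<beta>) * t powr (h * \<alpha>)" by (intro mult_right_mono) auto
      then have "real m * t powr (h * \<alpha>) \<le> \<kappa> * t powr s" by (simp only: mult.assoc t3)
      then show "c * (real m * t powr (h * \<alpha>)) \<le> c * \<kappa> * t powr s" using c by (simp add: mult.assoc)
    qed (use m t in auto)
    moreover have "\<kappa> / 4 * t powr (1 - \<beta>) \<le> 1 / 2 * (real m * real K * t)"
    proof -
      have "\<kappa> * t powr (1 - \<beta>) = x * K * t" by (simp only: xK mult.assoc t1)
      also have "\<dots> \<le> 2 * real m * K * t" using m K0 t by (intro mult_right_mono) auto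
      finally show ?thesis by simp
    qed
    ultimately show ?case by auto
  qed
  have c\<kappa>: "0 < c * \<kappa>" using c \<kappa> by simp
  show ?thesis
  proof (intro exI[of _ "\<kappa> / 4 * (1 / (c * \<kappa>)) powr ((1 - \<beta>) / s)"] conjI)
    show "0 < \<kappa> / 4 * (1 / (c * \<kappa>)) powr ((1 - \<beta>) / s)" using c \<kappa> by simp
    show "\<forall>\<^sub>F C in at_right 0. (\<exists>X. admissible \<alpha> \<beta> D h C X) \<and>
       \<kappa> / 4 * (1 / (c * \<kappa>)) powr ((1 - \<beta>) / s) * C powr ((1 - \<beta>) / (real h * \<alpha> - \<beta>)) \<le> Phi \<alpha> \<beta> D h C"
      using rescale_at_right_0[OF ev2 c\<kappa> s] eventually_at_right_less[of 0]
    proof eventually_elim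
      case (elim C)
      have "((C / (c * \<kappa>)) powr (1 / s)) powr (1 - \<beta>) = (1 / (c * \<kappa>)) powr ((1 - \<beta>) / s) * C powr ((1 - \<beta>) / s)"
        using elim(2) c\<kappa> by (simp add: powr_powr powr_divide)
      then show ?case
        using elim(1) rescale_powr[OF elim(2) c\<kappa> s] by (simp add: s_def mult.assoc)
    qed
  qed
qed

text \<open>One group suffices: its mass has order t and its deficit order t^(h \<alpha>), while the
  entropy constraint is slack for small t.\<close>

lemma Phi_ge_renyi_lt_1_single:
  fixes \<alpha> \<beta> D :: real
  assumes h: "2 \<le> h" and \<beta>: "0 < \<beta>" "\<beta> < 1" and \<alpha>: "\<beta> \<le> \<alpha>" and D: "0 < D"
  shows "\<exists>c>0. \<forall>\<^sub>F C in at_right 0. (\<exists>X. admissible \<alpha> \<beta> D h C X) \<and>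
     c * C powr (1 / (real h * \<alpha>)) \<le> Phi \<alpha> \<beta> D h C"
proof (rule spread_renyi_lt_1[OF assms])
  fix K :: nat and c :: real
  assume K: "1 \<le> K" and c: "0 < c" and
    adm: "\<And>(m::nat) (t::real) C. 1 \<le> m \<Longrightarrow> 0 < t \<Longrightarrow> real m * real K * t \<le> 1 / 2 \<Longrightarrow>
      real m * real K * t powr \<beta> \<le> exp ((1 - \<beta>) * D) - 1 \<Longrightarrow>
      c * (m * t powr (h * \<alpha>)) \<le> C \<Longrightarrow>
      (\<exists>X. admissible \<alpha> \<beta> D h C X) \<and> 1 / 2 * (real m * real K * t) \<le> Phi \<alpha> \<beta> D h C"
  define \<kappa> where "\<kappa> = exp ((1 - \<beta>) * D) - 1"
  have \<kappa>: "0 < \<kappa>" using \<beta> D by (simp add: \<kappa>_def)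
  define s where "s = real h * \<alpha>"
  have s: "0 < s" using h \<alpha> \<beta> by (simp add: s_def)
  have K0: "0 < real K" using K by simp
  have ev: "\<forall>\<^sub>F t::real in at_right 0. 0 < t \<and> real K * t \<le> 1 / 2 \<and> real K * t powr \<beta> \<le> \<kappa>"
    using \<kappa> \<beta> K0 by (intro eventually_conj; real_asymp)
  have ev2: "\<forall>\<^sub>F t::real in at_right 0. (\<exists>X. admissible \<alpha> \<beta> D h (c * t powr s) X) \<and>
     1 / 2 * t \<le> Phi \<alpha> \<beta> D h (c * t powr s)"
    using ev
  proof eventually_elim
    case (elim t)
    have "(\<exists>X. admissible \<alpha> \<beta> D h (c * t powr s) X) \<and>
       1 / 2 * (real 1 * real K * t) \<le> Phi \<alpha> \<beta> D h (c * t powr s)"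
      by (rule adm) (use elim in \<open>auto simp: \<kappa>_def s_def\<close>)
    moreover have "1 * t \<le> K * t" using K elim by (intro mult_right_mono) auto
    ultimately show ?case by auto
  qed
  show ?thesis
  proof (intro exI[of _ "1 / 2 * (1 / c) powr (1 / s)"] conjI)
    show "0 < 1 / 2 * (1 / c) powr (1 / s)" using c by simp
    show "\<forall>\<^sub>F C in at_right 0. (\<exists>X. admissible \<alpha> \<beta> D h C X) \<and>
       1 / 2 * (1 / c) powr (1 / s) * C powr (1 / (real h * \<alpha>)) \<le> Phi \<alpha> \<beta> D h C"
      using rescale_at_right_0[OF ev2 c s] eventually_at_right_less[of 0]
    proof eventually_elim
      case (elim C)
      have "(C / c) powr (1 / s) = (1 / c) powr (1 / s) * C powr (1 / s)"
        using elim(2) c by (simp add: powr_divide)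
      then show ?case
        using elim(1) rescale_powr[OF elim(2) c s] by (simp add: s_def)
    qed
  qed
qed

lemma Phi_bounds_renyi_lt_1:
  fixes \<alpha> \<beta> D :: real
  assumes h: "2 \<le> h" and D: "0 < D" and \<beta>: "0 < \<beta>" "\<beta> < 1" and \<alpha>: "\<beta> \<le> \<alpha>"
  defines "\<Theta> \<equiv> min (1 / (real h * \<alpha>)) ((1 - \<beta>) / (real h * \<alpha> - \<beta>))"
  shows "\<exists>c1 c2. 0 < c1 \<and> c1 \<le> c2 \<and> (\<forall>\<^sub>F C in at_right 0.
           c1 * C powr \<Theta> \<le> Phi \<alpha> \<beta> D h C \<and> Phi \<alpha> \<beta> D h C \<le> c2 * C powr \<Theta>)"
proof -
  define a where "a = real h * \<alpha>"
  define M where "M = exp ((1 - \<beta>) * D)"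
  define k where "k = removal_const \<alpha> (M ^ h)"
  have k: "0 \<le> k" unfolding k_def by (rule removal_const_nonneg) (simp add: M_def)
  have "1 * \<beta> < real h * \<alpha>" using h \<alpha> \<beta> by (intro mult_less_le_imp_less) auto
  then have a: "\<beta> < a" "0 < a" using \<beta> by (auto simp: a_def)
  have "\<exists>c1>0. \<exists>c2. \<forall>\<^sub>F C in at_right 0. c1 * C powr \<Theta> \<le> Phi \<alpha> \<beta> D h C \<and> Phi \<alpha> \<beta> D h C \<le> c2 * C powr \<Theta>"
  \<comment> \<open>The two exponents compare as (1 - \<beta>) a and a - \<beta>, that is, as
    \<beta> and \<beta> a; the minimum switches at a = 1.\<close>
  proof (cases "1 \<le> a")
    case True
    have "\<beta> * 1 \<le> \<beta> * a" using True \<beta> by (intro mult_left_mono) auto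
    then have "(1 - \<beta>) / (a - \<beta>) \<le> 1 / a" using a by (simp add: field_simps)
    then have \<Theta>: "\<Theta> = (1 - \<beta>) / (a - \<beta>)" by (simp add: \<Theta>_def a_def)
    obtain c1 where c1: "0 < c1" "\<forall>\<^sub>F C in at_right 0. (\<exists>X. admissible \<alpha> \<beta> D h C X) \<and> c1 * C powr \<Theta> \<le> Phi \<alpha> \<beta> D h C"
      using Phi_ge_renyi_lt_1_many[OF h \<beta> \<alpha> D] unfolding \<Theta> a_def by blast
    have "\<forall>\<^sub>F C::real in at_right 0. C < 1" by real_asymp
    with c1(2) have "\<forall>\<^sub>F C in at_right 0. c1 * C powr \<Theta> \<le> Phi \<alpha> \<beta> D h C \<and> Phi \<alpha> \<beta> D h C \<le> (M + k) * C powr \<Theta>"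
      using eventually_at_right_less[of 0]
    proof eventually_elim
      case (elim C)
      \<comment> \<open>This threshold balances the light mass t^(1-\<beta>) against the removal
        term C t^(1-a).\<close>
      define t where "t = C powr (1 / (a - \<beta>))"
      have t: "0 < t" using elim by (simp add: t_def)
      have t1: "t powr (1 - \<beta>) = C powr \<Theta>" by (simp add: t_def powr_powr \<Theta>)
      have t2: "C * t powr (1 - a) = C powr \<Theta>"
      proof -
        have "C * t powr (1 - a) = C powr 1 * C powr ((1 - a) / (a - \<beta>))"
          using elim by (simp add: t_def powr_powr)
        also have "\<dots> = C powr (1 + (1 - a) / (a - \<beta>))" by (rule powr_add[symmetric])
        also have "1 + (1 - a) / (a - \<beta>) = \<Theta>" using a unfolding \<Theta> by (simp add: field_simps)
        finally show ?thesis .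
      qed
      have "Phi \<alpha> \<beta> D h C \<le> (M + k) * C powr \<Theta>"
      proof (rule Phi_le)
        fix X assume "admissible \<alpha> \<beta> D h C X"
        then have "Bh_defect h X \<le> t powr (1 - \<beta>) * M + k * C * t powr (1 - a)"
          unfolding M_def k_def a_def using elim h \<alpha> \<beta> D t True
          by (intro Bh_defect_le_renyi_lt_1_large) (auto simp: a_def)
        then show "Bh_defect h X \<le> (M + k) * C powr \<Theta>"
          by (simp only: t1 t2 mult.assoc distrib_right) (simp add: mult.commute)
      qed (use elim in blast)
      then show ?case using elim by blast
    qed
    then show ?thesis using c1(1) by blast
  next
    case False
    have "\<beta> * a \<le> \<beta> * 1" using False \<beta> by (intro mult_left_mono) auto
    then have "1 / a \<le> (1 - \<beta>) / (a - \<beta>)" using a by (simp add: field_simps)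
    then have \<Theta>: "\<Theta> = 1 / a" by (simp add: \<Theta>_def a_def)
    obtain c1 where c1: "0 < c1" "\<forall>\<^sub>F C in at_right 0. (\<exists>X. admissible \<alpha> \<beta> D h C X) \<and> c1 * C powr \<Theta> \<le> Phi \<alpha> \<beta> D h C"
      using Phi_ge_renyi_lt_1_single[OF h \<beta> \<alpha> D] unfolding \<Theta> a_def by blast
    have "\<forall>\<^sub>F C::real in at_right 0. C < 1" by real_asymp
    with c1(2) have "\<forall>\<^sub>F C in at_right 0. c1 * C powr \<Theta> \<le> Phi \<alpha> \<beta> D h C \<and> Phi \<alpha> \<beta> D h C \<le> (M + k powr \<Theta>) * C powr \<Theta>"
      using eventually_at_right_less[of 0]
    proof eventually_elim
      case (elim C)
      \<comment> \<open>The removal term is now free of t and of order C^\<Theta>, so t is only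
        taken small enough to bring the light mass down to that order.\<close>
      define t where "t = C powr (\<Theta> / (1 - \<beta>))"
      have t: "0 < t" using elim by (simp add: t_def)
      have t1: "t powr (1 - \<beta>) = C powr \<Theta>" using \<beta> by (simp add: t_def powr_powr)
      have t2: "(k * C) powr (1 / a) = k powr \<Theta> * C powr \<Theta>" using k elim by (simp add: powr_mult \<Theta>)
      have "Phi \<alpha> \<beta> D h C \<le> (M + k powr \<Theta>) * C powr \<Theta>"
      proof (rule Phi_le)
        fix X assume "admissible \<alpha> \<beta> D h C X"
        then have "Bh_defect h X \<le> t powr (1 - \<beta>) * M + (k * C) powr (1 / a)"
          unfolding M_def k_def a_def using elim h \<alpha> \<beta> D t False
          by (intro Bh_defect_le_renyi_lt_1_small) (auto simp: a_def)
        then show "Bh_defect h X \<le> (M + k powr \<Theta>) * C powr \<Theta>"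
          by (simp only: t1 t2 distrib_right) (simp add: mult.commute)
      qed (use elim in blast)
      then show ?case using elim by blast
    qed
    then show ?thesis using c1(1) by blast
  qed
  then obtain c1 c2 where c: "0 < c1" "\<forall>\<^sub>F C in at_right 0. c1 * C powr \<Theta> \<le> Phi \<alpha> \<beta> D h C \<and> Phi \<alpha> \<beta> D h C \<le> c2 * C powr \<Theta>"
    by blast
  have "\<forall>\<^sub>F C in at_right 0. c1 * C powr \<Theta> \<le> Phi \<alpha> \<beta> D h C \<and> Phi \<alpha> \<beta> D h C \<le> max c1 c2 * C powr \<Theta>"
    using c(2)
  proof eventually_elim
    case (elim C)
    have "c2 * C powr \<Theta> \<le> max c1 c2 * C powr \<Theta>" by (intro mult_right_mono) auto
    then show ?case using elim by linarith
  qed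
  then show ?thesis using c(1) by (intro exI[of _ c1] exI[of _ "max c1 c2"]) auto
qed

theorem theorem1p2:
  fixes h :: nat and D :: real
  assumes "h \<ge> 2" and "D > 0"
  shows "(\<forall>\<alpha>::real. \<alpha> \<ge> 1 \<longrightarrow>
            ((\<lambda>C. Phi \<alpha> 1 D h C * ln (1 / C)) \<longlongrightarrow> (real h * \<alpha> - 1) * D) (at_right 0))
       \<and> (\<forall>\<alpha> \<beta>::real. \<alpha> \<ge> 1 \<and> \<beta> > 1 \<longrightarrow>
            ((\<lambda>C. Phi \<alpha> \<beta> D h C) \<longlongrightarrow> 1 - exp (- ((\<beta> - 1) * D / \<beta>))) (at_right 0))
       \<and> (\<forall>\<alpha> \<beta>::real. 0 < \<beta> \<and> \<beta> < 1 \<and> \<alpha> \<ge> \<beta> \<longrightarrow>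
            (let \<Theta> = min (1 / (real h * \<alpha>)) ((1 - \<beta>) / (real h * \<alpha> - \<beta>)) in
             \<exists>c1 c2::real. 0 < c1 \<and> c1 \<le> c2 \<and>
               (\<forall>\<^sub>F C in at_right 0.
                  c1 * C powr \<Theta> \<le> Phi \<alpha> \<beta> D h C \<and> Phi \<alpha> \<beta> D h C \<le> c2 * C powr \<Theta>)))"
  unfolding Let_def
proof (intro conjI allI impI)
  show "((\<lambda>C. Phi \<alpha> 1 D h C * ln (1 / C)) \<longlongrightarrow> (real h * \<alpha> - 1) * D) (at_right 0)"
    if "\<alpha> \<ge> 1" for \<alpha> :: real
    using Phi_limit_shannon assms that by blast
  show "((\<lambda>C. Phi \<alpha> \<beta> D h C) \<longlongrightarrow> 1 - exp (- ((\<beta> - 1) * D / \<beta>))) (at_right 0)"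
    if "\<alpha> \<ge> 1 \<and> \<beta> > 1" for \<alpha> \<beta> :: real
    using Phi_limit_renyi_gt_1 assms that by blast
qed (use Phi_bounds_renyi_lt_1 assms in blast)

end
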